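(* Let $S$ be an untwisted simple group of Lie type with a split $BN$-pair of rank $\ell\geq2$, let $\Delta$ be the node set of its Dynkin diagram, and let $\mathrm{Inn}(S)\leq X\leq\mathrm{Aut}(S)$. Fix $J\subsetneq\Delta$ and put $V:=Q_J$. Suppose that (a) the $S$-class $[Q_J]$ is $X$-stable, and (b) for every $J\subsetneq K\subsetneq\Delta$ the class $[Q_K]$ is not $X$-stable. Then $[V]\in\mathcal{P}_X(S)$, $[V]$ is a maximal element of $\mathcal{P}_X(S)$, and $V$ is normally saturating. Consequently, for every $k\ge 1$ and every finite group $G$ with unique minimal normal subgroup $N=S^k$ and coordinate closure $X$, in a normalized coordinate model $N\leq G\leq X\wr S_k$, the subgroup $B_V:=N_G(V^k)$ satisfies $B_V\cap N=V^k$, $B_VN=G$, $|B_V|=|G/N|\cdot|V|^k$, $B_V$ is maximal in $G$, and $B_V$ is not conjugate in $G$ to $B_W:=N_G(W^k)$ for any $[W]\in\mathcal{P}_X(S)$ with $[W]\neq[V]$.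
   Context: Parabolics: $B=U\rtimes T$ is a Borel subgroup of $S$ with unipotent radical $U$ and maximal torus $T$. For $J\subseteq\Delta$, $Q_J\supseteq B$ is the standard parabolic whose Levi subgroup $L_J$ is generated by $T$ and the root subgroups corresponding to $J$ (i.e. the root subgroups for the roots in the subsystem spanned by $J$); so $Q_\varnothing=B$ and $Q_\Delta=S$. Stable classes: for $V\leq S$, $[V]$ is the $S$-conjugacy class of $V$. The class $[V]$ is $X$-stable if the image of $V$ under every $a\in X$ is $S$-conjugate to $V$. Define $\mathcal{P}_X(S):=\{[V] : 1<V<S,\ N_S(V)=V,\ [V]\ X\text{-stable}\}$, partially ordered by $[V]\leq[U]$ iff $V\leq U^s$ for some $s\in S$. A subgroup $V$ is normally saturating if the normal closure $\langle V^W\rangle$ of $V$ in $W$ equals $W$ for every subgroup $W$ with $V\leq W\leq S$. Normalized coordinate model: conjugation on $N=S^k$ (factors $S_1,\dots,S_k$, each identified with $S$) embeds $G$ in $\mathrm{Aut}(N)=\mathrm{Aut}(S)\wr S_k=\mathrm{Aut}(S)^k\rtimes S_k$, with $N$ mapping onto $\mathrm{Inn}(S)^k$ and $G$ transitive on the factors. Let $G_1$ be the stabilizer of $S_1$ and $\pi_1\colon G_1\to\mathrm{Aut}(S)$ the map recording the automorphism induced on $S_1\cong S$; the coordinate closure is $X:=\pi_1(G_1)\mathrm{Inn}(S)$. The model is normalized if $G\leq X\wr S_k$, i.e. for every $g\in G$ carrying $S_i$ to $S_j$ by conjugation, the induced automorphism $S\cong S_i\to S_j\cong S$ lies in $X$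 (this can always be arranged by conjugating by an element of $\mathrm{Aut}(S)^k$ without changing $X$). *)

theory Defs
  imports "HOL-Analysis.Analysis" "HOL-Algebra.SimpleGroups" "HOL-Algebra.Product_Groups"
    "HOL-Algebra.Elementary_Groups" "HOL-Algebra.Group_Action" "HOL-Algebra.Bij"
begin

section \<open>Root systems\<close>

definition coroot :: "'v::euclidean_space \<Rightarrow> 'v" where
  "coroot r = (2 / (r \<bullet> r)) *\<^sub>R r"

definition reflection :: "'v::euclidean_space \<Rightarrow> 'v \<Rightarrow> 'v" where
  "reflection r s = s - (coroot r \<bullet> s) *\<^sub>R r"

text \<open>Irreducible, reduced, crystallographic root systems; the rank is the dimension of the
  ambient space.\<close>

definition irreducible_root_system :: "'v::euclidean_space set \<Rightarrow> bool" where
  "irreducible_root_system \<Phi> \<longleftrightarrow>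
     finite \<Phi> \<and> span \<Phi> = UNIV \<and> 0 \<notin> \<Phi> \<and>
     (\<forall>r\<in>\<Phi>. \<forall>s\<in>\<Phi>. reflection r s \<in> \<Phi>) \<and>
     (\<forall>r\<in>\<Phi>. \<forall>s\<in>\<Phi>. coroot r \<bullet> s \<in> \<int>) \<and>
     (\<forall>r\<in>\<Phi>. \<forall>a. a *\<^sub>R r \<in> \<Phi> \<longrightarrow> a = 1 \<or> a = - 1) \<and>
     \<Phi> \<noteq> {} \<and>
     (\<forall>A\<subseteq>\<Phi>. (\<forall>r\<in>A. \<forall>s\<in>\<Phi> - A. r \<bullet> s = 0) \<longrightarrow> A = {} \<or> A = \<Phi>)"

definition simple_system :: "'v::euclidean_space set \<Rightarrow> 'v set \<Rightarrow> bool" where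
  "simple_system \<Phi> \<Delta> \<longleftrightarrow>
     \<Delta> \<subseteq> \<Phi> \<and> independent \<Delta> \<and> span \<Delta> = UNIV \<and>
     (\<forall>r\<in>\<Phi>. (\<forall>a\<in>\<Delta>. representation \<Delta> r a \<in> \<nat>) \<or> (\<forall>a\<in>\<Delta>. - representation \<Delta> r a \<in> \<nat>))"

definition positive_roots :: "'v::euclidean_space set \<Rightarrow> 'v set \<Rightarrow> 'v set" where
  "positive_roots \<Phi> \<Delta> = {r \<in> \<Phi>. \<forall>a\<in>\<Delta>. 0 \<le> representation \<Delta> r a}"

section \<open>Chevalley bases\<close>

text \<open>A Chevalley basis of the simple Lie algebra of type \<open>\<Phi>\<close> consists of the simple coroots
  \<open>h\<^sub>a\<close> (for a simple root a), written \<open>Hb a\<close>, and root vectors \<open>e\<^sub>r\<close> (for a root r),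
  written \<open>Eb r\<close>. Coordinate vectors are functions vanishing outside
  \<open>chev_basis \<Phi> \<Delta>\<close>.\<close>

datatype 'v basis_index = Hb 'v | Eb 'v

definition chev_basis :: "'v set \<Rightarrow> 'v set \<Rightarrow> 'v basis_index set" where
  "chev_basis \<Phi> \<Delta> = Hb ` \<Delta> \<union> Eb ` \<Phi>"

definition unit_vec :: "'i \<Rightarrow> 'i \<Rightarrow> int" where
  "unit_vec i j = (if j = i then 1 else 0)"

text \<open>The floors below are taken of integers only, as \<open>\<Phi>\<close> is crystallographic. The third clause
  of \<open>basis_bracket\<close> is \<open>[e\<^sub>r, e\<^sub>-\<^sub>r] = h\<^sub>r\<close>, where \<open>h\<^sub>r\<close> is the coroot of r, expanded in simple
  coroots; \<open>c r s\<close> is the structure constant in \<open>[e\<^sub>r, e\<^sub>s] = c r s e\<^sub>r\<^sub>+\<^sub>s\<close>.\<close>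

definition coroot_vec :: "'v::euclidean_space set \<Rightarrow> 'v \<Rightarrow> 'v basis_index \<Rightarrow> int" where
  "coroot_vec \<Delta> r j = (case j of
      Hb a \<Rightarrow> if a \<in> \<Delta> then \<lfloor>representation (coroot ` \<Delta>) (coroot r) (coroot a)\<rfloor> else 0
    | Eb s \<Rightarrow> 0)"

fun basis_bracket :: "'v::euclidean_space set \<Rightarrow> 'v set \<Rightarrow> ('v \<Rightarrow> 'v \<Rightarrow> int) \<Rightarrow>
    'v basis_index \<Rightarrow> 'v basis_index \<Rightarrow> 'v basis_index \<Rightarrow> int" where
  "basis_bracket \<Phi> \<Delta> c (Hb a) (Hb b) j = 0"
| "basis_bracket \<Phi> \<Delta> c (Hb a) (Eb s) j = \<lfloor>coroot a \<bullet> s\<rfloor> * unit_vec (Eb s) j"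
| "basis_bracket \<Phi> \<Delta> c (Eb s) (Hb a) j = - \<lfloor>coroot a \<bullet> s\<rfloor> * unit_vec (Eb s) j"
| "basis_bracket \<Phi> \<Delta> c (Eb r) (Eb s) j =
     (if s = - r then coroot_vec \<Delta> r j
      else if r + s \<in> \<Phi> then c r s * unit_vec (Eb (r + s)) j
      else 0)"

definition lie_bracket :: "'v::euclidean_space set \<Rightarrow> 'v set \<Rightarrow> ('v \<Rightarrow> 'v \<Rightarrow> int) \<Rightarrow>
    ('v basis_index \<Rightarrow> int) \<Rightarrow> ('v basis_index \<Rightarrow> int) \<Rightarrow> 'v basis_index \<Rightarrow> int" where
  "lie_bracket \<Phi> \<Delta> c x y j =
     (\<Sum>a\<in>chev_basis \<Phi> \<Delta>. \<Sum>b\<in>chev_basis \<Phi> \<Delta>. x a * y b * basis_bracket \<Phi> \<Delta> c a b j)"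

text \<open>\<open>c\<close> is a system of structure constants of a Chevalley basis: the bracket above defines
  an integral Lie algebra, and \<open>c r s = \<plusminus>(p + 1)\<close>, where p is the largest number with
  \<open>s - p r\<close> a root.\<close>

definition chevalley_constants ::
    "'v::euclidean_space set \<Rightarrow> 'v set \<Rightarrow> ('v \<Rightarrow> 'v \<Rightarrow> int) \<Rightarrow> bool" where
  "chevalley_constants \<Phi> \<Delta> c \<longleftrightarrow>
     (\<forall>r\<in>\<Phi>. \<forall>s\<in>\<Phi>. r + s \<in> \<Phi> \<longrightarrow>
        \<bar>c r s\<bar> = int (Max {p. s - real p *\<^sub>R r \<in> \<Phi>}) + 1) \<and>
     (\<forall>x. lie_bracket \<Phi> \<Delta> c x x = (\<lambda>j. 0)) \<and>
     (\<forall>x y z j. lie_bracket \<Phi> \<Delta> c x (lie_bracket \<Phi> \<Delta> c y z) j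
              + lie_bracket \<Phi> \<Delta> c y (lie_bracket \<Phi> \<Delta> c z x) j
              + lie_bracket \<Phi> \<Delta> c z (lie_bracket \<Phi> \<Delta> c x y) j = 0)"

section \<open>Adjoint Chevalley groups\<close>

definition chev_space :: "'v set \<Rightarrow> 'v set \<Rightarrow> ('v basis_index \<Rightarrow> 'k::field) set" where
  "chev_space \<Phi> \<Delta> = {f. \<forall>j. j \<notin> chev_basis \<Phi> \<Delta> \<longrightarrow> f j = 0}"

text \<open>The root element \<open>x\<^sub>r(t) = exp (t ad e\<^sub>r)\<close>. The coordinates of \<open>(ad e\<^sub>r)\<^sup>i b\<close> for a
  basis vector b are divisible by \<open>i!\<close>, and \<open>(ad e\<^sub>r)\<^sup>4 = 0\<close> because root strings have length
  at most four; so the divided powers are computed over the integers and then reduced to the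
  field.\<close>

definition root_elt :: "'v::euclidean_space set \<Rightarrow> 'v set \<Rightarrow> ('v \<Rightarrow> 'v \<Rightarrow> int) \<Rightarrow> 'v \<Rightarrow> 'k::field \<Rightarrow>
    ('v basis_index \<Rightarrow> 'k) \<Rightarrow> 'v basis_index \<Rightarrow> 'k" where
  "root_elt \<Phi> \<Delta> c r t =
     (\<lambda>f \<in> chev_space \<Phi> \<Delta>. \<lambda>j. \<Sum>b\<in>chev_basis \<Phi> \<Delta>. f b *
        (\<Sum>i\<le>3. t ^ i *
           of_int (((lie_bracket \<Phi> \<Delta> c (unit_vec (Eb r)) ^^ i) (unit_vec b)) j div fact i)))"

type_synonym ('v, 'k) lin = "('v basis_index \<Rightarrow> 'k) \<Rightarrow> ('v basis_index \<Rightarrow> 'k)"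

definition root_subgroup :: "'v::euclidean_space set \<Rightarrow> 'v set \<Rightarrow> ('v \<Rightarrow> 'v \<Rightarrow> int) \<Rightarrow> 'v \<Rightarrow>
    ('v, 'k::field) lin set" where
  "root_subgroup \<Phi> \<Delta> c r = range (root_elt \<Phi> \<Delta> c r)"

definition chevalley_group :: "'v::euclidean_space set \<Rightarrow> 'v set \<Rightarrow> ('v \<Rightarrow> 'v \<Rightarrow> int) \<Rightarrow>
    ('v, 'k::field) lin monoid" where
  "chevalley_group \<Phi> \<Delta> c =
     subgroup_generated (BijGroup (chev_space \<Phi> \<Delta>)) (\<Union>r\<in>\<Phi>. root_subgroup \<Phi> \<Delta> c r)"

definition weyl_elt :: "'v::euclidean_space set \<Rightarrow> 'v set \<Rightarrow> ('v \<Rightarrow> 'v \<Rightarrow> int) \<Rightarrow> 'v \<Rightarrow> 'k::field \<Rightarrow>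
    ('v, 'k) lin" where
  "weyl_elt \<Phi> \<Delta> c r t =
     (let S = chevalley_group \<Phi> \<Delta> c in
      root_elt \<Phi> \<Delta> c r t \<otimes>\<^bsub>S\<^esub> root_elt \<Phi> \<Delta> c (- r) (- inverse t) \<otimes>\<^bsub>S\<^esub> root_elt \<Phi> \<Delta> c r t)"

definition torus_elt :: "'v::euclidean_space set \<Rightarrow> 'v set \<Rightarrow> ('v \<Rightarrow> 'v \<Rightarrow> int) \<Rightarrow> 'v \<Rightarrow> 'k::field \<Rightarrow>
    ('v, 'k) lin" where
  "torus_elt \<Phi> \<Delta> c r t =
     weyl_elt \<Phi> \<Delta> c r t \<otimes>\<^bsub>chevalley_group \<Phi> \<Delta> c\<^esub> weyl_elt \<Phi> \<Delta> c r (- 1)"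

definition chev_U :: "'v::euclidean_space set \<Rightarrow> 'v set \<Rightarrow> ('v \<Rightarrow> 'v \<Rightarrow> int) \<Rightarrow>
    ('v, 'k::field) lin set" where
  "chev_U \<Phi> \<Delta> c =
     generate (chevalley_group \<Phi> \<Delta> c) (\<Union>r\<in>positive_roots \<Phi> \<Delta>. root_subgroup \<Phi> \<Delta> c r)"

definition chev_T :: "'v::euclidean_space set \<Rightarrow> 'v set \<Rightarrow> ('v \<Rightarrow> 'v \<Rightarrow> int) \<Rightarrow>
    ('v, 'k::field) lin set" where
  "chev_T \<Phi> \<Delta> c =
     generate (chevalley_group \<Phi> \<Delta> c) {torus_elt \<Phi> \<Delta> c r t | r t. r \<in> \<Phi> \<and> t \<noteq> 0}"

definition chev_B :: "'v::euclidean_space set \<Rightarrow> 'v set \<Rightarrow> ('v \<Rightarrow> 'v \<Rightarrow> int) \<Rightarrow>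
    ('v, 'k::field) lin set" where
  "chev_B \<Phi> \<Delta> c = chev_U \<Phi> \<Delta> c <#>\<^bsub>chevalley_group \<Phi> \<Delta> c\<^esub> chev_T \<Phi> \<Delta> c"

definition chev_N :: "'v::euclidean_space set \<Rightarrow> 'v set \<Rightarrow> ('v \<Rightarrow> 'v \<Rightarrow> int) \<Rightarrow>
    ('v, 'k::field) lin set" where
  "chev_N \<Phi> \<Delta> c =
     generate (chevalley_group \<Phi> \<Delta> c) {weyl_elt \<Phi> \<Delta> c r t | r t. r \<in> \<Phi> \<and> t \<noteq> 0}"

definition levi :: "'v::euclidean_space set \<Rightarrow> 'v set \<Rightarrow> ('v \<Rightarrow> 'v \<Rightarrow> int) \<Rightarrow> 'v set \<Rightarrow>
    ('v, 'k::field) lin set" where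
  "levi \<Phi> \<Delta> c J = generate (chevalley_group \<Phi> \<Delta> c)
     (chev_T \<Phi> \<Delta> c \<union> (\<Union>r\<in>\<Phi> \<inter> span J. root_subgroup \<Phi> \<Delta> c r))"

definition std_parabolic :: "'v::euclidean_space set \<Rightarrow> 'v set \<Rightarrow> ('v \<Rightarrow> 'v \<Rightarrow> int) \<Rightarrow> 'v set \<Rightarrow>
    ('v, 'k::field) lin set" where
  "std_parabolic \<Phi> \<Delta> c J =
     generate (chevalley_group \<Phi> \<Delta> c) (chev_B \<Phi> \<Delta> c \<union> levi \<Phi> \<Delta> c J)"

section \<open>Split BN-pairs\<close>

text \<open>A split BN-pair of characteristic p with \<open>B = U \<rtimes> T\<close>. The Weyl group \<open>N / T\<close> has the
  distinguished generators \<open>n i T\<close> for i in I, and the rank is the cardinality of I.\<close>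

definition split_BN_pair :: "nat \<Rightarrow> ('a, 'b) monoid_scheme \<Rightarrow> 'a set \<Rightarrow> 'a set \<Rightarrow> 'a set \<Rightarrow> 'a set \<Rightarrow>
    'i set \<Rightarrow> ('i \<Rightarrow> 'a) \<Rightarrow> bool" where
  "split_BN_pair p G B N U T I n \<longleftrightarrow>
     \<comment> \<open>BN-pair\<close>
     subgroup B G \<and> subgroup N G \<and> generate G (B \<union> N) = carrier G \<and>
     B \<inter> N = T \<and> T \<lhd> (G\<lparr>carrier := N\<rparr>) \<and>
     n ` I \<subseteq> N \<and> generate G (T \<union> n ` I) = N \<and>
     (\<forall>i\<in>I. n i \<notin> T \<and> n i \<otimes>\<^bsub>G\<^esub> n i \<in> T) \<and>
     (\<forall>i\<in>I. \<forall>j\<in>I. i \<noteq> j \<longrightarrow> n i <#\<^bsub>G\<^esub> T \<noteq> n j <#\<^bsub>G\<^esub> T) \<and>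
     (\<forall>i\<in>I. \<forall>w\<in>N. n i <#\<^bsub>G\<^esub> B #>\<^bsub>G\<^esub> w \<subseteq>
        (B #>\<^bsub>G\<^esub> (n i \<otimes>\<^bsub>G\<^esub> w) <#>\<^bsub>G\<^esub> B) \<union> (B #>\<^bsub>G\<^esub> w <#>\<^bsub>G\<^esub> B)) \<and>
     (\<forall>i\<in>I. n i <#\<^bsub>G\<^esub> B #>\<^bsub>G\<^esub> inv\<^bsub>G\<^esub> (n i) \<noteq> B) \<and>
     \<comment> \<open>split\<close>
     U \<lhd> (G\<lparr>carrier := B\<rparr>) \<and> U <#>\<^bsub>G\<^esub> T = B \<and> U \<inter> T = {\<one>\<^bsub>G\<^esub>} \<and>
     (\<exists>m. card U = p ^ m) \<and>
     (\<forall>x\<in>T. \<forall>y\<in>T. x \<otimes>\<^bsub>G\<^esub> y = y \<otimes>\<^bsub>G\<^esub> x) \<and> coprime (card T) p \<and>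
     (\<Inter>w\<in>N. w <#\<^bsub>G\<^esub> B #>\<^bsub>G\<^esub> inv\<^bsub>G\<^esub> w) = T"

section \<open>Stable classes of subgroups\<close>

definition conj_class :: "('a, 'b) monoid_scheme \<Rightarrow> 'a set \<Rightarrow> 'a set set" where
  "conj_class G V = {x <#\<^bsub>G\<^esub> V #>\<^bsub>G\<^esub> inv\<^bsub>G\<^esub> x | x. x \<in> carrier G}"

definition inner_auts :: "('a, 'b) monoid_scheme \<Rightarrow> ('a \<Rightarrow> 'a) set" where
  "inner_auts G = {\<lambda>x\<in>carrier G. g \<otimes>\<^bsub>G\<^esub> x \<otimes>\<^bsub>G\<^esub> inv\<^bsub>G\<^esub> g | g. g \<in> carrier G}"

definition stable_class :: "('a, 'b) monoid_scheme \<Rightarrow> ('a \<Rightarrow> 'a) set \<Rightarrow> 'a set \<Rightarrow> bool" where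
  "stable_class S X V \<longleftrightarrow> (\<forall>a\<in>X. a ` V \<in> conj_class S V)"

definition stable_poset :: "('a, 'b) monoid_scheme \<Rightarrow> ('a \<Rightarrow> 'a) set \<Rightarrow> 'a set set set" where
  "stable_poset S X =
     {conj_class S V | V. subgroup V S \<and> {\<one>\<^bsub>S\<^esub>} \<subset> V \<and> V \<subset> carrier S \<and>
        normalizer S V = V \<and> stable_class S X V}"

definition class_le :: "('a, 'b) monoid_scheme \<Rightarrow> 'a set set \<Rightarrow> 'a set set \<Rightarrow> bool" where
  "class_le S C D \<longleftrightarrow>
     (\<exists>V U. subgroup V S \<and> subgroup U S \<and> C = conj_class S V \<and> D = conj_class S U \<and>
        (\<exists>s\<in>carrier S. V \<subseteq> inv\<^bsub>S\<^esub> s <#\<^bsub>S\<^esub> U #>\<^bsub>S\<^esub> s))"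

definition maximal_class :: "('a, 'b) monoid_scheme \<Rightarrow> ('a \<Rightarrow> 'a) set \<Rightarrow> 'a set set \<Rightarrow> bool" where
  "maximal_class S X C \<longleftrightarrow>
     C \<in> stable_poset S X \<and> (\<forall>D\<in>stable_poset S X. class_le S C D \<longrightarrow> D = C)"

definition normal_closure :: "('a, 'b) monoid_scheme \<Rightarrow> 'a set \<Rightarrow> 'a set \<Rightarrow> 'a set" where
  "normal_closure S W V = generate S (\<Union>w\<in>W. w <#\<^bsub>S\<^esub> V #>\<^bsub>S\<^esub> inv\<^bsub>S\<^esub> w)"

definition normally_saturating :: "('a, 'b) monoid_scheme \<Rightarrow> 'a set \<Rightarrow> bool" where
  "normally_saturating S V \<longleftrightarrow>
     subgroup V S \<and> (\<forall>W. subgroup W S \<and> V \<subseteq> W \<longrightarrow> normal_closure S W V = W)"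

section \<open>Coordinate models\<close>

definition minimal_normal :: "('g, 'b) monoid_scheme \<Rightarrow> 'g set \<Rightarrow> bool" where
  "minimal_normal G N \<longleftrightarrow>
     N \<lhd> G \<and> N \<noteq> {\<one>\<^bsub>G\<^esub>} \<and> (\<forall>M. M \<lhd> G \<and> M \<subseteq> N \<longrightarrow> M = {\<one>\<^bsub>G\<^esub>} \<or> M = N)"

definition unique_minimal_normal :: "('g, 'b) monoid_scheme \<Rightarrow> 'g set \<Rightarrow> bool" where
  "unique_minimal_normal G N \<longleftrightarrow>
     minimal_normal G N \<and> (\<forall>M. minimal_normal G M \<longrightarrow> M = N)"

abbreviation pow_group :: "('a, 'b) monoid_scheme \<Rightarrow> nat \<Rightarrow> (nat \<Rightarrow> 'a) monoid" where
  "pow_group S k \<equiv> product_group {1..k} (\<lambda>_. S)"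

abbreviation pow_set :: "'a set \<Rightarrow> nat \<Rightarrow> (nat \<Rightarrow> 'a) set" where
  "pow_set V k \<equiv> PiE {1..k} (\<lambda>_. V)"

definition factor_emb :: "('a, 'b) monoid_scheme \<Rightarrow> nat \<Rightarrow> nat \<Rightarrow> 'a \<Rightarrow> nat \<Rightarrow> 'a" where
  "factor_emb S k i s = (\<lambda>j\<in>{1..k}. if j = i then s else \<one>\<^bsub>S\<^esub>)"

text \<open>In the following, \<open>\<phi>\<close> is an isomorphism from \<open>S\<^sup>k\<close> to a normal subgroup of G, that is, a
  choice of coordinates. \<open>coord_conj\<close> maps g to the automorphism of \<open>S\<^sup>k\<close> given by
  conjugation with g in these coordinates.\<close>

definition coord_conj :: "('a, 'b) monoid_scheme \<Rightarrow> nat \<Rightarrow> ('g, 'c) monoid_scheme \<Rightarrow>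
    ((nat \<Rightarrow> 'a) \<Rightarrow> 'g) \<Rightarrow> 'g \<Rightarrow> (nat \<Rightarrow> 'a) \<Rightarrow> (nat \<Rightarrow> 'a)" where
  "coord_conj S k G \<phi> g =
     (\<lambda>f\<in>carrier (pow_group S k).
        inv_into (carrier (pow_group S k)) \<phi> (g \<otimes>\<^bsub>G\<^esub> \<phi> f \<otimes>\<^bsub>G\<^esub> inv\<^bsub>G\<^esub> g))"

definition first_factor_stabilizer :: "('a, 'b) monoid_scheme \<Rightarrow> nat \<Rightarrow> ('g, 'c) monoid_scheme \<Rightarrow>
    ((nat \<Rightarrow> 'a) \<Rightarrow> 'g) \<Rightarrow> 'g set" where
  "first_factor_stabilizer S k G \<phi> =
     {g \<in> carrier G. coord_conj S k G \<phi> g ` factor_emb S k 1 ` carrier S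
        = factor_emb S k 1 ` carrier S}"

definition first_coord_aut :: "('a, 'b) monoid_scheme \<Rightarrow> nat \<Rightarrow> ('g, 'c) monoid_scheme \<Rightarrow>
    ((nat \<Rightarrow> 'a) \<Rightarrow> 'g) \<Rightarrow> 'g \<Rightarrow> 'a \<Rightarrow> 'a" where
  "first_coord_aut S k G \<phi> g =
     (\<lambda>s\<in>carrier S. coord_conj S k G \<phi> g (factor_emb S k 1 s) 1)"

definition coordinate_closure :: "('a, 'b) monoid_scheme \<Rightarrow> nat \<Rightarrow> ('g, 'c) monoid_scheme \<Rightarrow>
    ((nat \<Rightarrow> 'a) \<Rightarrow> 'g) \<Rightarrow> ('a \<Rightarrow> 'a) set" where
  "coordinate_closure S k G \<phi> =
     first_coord_aut S k G \<phi> ` first_factor_stabilizer S k G \<phi> <#>\<^bsub>AutoGroup S\<^esub> inner_auts S"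

text \<open>The wreath product of X with the symmetric group of degree k, as a set of automorphisms
  of \<open>S\<^sup>k\<close>.\<close>

definition wreath_auts :: "('a, 'b) monoid_scheme \<Rightarrow> nat \<Rightarrow> ('a \<Rightarrow> 'a) set \<Rightarrow>
    ((nat \<Rightarrow> 'a) \<Rightarrow> (nat \<Rightarrow> 'a)) set" where
  "wreath_auts S k X =
     {\<lambda>f\<in>carrier (pow_group S k). \<lambda>i\<in>{1..k}. a i (f (\<sigma> i)) | a \<sigma>.
        (\<forall>i\<in>{1..k}. a i \<in> X) \<and> bij_betw \<sigma> {1..k} {1..k}}"

text \<open>G is a finite group whose unique minimal normal subgroup N is identified with \<open>S\<^sup>k\<close> by
  \<open>\<phi>\<close>, with coordinate closure X, such that conjugation maps G into the wreath product of X
  with the symmetric group.\<close>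

definition normalized_model :: "('a, 'b) monoid_scheme \<Rightarrow> ('a \<Rightarrow> 'a) set \<Rightarrow> nat \<Rightarrow>
    ('g, 'c) monoid_scheme \<Rightarrow> 'g set \<Rightarrow> ((nat \<Rightarrow> 'a) \<Rightarrow> 'g) \<Rightarrow> bool" where
  "normalized_model S X k G N \<phi> \<longleftrightarrow>
     group G \<and> finite (carrier G) \<and> unique_minimal_normal G N \<and>
     \<phi> \<in> iso (pow_group S k) (G\<lparr>carrier := N\<rparr>) \<and>
     coordinate_closure S k G \<phi> = X \<and>
     coord_conj S k G \<phi> ` carrier G \<subseteq> wreath_auts S k X"

text \<open>\<open>power_normalizer G \<phi> k V\<close> is the subgroup \<open>N\<^sub>G(V\<^sup>k)\<close>.\<close>

definition power_normalizer :: "('g, 'c) monoid_scheme \<Rightarrow> ((nat \<Rightarrow> 'a) \<Rightarrow> 'g) \<Rightarrow> nat \<Rightarrow> 'a set \<Rightarrow>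
    'g set" where
  "power_normalizer G \<phi> k V = normalizer G (\<phi> ` pow_set V k)"

definition maximal_subgroup :: "('g, 'c) monoid_scheme \<Rightarrow> 'g set \<Rightarrow> bool" where
  "maximal_subgroup G M \<longleftrightarrow>
     subgroup M G \<and> M \<noteq> carrier G \<and> (\<forall>H. subgroup H G \<and> M \<subset> H \<longrightarrow> H = carrier G)"

end

theory Submission
  imports Defs "HOL-Algebra.SndIsomorphismGrp"
begin

text \<open>In a group with a BN-pair, \<open>B\<^sup>g \<subseteq> P\<close> for an overgroup P of B forces g into P, and P is generated by
  B and the \<open>n\<^sub>a\<close> it contains. So overgroups of B are self-normalizing and normally saturating, and they
  are exactly the \<open>Q\<^sub>K\<close> provided that \<open>n\<^sub>a\<close> lies in \<open>Q\<^sub>K\<close> only for a in K. The latter is the one place where the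
  Chevalley construction enters: for a outside K, \<open>Q\<^sub>K\<close> preserves the subspace of the Lie algebra spanned by the
  weight spaces whose weight has nonnegative a-coefficient, and \<open>x\<^sub>-\<^sub>a(1)\<close> does not. By (b), the only
  X-stable overgroups of V are V and S.

  Stability of V gives \<open>G = B\<^sub>V N\<close> by a Frattini argument. If \<open>B\<^sub>V < H \<le> G\<close>, normal saturation makes
  \<open>H \<inter> N\<close> a product of overgroups \<open>W\<^sub>i\<close> of V in the factors. As \<open>G = HN\<close>, conjugation by G permutes
  the \<open>W\<^sub>i\<close> up to X and inner automorphisms, so \<open>W\<^sub>1\<close> is X-stable and all \<open>W\<^sub>i\<close> equal V, or all equal S;
  the first makes H normalize \<open>V\<^sup>k\<close>, the second gives \<open>N \<le> H\<close> and \<open>H = G\<close>.\<close>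

section \<open>Conjugation of subgroups\<close>

text \<open>The delicate point is that \<open>Q_K\<close> is defined by generators, while the
  BN-pair is a hypothesis about B, N and the \<open>n_a\<close>. Abstract BN-theory describes the
  overgroups of B, but cannot exclude that some root subgroup brings an extra \<open>n_a\<close>
  into \<open>Q_K\<close>. Excluding this needs an invariant subspace, and the generators whose
  action on it cannot be read off from their definition are the torus elements: products of two Weyl
  elements, each a product of three exponentials. They have to be shown to preserve every weight
  space. In characteristic 2 or 3 the exponential series cannot be manipulated directly, so the
  identities of sl2 are proved for integer operators scaled by powers of six, the scaling is
  cancelled over the integers, and only then is the result reduced to the field. The parameter t
  enters afterwards, through conjugation by a diagonal matrix of powers of t, so that only t = 1 has
  to be computed.

  On the side of G, the coordinate closure sees only the first factor. Minimality of N supplies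
  transitivity on the factors, and normalization of the model keeps the transfer from the first
  factor to the others inside X.\<close>

lemma coset_conj_eq_image: "g <#\<^bsub>G\<^esub> A #>\<^bsub>G\<^esub> h = (\<lambda>x. g \<otimes>\<^bsub>G\<^esub> x \<otimes>\<^bsub>G\<^esub> h) ` A"
  by (auto simp: l_coset_def r_coset_def)

context group
begin

lemma cancel_left1: "\<lbrakk>x \<in> carrier G; y \<in> carrier G\<rbrakk> \<Longrightarrow> inv x \<otimes> (x \<otimes> y) = y"
  by (simp flip: m_assoc)

lemma cancel_left2: "\<lbrakk>x \<in> carrier G; y \<in> carrier G\<rbrakk> \<Longrightarrow> x \<otimes> (inv x \<otimes> y) = y"
  by (simp flip: m_assoc)

lemmas group_simps = m_assoc inv_mult_group cancel_left1 cancel_left2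

abbreviation conj_set :: "'a \<Rightarrow> 'a set \<Rightarrow> 'a set" where
  "conj_set g A \<equiv> (\<lambda>x. g \<otimes> x \<otimes> inv g) ` A"

lemma normalizer_iff:
  assumes "H \<subseteq> carrier G"
  shows "g \<in> normalizer G H \<longleftrightarrow> g \<in> carrier G \<and> conj_set g H = H"
  using assms by (auto simp: normalizer_def stabilizer_def coset_conj_eq_image)

lemma conj_set_mult:
  assumes "H \<subseteq> carrier G" "g \<in> carrier G" "h \<in> carrier G"
  shows "conj_set (g \<otimes> h) H = conj_set g (conj_set h H)"
proof -
  have "(g \<otimes> h) \<otimes> x \<otimes> inv (g \<otimes> h) = g \<otimes> (h \<otimes> x \<otimes> inv h) \<otimes> inv g" if "x \<in> H" for x
    using that assms by (simp add: group_simps subset_iff)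
  then show ?thesis by (auto simp: image_image intro!: image_cong)
qed

lemma conj_set_one: "H \<subseteq> carrier G \<Longrightarrow> conj_set \<one> H = H"
  by (auto simp: subset_iff image_iff)

lemma conj_set_carrier: "\<lbrakk>H \<subseteq> carrier G; g \<in> carrier G\<rbrakk> \<Longrightarrow> conj_set g H \<subseteq> carrier G"
  by auto

lemma conj_set_inv:
  assumes "H \<subseteq> carrier G" "g \<in> carrier G"
  shows "conj_set (inv g) (conj_set g H) = H"
  using conj_set_mult[of H "inv g" g] assms conj_set_one by simp

lemma conj_class_iff: "V' \<in> conj_class G V \<longleftrightarrow> (\<exists>g\<in>carrier G. V' = conj_set g V)"
  by (auto simp: conj_class_def coset_conj_eq_image)

lemma conj_class_self: "V \<subseteq> carrier G \<Longrightarrow> V \<in> conj_class G V"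
  unfolding conj_class_iff using conj_set_one by (metis one_closed)

lemma conj_class_eq:
  assumes "V \<subseteq> carrier G" "V' \<in> conj_class G V"
  shows "conj_class G V' = conj_class G V"
proof -
  obtain g where g: "g \<in> carrier G" "V' = conj_set g V" using assms conj_class_iff by metis
  have "conj_set h V' = conj_set (h \<otimes> g) V" if "h \<in> carrier G" for h
    using g that assms conj_set_mult by simp
  moreover have "conj_set h V = conj_set (h \<otimes> inv g) V'" if "h \<in> carrier G" for h
    using g that assms conj_set_mult[of V "h \<otimes> inv g" g] by (simp add: m_assoc)
  ultimately show ?thesis
    using g unfolding conj_class_iff set_eq_iff by (metis inv_closed m_closed)
qed

lemma subgroup_conj_set:
  assumes "subgroup H G" "g \<in> carrier G"
  shows "subgroup (conj_set g H) G"
  using subgroup_conjugation_is_surj2[OF assms(2,1)] by (simp add: coset_conj_eq_image)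

lemma normalizer_conj_set:
  assumes "H \<subseteq> carrier G" "g \<in> carrier G"
  shows "normalizer G (conj_set g H) = conj_set g (normalizer G H)"
proof
  show "conj_set g (normalizer G H) \<subseteq> normalizer G (conj_set g H)"
  proof clarify
    fix x assume x: "x \<in> normalizer G H"
    then have "x \<in> carrier G" "conj_set x H = H" using assms normalizer_iff by auto
    then have "conj_set (g \<otimes> x \<otimes> inv g) (conj_set g H) = conj_set g H"
      using assms conj_set_mult[of H "g \<otimes> x \<otimes> inv g" g] conj_set_mult[of H g x] by (simp add: m_assoc)
    then show "g \<otimes> x \<otimes> inv g \<in> normalizer G (conj_set g H)"
      using normalizer_iff[OF conj_set_carrier[OF assms]] assms \<open>x \<in> carrier G\<close> by simp
  qed
  show "normalizer G (conj_set g H) \<subseteq> conj_set g (normalizer G H)"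
  proof
    fix x assume "x \<in> normalizer G (conj_set g H)"
    then have x: "x \<in> carrier G" "conj_set x (conj_set g H) = conj_set g H"
      using normalizer_iff[OF conj_set_carrier[OF assms]] by auto
    then have "conj_set (inv g \<otimes> x \<otimes> g) H = H"
      using assms conj_set_mult[of H "inv g \<otimes> x" g] conj_set_mult[of "conj_set g H" "inv g" x] conj_set_inv
      by (simp add: conj_set_carrier)
    then have "inv g \<otimes> x \<otimes> g \<in> normalizer G H" using assms x normalizer_iff by simp
    moreover have "x = g \<otimes> (inv g \<otimes> x \<otimes> g) \<otimes> inv g" using assms x by (simp add: group_simps)
    ultimately show "x \<in> conj_set g (normalizer G H)" by blast
  qed
qed

text \<open>An automorphism a carries the g-conjugate of V to the conjugate of a(V) by a(g), so
  stability depends on the class only and representatives can be moved freely.\<close>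

lemma stable_class_conj:
  assumes X: "X \<subseteq> auto G" and V: "V \<subseteq> carrier G" "V' \<in> conj_class G V" "stable_class G X V"
  shows "stable_class G X V'"
  unfolding stable_class_def
proof
  fix a assume a: "a \<in> X"
  obtain g where g: "g \<in> carrier G" "V' = conj_set g V" using V conj_class_iff by metis
  have hom: "a \<in> hom G G" using a X by (auto simp: auto_def)
  then have ag: "a g \<in> carrier G" using g by (auto simp: hom_def)
  have "group_hom G G a" using hom by (simp add: group_hom_def group_hom_axioms_def is_group)
  have "a ` V' = conj_set (a g) (a ` V)"
  proof -
    have "a (g \<otimes> x \<otimes> inv g) = a g \<otimes> a x \<otimes> inv (a g)" if "x \<in> V" for x
    proof -
      have "x \<in> carrier G" using that V by auto
      then show ?thesis using g hom group_hom.hom_inv[OF \<open>group_hom G G a\<close> g(1)]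
        by (simp add: hom_mult)
    qed
    then show ?thesis using g by (auto simp: image_image intro!: image_cong)
  qed
  moreover obtain h where h: "h \<in> carrier G" "a ` V = conj_set h V"
    using V(3) a unfolding stable_class_def conj_class_iff by auto
  ultimately have "a ` V' = conj_set (a g) (conj_set h V)" by simp
  also have "\<dots> = conj_set (a g \<otimes> h) V" using conj_set_mult V h ag by simp
  finally have "a ` V' \<in> conj_class G V" using conj_class_iff ag h by blast
  then show "a ` V' \<in> conj_class G V'" using conj_class_eq V by simp
qed

lemma normal_closure_subset:
  assumes "subgroup E G" "\<And>w v. w \<in> W \<Longrightarrow> v \<in> V \<Longrightarrow> w \<otimes> v \<otimes> inv w \<in> E"
  shows "normal_closure G W V \<subseteq> E"
  unfolding normal_closure_def
  by (rule generate_subgroup_incl[OF _ assms(1)]) (use assms(2) in \<open>auto simp: coset_conj_eq_image\<close>)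

end

lemma (in normal) set_mult_commute_subgroup:
  assumes "subgroup K G" shows "K <#> H = H <#> K"
  using assms coset_eq subgroup.mem_carrier[OF assms]
  by (fastforce simp: set_mult_def r_coset_def l_coset_def)

text \<open>The second isomorphism theorem: K modulo its intersection with H is G modulo H once HK
  is everything. With H = N and K the normalizer of the power, this is the order formula.\<close>

lemma (in normal) card_supplement:
  assumes "finite (carrier G)" "subgroup K G" "H <#> K = carrier G"
  shows "card K = order (G Mod H) * card (K \<inter> H)"
proof -
  interpret K: group "G\<lparr>carrier := K\<rparr>" using assms subgroup_imp_group by blast
  interpret second_isomorphism_grp H G K
    using assms(2) normal_axioms
    by (simp add: second_isomorphism_grp_def second_isomorphism_grp_axioms_def)
  have "G\<lparr>carrier := K\<rparr> Mod (H \<inter> K) \<cong> G Mod H"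
    using normal_intersection_quotient_isom assms(3) by (auto simp: is_iso_def)
  then have "order (G\<lparr>carrier := K\<rparr> Mod (H \<inter> K)) = order (G Mod H)"
    using iso_same_card by (auto simp: order_def)
  moreover have "order (G\<lparr>carrier := K\<rparr> Mod (H \<inter> K)) * card (H \<inter> K) = card K"
    using K.lagrange[of "H \<inter> K"] normal_imp_subgroup[OF normal_subgrp_intersection_normal]
    by (simp add: FactGroup_def order_def Int_commute)
  ultimately show ?thesis by (simp add: Int_commute)
qed

section \<open>BN-pairs\<close>

locale BN_pair = group G for G (structure) +
  fixes B N T :: "'a set" and I :: "'i set" and n :: "'i \<Rightarrow> 'a"
  assumes B: "subgroup B G" and N: "subgroup N G"
    and generate_BN: "generate G (B \<union> N) = carrier G"
    and BN: "B \<inter> N = T"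
    and T_conj: "\<And>w t. \<lbrakk>w \<in> N; t \<in> T\<rbrakk> \<Longrightarrow> w \<otimes> t \<otimes> inv w \<in> T"
    and n_N: "\<And>i. i \<in> I \<Longrightarrow> n i \<in> N"
    and generate_N: "generate G (T \<union> n ` I) = N"
    and n_notin: "\<And>i. i \<in> I \<Longrightarrow> n i \<notin> T"
    and n_square: "\<And>i. i \<in> I \<Longrightarrow> n i \<otimes> n i \<in> T"
    and exchange: "\<And>i w b. \<lbrakk>i \<in> I; w \<in> N; b \<in> B\<rbrakk> \<Longrightarrow>
        (\<exists>b1\<in>B. \<exists>b2\<in>B. n i \<otimes> b \<otimes> w = b1 \<otimes> (n i \<otimes> w) \<otimes> b2) \<or>
        (\<exists>b1\<in>B. \<exists>b2\<in>B. n i \<otimes> b \<otimes> w = b1 \<otimes> w \<otimes> b2)"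
    and nondegenerate: "\<And>i. i \<in> I \<Longrightarrow> \<exists>b\<in>B. n i \<otimes> b \<otimes> inv (n i) \<notin> B"

context BN_pair
begin

lemma T_B: "t \<in> T \<Longrightarrow> t \<in> B" and T_N: "t \<in> T \<Longrightarrow> t \<in> N"
  using BN by auto

lemma B_carrier [simp]: "b \<in> B \<Longrightarrow> b \<in> carrier G" and N_carrier [simp]: "w \<in> N \<Longrightarrow> w \<in> carrier G"
  using B N subgroup.mem_carrier by fast+

lemma T_carrier [simp]: "t \<in> T \<Longrightarrow> t \<in> carrier G"
  using T_B by simp

lemma n_carrier [simp]: "i \<in> I \<Longrightarrow> n i \<in> carrier G"
  using n_N by simp

lemma T: "subgroup T G"
  using B N BN by (metis subgroups_Inter_pair)

lemma B_mult [simp]: "\<lbrakk>b \<in> B; b' \<in> B\<rbrakk> \<Longrightarrow> b \<otimes> b' \<in> B" and B_inv [simp]: "b \<in> B \<Longrightarrow> inv b \<in> B"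
  and B_one [simp]: "\<one> \<in> B"
  using B by (auto simp: subgroup.m_closed subgroup.m_inv_closed subgroup.one_closed)

lemma N_mult [simp]: "\<lbrakk>b \<in> N; b' \<in> N\<rbrakk> \<Longrightarrow> b \<otimes> b' \<in> N" and N_inv [simp]: "b \<in> N \<Longrightarrow> inv b \<in> N"
  and N_one [simp]: "\<one> \<in> N"
  using N by (auto simp: subgroup.m_closed subgroup.m_inv_closed subgroup.one_closed)

lemma T_mult [simp]: "\<lbrakk>b \<in> T; b' \<in> T\<rbrakk> \<Longrightarrow> b \<otimes> b' \<in> T" and T_inv [simp]: "b \<in> T \<Longrightarrow> inv b \<in> T"
  and T_one [simp]: "\<one> \<in> T"
  using T by (auto simp: subgroup.m_closed subgroup.m_inv_closed subgroup.one_closed)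

lemma T_conj': "\<lbrakk>w \<in> N; t \<in> T\<rbrakk> \<Longrightarrow> inv w \<otimes> t \<otimes> w \<in> T"
  using T_conj[of "inv w" t] by simp

lemma T_commute: assumes "w \<in> N" "t \<in> T" obtains t' where "t' \<in> T" "t \<otimes> w = w \<otimes> t'"
  using T_conj'[OF assms] assms by (intro that[of "inv w \<otimes> t \<otimes> w"]) (auto simp: group_simps)

lemma T_commute': assumes "w \<in> N" "t \<in> T" obtains t' where "t' \<in> T" "w \<otimes> t = t' \<otimes> w"
  using T_conj[OF assms] assms by (intro that[of "w \<otimes> t \<otimes> inv w"]) (auto simp: group_simps)

text \<open>As the square of \<open>n i\<close> lies in T, inverses of generators are again
  generators up to T; words and length can therefore be defined with positive letters only.\<close>

lemma inv_n: assumes "i \<in> I" obtains t where "t \<in> T" "inv (n i) = n i \<otimes> t"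
proof -
  have "n i \<otimes> inv (n i \<otimes> n i) = inv (n i)"
    using assms by (simp add: group_simps)
  then show ?thesis using that[of "inv (n i \<otimes> n i)"] n_square[OF assms] by auto
qed

section \<open>Words and length in the Weyl group N/T, with elements of N standing for their
  cosets\<close>

inductive word :: "nat \<Rightarrow> 'a \<Rightarrow> bool" where
  word_T: "t \<in> T \<Longrightarrow> word 0 t"
| word_n: "\<lbrakk>word m w; i \<in> I\<rbrakk> \<Longrightarrow> word (Suc m) (n i \<otimes> w)"

lemma word_N: "word m w \<Longrightarrow> w \<in> N"
  by (induction rule: word.induct) (auto simp: T_N n_N)

lemma word_left_T: "word m w \<Longrightarrow> t \<in> T \<Longrightarrow> word m (t \<otimes> w)"
proof (induction arbitrary: t rule: word.induct)
  case (word_T t)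
  then show ?case by (auto intro: word.word_T)
next
  case (word_n m w i)
  obtain t' where t': "t' \<in> T" "t \<otimes> n i = n i \<otimes> t'"
    using T_commute[OF n_N] word_n by metis
  have "t \<otimes> (n i \<otimes> w) = n i \<otimes> (t' \<otimes> w)"
    using word_n t' word_N by (metis N_carrier T_carrier m_assoc n_N)
  then show ?case using word_n t' by (metis word.word_n)
qed

lemma word_right_T: "word m w \<Longrightarrow> t \<in> T \<Longrightarrow> word m (w \<otimes> t)"
proof (induction arbitrary: t rule: word.induct)
  case (word_T t)
  then show ?case by (auto intro: word.word_T)
next
  case (word_n m w i)
  then show ?case using word_N by (auto simp: m_assoc intro: word.word_n)
qed

lemma word_right_n: "word m w \<Longrightarrow> j \<in> I \<Longrightarrow> word (Suc m) (w \<otimes> n j)"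
proof (induction rule: word.induct)
  case (word_T t)
  obtain t' where t': "t' \<in> T" "t \<otimes> n j = n j \<otimes> t'"
    using T_commute[OF n_N] word_T by metis
  then show ?case using word_T by (metis word.word_T word.word_n)
next
  case (word_n m w i)
  then show ?case using word_N by (auto simp: m_assoc intro: word.word_n)
qed

lemma word_inv: "word m w \<Longrightarrow> word m (inv w)"
proof (induction rule: word.induct)
  case (word_T t)
  then show ?case by (auto intro: word.word_T)
next
  case (word_n m w i)
  obtain t where t: "t \<in> T" "inv (n i) = n i \<otimes> t" using inv_n word_n by metis
  have "inv (n i \<otimes> w) = (inv w \<otimes> n i) \<otimes> t"
    using word_n t word_N by (simp add: inv_mult_group m_assoc)
  then show ?case using word_n t word_right_n word_right_T by metis
qed

lemma word_exists: assumes "w \<in> N" shows "\<exists>m. word m w"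
proof -
  \<comment> \<open>Multiplying onto an arbitrary word makes the induction over generated elements
    work: a product h1 h2 is absorbed by prepending h2 and then h1.\<close>
  have "x \<in> generate G (T \<union> n ` I) \<Longrightarrow> word m w \<Longrightarrow> \<exists>m. word m (x \<otimes> w)" for x w m
  proof (induction arbitrary: w m rule: generate.induct)
    case one
    then show ?case using word_N by auto
  next
    case (incl h)
    then show ?case using word_left_T word_n by blast
  next
    case (inv h)
    then consider "h \<in> T" | i where "i \<in> I" "h = n i" by auto
    then show ?case
    proof cases
      case 1 then show ?thesis using word_left_T[OF inv(2)] by (intro exI[of _ m]) simp
    next
      case 2
      then obtain t where t: "t \<in> T" "inv (n i) = n i \<otimes> t" using inv_n by metis
      have "inv h \<otimes> w = n i \<otimes> (t \<otimes> w)" using 2 t inv word_N by (simp add: m_assoc)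
      then show ?thesis using word_n[OF word_left_T[OF inv(2) t(1)]] 2 by metis
    qed
  next
    case (eng h1 h2)
    have "h1 \<in> carrier G" "h2 \<in> carrier G" using eng generate_N by auto
    then have "h1 \<otimes> h2 \<otimes> w = h1 \<otimes> (h2 \<otimes> w)" using word_N eng by (simp add: m_assoc)
    then show ?case using eng by metis
  qed
  from this[of w 0 \<one>] have "\<exists>m. word m (w \<otimes> \<one>)"
    using generate_N assms word_T[OF T_one] by metis
  then show ?thesis using assms by simp
qed

definition len :: "'a \<Rightarrow> nat" where
  "len w = (LEAST m. word m w)"

lemma word_len: "w \<in> N \<Longrightarrow> word (len w) w"
  unfolding len_def using word_exists by (metis LeastI_ex)

lemma len_le: "word m w \<Longrightarrow> len w \<le> m"
  unfolding len_def by (rule Least_le)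

lemma len_0: "w \<in> N \<Longrightarrow> len w = 0 \<longleftrightarrow> w \<in> T"
  using word_len[of w] len_le[OF word_T, of w] by (auto elim: word.cases)

lemma len_left_n: "\<lbrakk>w \<in> N; i \<in> I\<rbrakk> \<Longrightarrow> len (n i \<otimes> w) \<le> Suc (len w)"
  by (meson len_le word_len word_n)

lemma len_right_T: "\<lbrakk>w \<in> N; t \<in> T\<rbrakk> \<Longrightarrow> len (w \<otimes> t) = len w"
proof (rule antisym)
  assume wt: "w \<in> N" "t \<in> T"
  then show "len (w \<otimes> t) \<le> len w" by (meson len_le word_len word_right_T)
  have "len (w \<otimes> t \<otimes> inv t) \<le> len (w \<otimes> t)"
    using wt by (meson len_le word_len word_right_T N_mult T_N T_inv)
  then show "len w \<le> len (w \<otimes> t)" using wt by (simp add: m_assoc)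
qed

lemma len_left_T: "\<lbrakk>w \<in> N; t \<in> T\<rbrakk> \<Longrightarrow> len (t \<otimes> w) = len w"
  using T_commute[of w t] len_right_T by metis

lemma len_left_n': assumes "w \<in> N" "i \<in> I" shows "len w \<le> Suc (len (n i \<otimes> w))"
proof -
  obtain t where t: "t \<in> T" "inv (n i) = n i \<otimes> t" using inv_n assms by metis
  have "w = inv (n i) \<otimes> (n i \<otimes> w)" using assms by (simp add: group_simps)
  also have "\<dots> = n i \<otimes> (t \<otimes> (n i \<otimes> w))" using assms t by (simp add: group_simps)
  finally have "len w \<le> Suc (len (t \<otimes> (n i \<otimes> w)))"
    using len_left_n[of "t \<otimes> (n i \<otimes> w)" i] assms t T_N n_N by simp
  then show ?thesis using len_left_T[of "n i \<otimes> w" t] assms t n_N by simp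
qed

lemma len_inv: "w \<in> N \<Longrightarrow> len (inv w) = len w"
  by (metis N_inv N_carrier inv_inv len_le nle_le word_inv word_len)

lemma len_Suc_left: assumes "w \<in> N" "len w = Suc m"
  obtains i v where "i \<in> I" "v \<in> N" "w = n i \<otimes> v" "len v = m"
proof -
  have "word (Suc m) w" using assms word_len by metis
  then obtain v i where v: "word m v" "i \<in> I" "w = n i \<otimes> v" by (auto elim: word.cases)
  then have "len v \<le> m" "v \<in> N" using len_le word_N by auto
  moreover have "Suc m \<le> Suc (len v)" using len_left_n v assms calculation by metis
  ultimately show ?thesis using v that[of i v] by auto
qed

text \<open>Obtained from the left-hand version by inversion, which preserves length; the inverse
  letter returns to \<open>n i\<close> at the cost of an element of T.\<close>

lemma len_Suc_right: assumes "w \<in> N" "len w = Suc m"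
  obtains i v where "i \<in> I" "v \<in> N" "w = v \<otimes> n i" "len v = m"
proof -
  obtain i v where v: "i \<in> I" "v \<in> N" "inv w = n i \<otimes> v" "len v = m"
    using len_Suc_left[of "inv w" m] assms len_inv by (metis N_inv)
  obtain t where t: "t \<in> T" "inv (n i) = n i \<otimes> t" using inv_n v by metis
  obtain t' where t': "t' \<in> T" "n i \<otimes> t = t' \<otimes> n i" using T_commute' v t n_N by metis
  have "w = inv (inv w)" using assms by simp
  also have "\<dots> = (inv v \<otimes> t') \<otimes> n i"
    using v t t' by (simp add: inv_mult_group m_assoc)
  finally show ?thesis using that[of i "inv v \<otimes> t'"] v t' len_right_T len_inv T_N by auto
qed

section \<open>Double cosets of B and the uniqueness half of the Bruhat decomposition\<close>

definition dc :: "'a \<Rightarrow> 'a set" where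
  "dc w = {b \<otimes> w \<otimes> b' | b b'. b \<in> B \<and> b' \<in> B}"

lemma dcI: "\<lbrakk>b \<in> B; b' \<in> B\<rbrakk> \<Longrightarrow> b \<otimes> w \<otimes> b' \<in> dc w"
  unfolding dc_def by blast

lemma dc_self: "w \<in> carrier G \<Longrightarrow> w \<in> dc w"
  unfolding dc_def by (force intro: exI[of _ \<one>])

lemma dc_carrier: "w \<in> carrier G \<Longrightarrow> x \<in> dc w \<Longrightarrow> x \<in> carrier G"
  unfolding dc_def by auto

lemma dc_left: assumes "w \<in> carrier G" "b \<in> B" "x \<in> dc w" shows "b \<otimes> x \<in> dc w"
proof -
  obtain b1 b2 where b: "b1 \<in> B" "b2 \<in> B" "x = b1 \<otimes> w \<otimes> b2" using assms dc_def by auto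
  then have "b \<otimes> x = (b \<otimes> b1) \<otimes> w \<otimes> b2" using assms by (simp add: m_assoc)
  then show ?thesis using b assms dcI by simp
qed

lemma dc_right: assumes "w \<in> carrier G" "b \<in> B" "x \<in> dc w" shows "x \<otimes> b \<in> dc w"
proof -
  obtain b1 b2 where b: "b1 \<in> B" "b2 \<in> B" "x = b1 \<otimes> w \<otimes> b2" using assms dc_def by auto
  then have "x \<otimes> b = b1 \<otimes> w \<otimes> (b2 \<otimes> b)" using assms by (simp add: m_assoc)
  then show ?thesis using b assms dcI by simp
qed

lemma dc_inv: assumes "w \<in> carrier G" "x \<in> dc w" shows "inv x \<in> dc (inv w)"
proof -
  obtain b1 b2 where b: "b1 \<in> B" "b2 \<in> B" "x = b1 \<otimes> w \<otimes> b2" using assms dc_def by auto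
  then have "inv x = inv b2 \<otimes> inv w \<otimes> inv b1" using assms by (simp add: group_simps)
  then show ?thesis using b dcI by (metis B_inv)
qed

lemma dc_sym: assumes "w \<in> carrier G" "w' \<in> dc w" shows "w \<in> dc w'"
proof -
  obtain b1 b2 where b: "b1 \<in> B" "b2 \<in> B" "w' = b1 \<otimes> w \<otimes> b2" using assms dc_def by auto
  then have "w = inv b1 \<otimes> w' \<otimes> inv b2" using assms by (simp add: group_simps)
  then show ?thesis using b dcI by (metis B_inv)
qed

lemma dc_trans: assumes "w \<in> carrier G" "w' \<in> dc w" "x \<in> dc w'" shows "x \<in> dc w"
proof -
  obtain b1 b2 where b: "b1 \<in> B" "b2 \<in> B" "x = b1 \<otimes> w' \<otimes> b2" using assms dc_def by auto
  then show ?thesis using assms dc_left dc_right by metis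
qed

lemma dc_left_n: assumes "i \<in> I" "w \<in> N" "x \<in> dc w"
  shows "n i \<otimes> x \<in> dc (n i \<otimes> w) \<or> n i \<otimes> x \<in> dc w"
proof -
  obtain b1 b2 where b: "b1 \<in> B" "b2 \<in> B" "x = b1 \<otimes> w \<otimes> b2" using assms dc_def by auto
  have "n i \<otimes> b1 \<otimes> w \<in> dc (n i \<otimes> w) \<or> n i \<otimes> b1 \<otimes> w \<in> dc w"
    using exchange[OF assms(1,2) b(1)] unfolding dc_def by fast
  moreover have "n i \<otimes> x = (n i \<otimes> b1 \<otimes> w) \<otimes> b2" using b assms by (simp add: m_assoc)
  ultimately show ?thesis using dc_right b assms by auto
qed

lemma dc_right_T: assumes "w \<in> carrier G" "t \<in> T" shows "dc (w \<otimes> t) = dc w"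
proof -
  have "w \<otimes> t \<in> dc w" using dc_right[OF _ _ dc_self] assms T_B by auto
  then show ?thesis using dc_trans[of w "w \<otimes> t"] dc_trans[OF _ dc_sym, of "w \<otimes> t" w] assms
    by (meson T_carrier dc_sym dc_trans m_closed subsetI subset_antisym)
qed

text \<open>The exchange axiom is one-sided. Inversion turns right multiplication of x by
  \<open>n i\<close> into left multiplication of the inverse of x, up to T.\<close>

lemma dc_right_n: assumes "i \<in> I" "w \<in> N" "x \<in> dc w"
  shows "x \<otimes> n i \<in> dc (w \<otimes> n i) \<or> x \<otimes> n i \<in> dc w"
proof -
  have x: "x \<in> carrier G" using assms dc_carrier by (meson N_carrier)
  obtain t where t: "t \<in> T" "inv (n i) = n i \<otimes> t" using inv_n assms by metis
  obtain t' where t': "t' \<in> T" "n i \<otimes> t = t' \<otimes> n i" using T_commute' assms t n_N by metis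
  have "n i \<otimes> inv x \<in> dc (n i \<otimes> inv w) \<or> n i \<otimes> inv x \<in> dc (inv w)"
    using dc_left_n[of i "inv w" "inv x"] assms dc_inv[of w x] by auto
  moreover have "inv (x \<otimes> n i) = t' \<otimes> (n i \<otimes> inv x)"
    using assms t t' x by (simp add: group_simps)
  ultimately have "inv (x \<otimes> n i) \<in> dc (n i \<otimes> inv w) \<or> inv (x \<otimes> n i) \<in> dc (inv w)"
    using dc_left[of _ t'] t' T_B assms by auto
  then have "inv (inv (x \<otimes> n i)) \<in> dc (inv (n i \<otimes> inv w)) \<or> inv (inv (x \<otimes> n i)) \<in> dc (inv (inv w))"
    using dc_inv assms by (metis N_carrier inv_closed m_closed n_carrier)
  moreover have "inv (n i \<otimes> inv w) = w \<otimes> n i \<otimes> t" using assms t by (simp add: inv_mult_group m_assoc)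
  ultimately show ?thesis using assms x dc_right_T t by auto
qed

lemma dc_disjoint: assumes "w \<in> N" "w' \<in> N" "x \<in> dc w" "x \<in> dc w'" shows "w' \<in> dc w"
  using assms by (meson N_carrier dc_sym dc_trans dc_carrier)

text \<open>Induction on the smaller of the two lengths. Cancelling the first letter of w =
  \<open>n i\<close> v puts v into the double coset of \<open>n i\<close> w' or of w'. The induction
  hypothesis makes that element equal to v modulo T: the first case gives w' = w modulo T, the
  second would make w' shorter than w.\<close>

lemma bruhat_unique:
  assumes "w \<in> N" "w' \<in> N" "w' \<in> dc w"
  shows "\<exists>t\<in>T. w' = w \<otimes> t"
proof -
  have "m = len w \<Longrightarrow> len w \<le> len w' \<Longrightarrow> w \<in> N \<Longrightarrow> w' \<in> N \<Longrightarrow> w' \<in> dc w \<Longrightarrow> \<exists>t\<in>T. w' = w \<otimes> t" for m w w'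
  proof (induction m arbitrary: w w')
    case 0
    then have w: "w \<in> T" using len_0 by auto
    then have "w' \<in> B" using 0 T_B unfolding dc_def by auto
    then have "w' \<in> T" using 0 BN by auto
    then show ?case using w by (intro bexI[of _ "inv w \<otimes> w'"]) (auto simp: group_simps)
  next
    case (Suc m)
    obtain i v where v: "i \<in> I" "v \<in> N" "w = n i \<otimes> v" "len v = m"
      using len_Suc_left Suc by metis
    obtain t where t: "t \<in> T" "inv (n i) = n i \<otimes> t" using inv_n v by metis
    obtain t' where t': "t' \<in> T" "n i \<otimes> t = t' \<otimes> n i" using T_commute' v t n_N by metis
    have w: "w \<in> dc w'" using Suc dc_sym by auto
    have "v = inv (n i) \<otimes> w" using v by (simp add: group_simps)
    then have "v = t' \<otimes> (n i \<otimes> w)" using t t' Suc v by (simp add: m_assoc)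
    moreover have "n i \<otimes> w \<in> dc (n i \<otimes> w') \<or> n i \<otimes> w \<in> dc w'"
      using dc_left_n v w Suc by auto
    ultimately have "v \<in> dc (n i \<otimes> w') \<or> v \<in> dc w'"
      using dc_left T_B t' v Suc by (metis N_carrier N_mult n_N)
    then have "n i \<otimes> w' \<in> dc v \<or> w' \<in> dc v" using dc_sym v Suc by auto
    then show ?case
    proof
      assume "n i \<otimes> w' \<in> dc v"
      moreover have "len v \<le> len (n i \<otimes> w')"
        using len_left_n'[of w' i] v Suc by auto
      ultimately obtain s where s: "s \<in> T" "n i \<otimes> w' = v \<otimes> s"
        using Suc.IH[of v "n i \<otimes> w'"] v(2,4) N_mult[OF n_N[OF v(1)] Suc.prems(4)] by metis
      have "w' = inv (n i) \<otimes> (n i \<otimes> w')" using v Suc by (simp add: group_simps)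
      also have "\<dots> = n i \<otimes> t \<otimes> (v \<otimes> s)" using s t by simp
      also have "\<dots> = n i \<otimes> (t \<otimes> v) \<otimes> s" using v s t by (simp add: m_assoc)
      finally show ?thesis using T_commute[of v t] v s t
        by (metis N_carrier N_mult T_carrier T_mult m_assoc n_N)
    next
      assume "w' \<in> dc v"
      then obtain s where s: "s \<in> T" "w' = v \<otimes> s"
        using Suc.IH[OF v(4)[symmetric] _ v(2) Suc.prems(4)] Suc.prems(1,2) v(4) by auto
      then have "len w' = m" using len_right_T v by auto
      then show ?thesis using Suc by simp
    qed
  qed
  note * = this
  show ?thesis
  proof (cases "len w \<le> len w'")
    case True
    then show ?thesis using * assms by blast
  next
    case False
    then have "\<exists>t\<in>T. w = w' \<otimes> t" using *[of _ w' w] assms dc_sym by auto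
    then obtain t where "t \<in> T" "w = w' \<otimes> t" by auto
    then show ?thesis using assms by (intro bexI[of _ "inv t"]) (auto simp: m_assoc)
  qed
qed

text \<open>If the conclusion fails, the exchange axiom puts \<open>n i\<close> b w into the double
  coset of w = v \<open>n j\<close>. Multiplying by \<open>n j\<close> puts \<open>n i\<close> b v
  into the double coset of v or of w, while the induction hypothesis puts it into that of
  \<open>n i\<close> v. By uniqueness \<open>n i\<close> v is v or w modulo T: the former puts
  \<open>n i\<close> into T, the latter makes \<open>n i\<close> w as short as v.\<close>

lemma exchange_longer:
  assumes "w \<in> N" "i \<in> I" "len w \<le> len (n i \<otimes> w)" "b \<in> B"
  shows "n i \<otimes> b \<otimes> w \<in> dc (n i \<otimes> w)"
  using assms
proof (induction "len w" arbitrary: w)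
  case 0
  then have "w \<in> B" using len_0 T_B by auto
  then have "n i \<otimes> b \<otimes> w \<in> dc (n i)" using dc_right[OF _ _ dc_right[OF _ _ dc_self]] 0 by auto
  moreover have "dc (n i \<otimes> w) = dc (n i)" using dc_right_T 0 len_0 by auto
  ultimately show ?case by simp
next
  case (Suc m)
  have ax: "n i \<otimes> b \<otimes> w \<in> dc (n i \<otimes> w) \<or> n i \<otimes> b \<otimes> w \<in> dc w"
    using dc_left_n[of i w "b \<otimes> w"] dc_left[of w b w] dc_self Suc by (auto simp: m_assoc)
  show ?case
  proof (rule ccontr)
    assume "n i \<otimes> b \<otimes> w \<notin> dc (n i \<otimes> w)"
    with ax have A: "n i \<otimes> b \<otimes> w \<in> dc w" by auto
    obtain j v where v: "j \<in> I" "v \<in> N" "w = v \<otimes> n j" "len v = m"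
      using len_Suc_right Suc by metis
    obtain t where t: "t \<in> T" "inv (n j) = n j \<otimes> t" using inv_n v by metis
    \<comment> \<open>Otherwise \<open>n i\<close> w, which is \<open>n i\<close> v followed by one
      letter, would be shorter than w.\<close>
    have len: "len v \<le> len (n i \<otimes> v)"
    proof (rule ccontr)
      assume "\<not> ?thesis"
      moreover have "len (n i \<otimes> w) \<le> Suc (len (n i \<otimes> v))"
      proof -
        have "n i \<otimes> w = (n i \<otimes> v) \<otimes> n j" using v Suc by (simp add: m_assoc)
        then show ?thesis using word_right_n[OF word_len, of "n i \<otimes> v" j] v Suc n_N len_le by simp
      qed
      ultimately show False using v Suc by simp
    qed
    have *: "n i \<otimes> b \<otimes> v \<in> dc (n i \<otimes> v)" using Suc.hyps(1)[of v] v Suc len by auto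
    have "n i \<otimes> b \<otimes> v = (n i \<otimes> b \<otimes> w \<otimes> n j) \<otimes> t"
      using v t Suc by (metis B_carrier N_carrier m_assoc m_closed n_carrier r_inv r_one T_carrier)
    moreover have "n i \<otimes> b \<otimes> w \<otimes> n j \<in> dc (w \<otimes> n j) \<or> n i \<otimes> b \<otimes> w \<otimes> n j \<in> dc w"
      using dc_right_n[OF v(1) _ A] Suc by auto
    ultimately have "n i \<otimes> b \<otimes> v \<in> dc (w \<otimes> n j) \<or> n i \<otimes> b \<otimes> v \<in> dc w"
      using dc_right[of _ t] t T_B v Suc by (metis N_carrier N_mult n_N)
    moreover have "dc (w \<otimes> n j) = dc v"
    proof -
      have "w \<otimes> n j = v \<otimes> (n j \<otimes> n j)" using v by (simp add: m_assoc)
      then show ?thesis using dc_right_T n_square v by auto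
    qed
    ultimately have "n i \<otimes> v \<in> dc v \<or> n i \<otimes> v \<in> dc w"
      using dc_disjoint[OF _ _ _ *, of v] dc_disjoint[OF _ _ _ *, of w] v Suc n_N by auto
    then show False
    proof
      assume "n i \<otimes> v \<in> dc v"
      then obtain s where s: "s \<in> T" "n i \<otimes> v = v \<otimes> s" using bruhat_unique v Suc n_N by (metis N_mult)
      then have "n i = v \<otimes> s \<otimes> inv v" using v Suc by (metis N_carrier inv_solve_right m_closed n_carrier T_carrier)
      then show False using T_conj[OF v(2) s(1)] n_notin[OF Suc(4)] by simp
    next
      assume "n i \<otimes> v \<in> dc w"
      then obtain s where s: "s \<in> T" "n i \<otimes> v = w \<otimes> s" using bruhat_unique v Suc n_N by (metis N_mult)
      obtain s' where s': "s' \<in> T" "inv (n i) = n i \<otimes> s'" using inv_n Suc by metis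
      have "v = inv (n i) \<otimes> (n i \<otimes> v)" using v Suc by (simp add: group_simps)
      also have "\<dots> = n i \<otimes> s' \<otimes> (w \<otimes> s)" using s s' by simp
      also have "\<dots> = n i \<otimes> (s' \<otimes> w) \<otimes> s" using s s' Suc by (simp add: m_assoc)
      finally have ve: "v = n i \<otimes> (s' \<otimes> w) \<otimes> s" .
      obtain s2 where s2: "s2 \<in> T" "s' \<otimes> w = w \<otimes> s2" using T_commute s' Suc by metis
      have "v = (n i \<otimes> w) \<otimes> (s2 \<otimes> s)" using ve s s2 Suc by (simp add: m_assoc)
      then have "len v = len (n i \<otimes> w)" using len_right_T s s2 Suc n_N by simp
      then show False using v Suc by simp
    qed
  qed
qed

text \<open>Choose b whose conjugate by \<open>n i\<close> leaves B. Then \<open>n i\<close> b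
  \<open>n i\<close> lies outside B, hence in B \<open>n i\<close> B, and
  \<open>exchange_longer\<close> puts \<open>n i\<close> b w = (\<open>n i\<close> b
  \<open>n i\<close>) v into B w B. Solving for \<open>n i\<close> writes it as a product of
  elements of B and one conjugate by w of an element of B. The letter does not depend on P.\<close>

lemma descent:
  assumes "w \<in> N" "len w = Suc m"
  shows "\<exists>i v. i \<in> I \<and> v \<in> N \<and> w = n i \<otimes> v \<and> len v = m \<and>
    (\<forall>P. subgroup P G \<and> B \<subseteq> P \<and> (\<forall>b\<in>B. w \<otimes> b \<otimes> inv w \<in> P) \<longrightarrow> n i \<in> P)"
proof -
  obtain i v where v: "i \<in> I" "v \<in> N" "w = n i \<otimes> v" "len v = m"
    using len_Suc_left assms by metis
  obtain b where b: "b \<in> B" "n i \<otimes> b \<otimes> inv (n i) \<notin> B" using nondegenerate v by metis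
  obtain t where t: "t \<in> T" "inv (n i) = n i \<otimes> t" using inv_n v by metis
  have "n i \<otimes> b \<otimes> n i \<in> dc (n i \<otimes> n i) \<or> n i \<otimes> b \<otimes> n i \<in> dc (n i)"
    using dc_left_n[of i "n i" "b \<otimes> n i"] dc_left[OF _ _ dc_self, of "n i" b] v b n_N by (auto simp: m_assoc)
  moreover have "n i \<otimes> b \<otimes> n i \<notin> dc (n i \<otimes> n i)"
  proof
    assume "n i \<otimes> b \<otimes> n i \<in> dc (n i \<otimes> n i)"
    then have "n i \<otimes> b \<otimes> n i \<in> B" using n_square[OF v(1)] T_B unfolding dc_def by auto
    then have "n i \<otimes> b \<otimes> n i \<otimes> t \<in> B" using t T_B by auto
    then show False using b t v by (simp add: m_assoc)
  qed
  ultimately obtain b1 b2 where bb: "b1 \<in> B" "b2 \<in> B" "n i \<otimes> b \<otimes> n i = b1 \<otimes> n i \<otimes> b2"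
    unfolding dc_def by auto
  obtain x where x: "x \<in> dc w" "n i \<otimes> b \<otimes> w = x"
  proof -
    have "n i \<otimes> b \<otimes> w = (n i \<otimes> b \<otimes> n i) \<otimes> v" using v b by (simp add: m_assoc)
    also have "\<dots> = b1 \<otimes> (n i \<otimes> b2 \<otimes> v)" using v b bb by (simp add: m_assoc)
    also have "\<dots> \<in> dc w" using exchange_longer[of v i b2] v bb assms dc_left by auto
    finally show ?thesis using that by blast
  qed
  obtain c1 c2 where c: "c1 \<in> B" "c2 \<in> B" "n i \<otimes> b \<otimes> w = c1 \<otimes> w \<otimes> c2" using x unfolding dc_def by auto
  have "n i = n i \<otimes> b \<otimes> w \<otimes> inv w \<otimes> inv b"
    using b v assms by (simp add: group_simps)
  also have "\<dots> = c1 \<otimes> (w \<otimes> c2 \<otimes> inv w) \<otimes> inv b" using c b assms by (simp add: m_assoc)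
  finally have ni: "n i = \<dots>" .
  have "n i \<in> P" if P: "subgroup P G" "B \<subseteq> P" "\<forall>b\<in>B. w \<otimes> b \<otimes> inv w \<in> P" for P
  proof -
    have "c1 \<otimes> (w \<otimes> c2 \<otimes> inv w) \<otimes> inv b \<in> P"
      using P b c by (intro subgroup.m_closed[OF P(1) subgroup.m_closed[OF P(1), of _ "w \<otimes> c2 \<otimes> inv w"]]) auto
    then show ?thesis using ni by simp
  qed
  then show ?thesis using v by (intro exI[of _ i] exI[of _ v]) simp
qed

section \<open>Overgroups of B and the existence half of the Bruhat decomposition\<close>

lemma mem_overgroup_N:
  assumes P: "subgroup P G" "B \<subseteq> P" and w: "w \<in> N" and "\<And>b. b \<in> B \<Longrightarrow> w \<otimes> b \<otimes> inv w \<in> P"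
  shows "w \<in> generate G (B \<union> {n i | i. i \<in> I \<and> n i \<in> P})"
  using w assms(4)
proof (induction "len w" arbitrary: w)
  case 0
  then have "w \<in> B" using len_0 T_B by auto
  then show ?case by (simp add: generate.incl)
next
  case (Suc m)
  then obtain i v where v: "i \<in> I" "v \<in> N" "w = n i \<otimes> v" "len v = m"
    and "\<forall>P. subgroup P G \<and> B \<subseteq> P \<and> (\<forall>b\<in>B. w \<otimes> b \<otimes> inv w \<in> P) \<longrightarrow> n i \<in> P"
    using descent[OF Suc(3), of m] by auto
  then have ni: "n i \<in> P" using P Suc by auto
  \<comment> \<open>With \<open>n i\<close> in P, conjugating back by it shows that the shorter
    element v again conjugates B into P.\<close>
  have "v \<otimes> b \<otimes> inv v \<in> P" if "b \<in> B" for b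
  proof -
    have "v \<otimes> b \<otimes> inv v = inv (n i) \<otimes> (w \<otimes> b \<otimes> inv w) \<otimes> n i"
      using v that by (simp add: group_simps)
    moreover have "inv (n i) \<otimes> (w \<otimes> b \<otimes> inv w) \<otimes> n i \<in> P"
      using subgroup.m_closed[OF P(1) subgroup.m_closed[OF P(1) subgroup.m_inv_closed[OF P(1) ni] Suc.prems(2)[OF that]] ni] .
    ultimately show ?thesis by simp
  qed
  then have "v \<in> generate G (B \<union> {n i | i. i \<in> I \<and> n i \<in> P})" using Suc v by auto
  then show ?case using v ni by (auto intro: generate.eng generate.incl)
qed

text \<open>The union of the double cosets B w B is closed under left multiplication by B and,
  letter by letter, by N; these two generate G.\<close>

lemma bruhat: assumes "g \<in> carrier G" shows "\<exists>w\<in>N. g \<in> dc w"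
proof -
  have "w \<in> N \<Longrightarrow> v \<in> N \<Longrightarrow> x \<in> dc v \<Longrightarrow> \<exists>v'\<in>N. w \<otimes> x \<in> dc v'" for w v x
  proof (induction "len w" arbitrary: w)
    case 0
    then show ?case using len_0 T_B dc_left by (metis N_carrier)
  next
    case (Suc m)
    then obtain i u where u: "i \<in> I" "u \<in> N" "w = n i \<otimes> u" "len u = m" using len_Suc_left by metis
    then obtain v' where v': "v' \<in> N" "u \<otimes> x \<in> dc v'" using Suc by metis
    have "w \<otimes> x = n i \<otimes> (u \<otimes> x)" using u Suc dc_carrier by (metis N_carrier m_assoc n_carrier)
    then show ?case using dc_left_n[OF u(1) v'] v' u n_N by (metis N_mult)
  qed
  note * = this
  have "g \<in> generate G (B \<union> N) \<Longrightarrow> v \<in> N \<Longrightarrow> x \<in> dc v \<Longrightarrow> \<exists>v'\<in>N. g \<otimes> x \<in> dc v'" for v x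
  proof (induction arbitrary: v x rule: generate.induct)
    case one
    then show ?case using dc_carrier by (metis N_carrier l_one)
  next
    case (incl h)
    then show ?case using * dc_left by (metis N_carrier UnE)
  next
    case (inv h)
    then show ?case using * dc_left by (metis N_carrier UnE B_inv N_inv)
  next
    case (eng h1 h2)
    have "h1 \<in> carrier G" "h2 \<in> carrier G" using eng generate_BN by auto
    then have "h1 \<otimes> h2 \<otimes> x = h1 \<otimes> (h2 \<otimes> x)" using dc_carrier eng by (metis N_carrier m_assoc)
    then show ?case using eng by metis
  qed
  from this[of \<one> \<one>] show ?thesis using assms generate_BN dc_self by auto
qed

text \<open>The outer factors of g = b1 w b2 lie in B, so w inherits the hypothesis from g and
  \<open>mem_overgroup_N\<close> applies. Naming the generators in the conclusion serves two ends:
  membership of g in P, and the description of P by the \<open>n i\<close> it contains.\<close>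

lemma generate_overgroup:
  assumes P: "subgroup P G" "B \<subseteq> P" and g: "g \<in> carrier G" and conj: "\<And>b. b \<in> B \<Longrightarrow> g \<otimes> b \<otimes> inv g \<in> P"
  shows "g \<in> generate G (B \<union> {n i | i. i \<in> I \<and> n i \<in> P})"
proof -
  obtain w where w: "w \<in> N" "g \<in> dc w" using bruhat g by metis
  then obtain b1 b2 where b: "b1 \<in> B" "b2 \<in> B" "g = b1 \<otimes> w \<otimes> b2" unfolding dc_def by auto
  have "w \<otimes> b \<otimes> inv w \<in> P" if "b \<in> B" for b
  proof -
    have "w \<otimes> b \<otimes> inv w = inv b1 \<otimes> (g \<otimes> (inv b2 \<otimes> b \<otimes> b2) \<otimes> inv g) \<otimes> b1"
      using b w that by (simp add: group_simps)
    also have "\<dots> \<in> P" using conj[of "inv b2 \<otimes> b \<otimes> b2"] b that P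
      by (intro subgroup.m_closed[OF P(1) subgroup.m_closed[OF P(1), of _ "g \<otimes> (inv b2 \<otimes> b \<otimes> b2) \<otimes> inv g"]]) auto
    finally show ?thesis .
  qed
  then have "w \<in> generate G (B \<union> {n i | i. i \<in> I \<and> n i \<in> P})" using mem_overgroup_N P w by auto
  then show ?thesis using b by (auto intro: generate.eng generate.incl)
qed

lemma generate_subset: "\<lbrakk>subgroup P G; H \<subseteq> P\<rbrakk> \<Longrightarrow> generate G H \<subseteq> P"
  using generate_subgroup_incl by blast

lemma mem_overgroup:
  assumes P: "subgroup P G" "B \<subseteq> P" and g: "g \<in> carrier G" "\<And>b. b \<in> B \<Longrightarrow> g \<otimes> b \<otimes> inv g \<in> P"
  shows "g \<in> P"
proof -
  have "generate G (B \<union> {n i | i. i \<in> I \<and> n i \<in> P}) \<subseteq> P"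
    using P by (intro generate_subset) auto
  then show ?thesis using generate_overgroup assms by blast
qed

lemma overgroup_eqI:
  assumes P: "subgroup P G" "B \<subseteq> P" and Q: "subgroup Q G" "B \<subseteq> Q"
    and "\<And>i. i \<in> I \<Longrightarrow> n i \<in> P \<longleftrightarrow> n i \<in> Q"
  shows "P = Q"
proof -
  have "P \<subseteq> Q" if P: "subgroup P G" "B \<subseteq> P" and Q: "subgroup Q G" "B \<subseteq> Q"
    and *: "\<And>i. i \<in> I \<Longrightarrow> n i \<in> P \<Longrightarrow> n i \<in> Q" for P Q
  proof
    fix g assume g: "g \<in> P"
    then have "g \<in> carrier G" using P subgroup.mem_carrier by metis
    moreover have "g \<otimes> b \<otimes> inv g \<in> P" if "b \<in> B" for b
      using that g P by (intro subgroup.m_closed[OF P(1)] subgroup.m_inv_closed[OF P(1)]) auto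
    ultimately have "g \<in> generate G (B \<union> {n i | i. i \<in> I \<and> n i \<in> P})"
      using generate_overgroup P by blast
    moreover have "generate G (B \<union> {n i | i. i \<in> I \<and> n i \<in> P}) \<subseteq> Q"
      using Q * by (intro generate_subset) auto
    ultimately show "g \<in> Q" by blast
  qed
  from this[of P Q] this[of Q P] show ?thesis using assms by blast
qed

end

section \<open>Subgroups of coordinate models\<close>

locale coordinates = S: group S + G: group G
  for S :: "('a, 's) monoid_scheme" and G :: "('g, 'h) monoid_scheme" +
  fixes X :: "('a \<Rightarrow> 'a) set" and k :: nat and N :: "'g set" and \<phi> :: "(nat \<Rightarrow> 'a) \<Rightarrow> 'g"
  assumes X_auto: "X \<subseteq> auto S"
    and k: "1 \<le> k"
    and finite_G: "finite (carrier G)"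
    and N_normal: "N \<lhd> G"
    and N_nontrivial: "N \<noteq> {\<one>\<^bsub>G\<^esub>}"
    and N_minimal: "\<And>M. \<lbrakk>M \<lhd> G; M \<subseteq> N\<rbrakk> \<Longrightarrow> M = {\<one>\<^bsub>G\<^esub>} \<or> M = N"
    and \<phi>_iso: "\<phi> \<in> iso (pow_group S k) (G\<lparr>carrier := N\<rparr>)"
    and closure: "coordinate_closure S k G \<phi> = X"
    and wreath: "coord_conj S k G \<phi> ` carrier G \<subseteq> wreath_auts S k X"
begin

abbreviation "P \<equiv> pow_group S k"

lemma P_group: "group P"
  by simp

sublocale P: group P
  by (rule P_group)

lemma \<phi>_N: "\<phi> ` carrier P = N"
  using \<phi>_iso by (auto simp: iso_def bij_betw_def)

lemma \<phi>_inj: "inj_on \<phi> (carrier P)"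
  using \<phi>_iso by (auto simp: iso_def bij_betw_def)

lemma N_subgroup: "subgroup N G"
  using N_normal normal_imp_subgroup by blast

lemma N_sub: "N \<subseteq> carrier G"
  using N_subgroup subgroup.subset by blast

lemma \<phi>_hom: "\<phi> \<in> hom P G"
  using \<phi>_iso N_sub by (auto simp: iso_def hom_def)

sublocale \<phi>: group_hom P G \<phi>
  by (unfold_locales) (rule \<phi>_hom)

lemma finite_N: "finite N"
  using N_sub finite_G finite_subset by blast

lemma finite_P: "finite (carrier P)"
  using finite_N \<phi>_N \<phi>_inj finite_image_iff by metis

lemma carrier_P: "carrier P = (\<Pi>\<^sub>E i\<in>{1..k}. carrier S)"
  by simp

lemma finite_S: "finite (carrier S)"
proof -
  have "carrier S \<subseteq> (\<lambda>f. f 1) ` carrier P"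
  proof
    fix s assume "s \<in> carrier S"
    then show "s \<in> (\<lambda>f. f 1) ` carrier P"
      using k by (intro image_eqI[of _ _ "\<lambda>i\<in>{1..k}. s"]) auto
  qed
  then show ?thesis using finite_P finite_surj by blast
qed

lemma S_nontrivial: "carrier S \<noteq> {\<one>\<^bsub>S\<^esub>}"
proof
  assume "carrier S = {\<one>\<^bsub>S\<^esub>}"
  then have "carrier P = {\<one>\<^bsub>P\<^esub>}" by (auto simp: PiE_singleton)
  then have "N = {\<one>\<^bsub>G\<^esub>}" using \<phi>_N \<phi>.hom_one by auto
  then show False using N_nontrivial by simp
qed

text \<open>Direction of the permutation: coordinate i of the conjugate is read from coordinate
  \<open>\<sigma> i\<close>, so conjugation by g carries the factor \<open>\<sigma> i\<close> onto
  the factor i, through \<open>a i\<close>.\<close>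

definition rep :: "'g \<Rightarrow> (nat \<Rightarrow> 'a \<Rightarrow> 'a) \<Rightarrow> (nat \<Rightarrow> nat) \<Rightarrow> bool" where
  "rep g a \<sigma> \<longleftrightarrow> (\<forall>i\<in>{1..k}. a i \<in> X) \<and> bij_betw \<sigma> {1..k} {1..k} \<and>
     (\<forall>f\<in>carrier P. g \<otimes>\<^bsub>G\<^esub> \<phi> f \<otimes>\<^bsub>G\<^esub> inv\<^bsub>G\<^esub> g = \<phi> (\<lambda>i\<in>{1..k}. a i (f (\<sigma> i))))"

lemma conj_N: "\<lbrakk>g \<in> carrier G; x \<in> N\<rbrakk> \<Longrightarrow> g \<otimes>\<^bsub>G\<^esub> x \<otimes>\<^bsub>G\<^esub> inv\<^bsub>G\<^esub> g \<in> N"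
  using N_normal by (simp add: normal.inv_op_closed2)

lemma coord_conj:
  assumes "g \<in> carrier G" "f \<in> carrier P"
  shows "\<phi> (coord_conj S k G \<phi> g f) = g \<otimes>\<^bsub>G\<^esub> \<phi> f \<otimes>\<^bsub>G\<^esub> inv\<^bsub>G\<^esub> g"
proof -
  have "g \<otimes>\<^bsub>G\<^esub> \<phi> f \<otimes>\<^bsub>G\<^esub> inv\<^bsub>G\<^esub> g \<in> \<phi> ` carrier P"
    using conj_N[OF assms(1)] \<phi>_N assms(2) by blast
  then show ?thesis using assms(2) f_inv_into_f[of _ \<phi> "carrier P"] unfolding coord_conj_def by simp
qed

lemma rep_coord:
  assumes "g \<in> carrier G"
  obtains a \<sigma> where "rep g a \<sigma>"
    "coord_conj S k G \<phi> g = (\<lambda>f\<in>carrier P. \<lambda>i\<in>{1..k}. a i (f (\<sigma> i)))"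
proof -
  have "coord_conj S k G \<phi> g \<in> wreath_auts S k X" using wreath assms by blast
  then obtain a \<sigma> where *: "coord_conj S k G \<phi> g = (\<lambda>f\<in>carrier P. \<lambda>i\<in>{1..k}. a i (f (\<sigma> i)))"
    "\<forall>i\<in>{1..k}. a i \<in> X" "bij_betw \<sigma> {1..k} {1..k}"
    unfolding wreath_auts_def by blast
  have "g \<otimes>\<^bsub>G\<^esub> \<phi> f \<otimes>\<^bsub>G\<^esub> inv\<^bsub>G\<^esub> g = \<phi> (\<lambda>i\<in>{1..k}. a i (f (\<sigma> i)))" if "f \<in> carrier P" for f
    using coord_conj[OF assms that] * that by simp
  then show ?thesis using that * unfolding rep_def by blast
qed

lemma X_hom: "a \<in> X \<Longrightarrow> a \<in> hom S S" and X_bij: "a \<in> X \<Longrightarrow> bij_betw a (carrier S) (carrier S)"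
  using X_auto by (auto simp: auto_def Bij_def)

lemma X_closed: "\<lbrakk>a \<in> X; s \<in> carrier S\<rbrakk> \<Longrightarrow> a s \<in> carrier S"
  using X_hom by (auto simp: hom_def)

lemma X_group_hom: "a \<in> X \<Longrightarrow> group_hom S S a"
  using X_hom by (simp add: group_hom_def group_hom_axioms_def S.is_group)

lemma X_one: "a \<in> X \<Longrightarrow> a \<one>\<^bsub>S\<^esub> = \<one>\<^bsub>S\<^esub>"
  using X_group_hom group_hom.hom_one by blast

section \<open>Product subgroups of N, their conjugates, and normalizers of powers\<close>

definition blk :: "(nat \<Rightarrow> 'a set) \<Rightarrow> 'g set" where
  "blk W = \<phi> ` (PiE {1..k} W)"

lemma blk_cong: "(\<And>i. i \<in> {1..k} \<Longrightarrow> W i = W' i) \<Longrightarrow> blk W = blk W'"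
  unfolding blk_def by (metis PiE_cong)

lemma PiE_sub_P: "(\<And>i. i \<in> {1..k} \<Longrightarrow> W i \<subseteq> carrier S) \<Longrightarrow> PiE {1..k} W \<subseteq> carrier P"
  unfolding carrier_P by (rule PiE_mono)

lemma blk_sub: "(\<And>i. i \<in> {1..k} \<Longrightarrow> W i \<subseteq> carrier S) \<Longrightarrow> blk W \<subseteq> N"
  unfolding blk_def \<phi>_N[symmetric] by (rule image_mono) (rule PiE_sub_P)

lemma blk_eqD:
  assumes "blk W = blk W'" and W: "\<And>i. i \<in> {1..k} \<Longrightarrow> W i \<subseteq> carrier S" "\<And>i. i \<in> {1..k} \<Longrightarrow> W i \<noteq> {}"
    and W': "\<And>i. i \<in> {1..k} \<Longrightarrow> W' i \<subseteq> carrier S" and i: "i \<in> {1..k}"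
  shows "W i = W' i"
proof -
  have "PiE {1..k} W = PiE {1..k} W'"
    using assms(1) inj_on_image_eq_iff[OF \<phi>_inj PiE_sub_P PiE_sub_P, of W W'] W W' unfolding blk_def by blast
  moreover have "PiE {1..k} W \<noteq> {}" using W by (simp add: PiE_eq_empty_iff)
  ultimately show ?thesis using i PiE_eq_iff[of "{1..k}" W W'] W by auto
qed

lemma conj_blk:
  assumes "rep g a \<sigma>" and W: "\<And>i. i \<in> {1..k} \<Longrightarrow> W i \<subseteq> carrier S"
  shows "G.conj_set g (blk W) = blk (\<lambda>i. a i ` W (\<sigma> i))"
proof -
  let ?\<tau> = "inv_into {1..k} \<sigma>"
  have \<sigma>: "bij_betw \<sigma> {1..k} {1..k}" using assms by (simp add: rep_def)
  have "(\<lambda>f. \<lambda>i\<in>{1..k}. a i (f (\<sigma> i))) ` (PiE {1..k} W) = (\<Pi>\<^sub>E i\<in>{1..k}. a i ` W (\<sigma> i))" (is "?F ` _ = _")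
  proof
    show "?F ` (PiE {1..k} W) \<subseteq> (\<Pi>\<^sub>E i\<in>{1..k}. a i ` W (\<sigma> i))"
      using bij_betwE[OF \<sigma>] by (auto simp: PiE_iff)
    show "(\<Pi>\<^sub>E i\<in>{1..k}. a i ` W (\<sigma> i)) \<subseteq> ?F ` (PiE {1..k} W)"
    proof
      fix h assume h: "h \<in> (\<Pi>\<^sub>E i\<in>{1..k}. a i ` W (\<sigma> i))"
      then have "\<forall>i\<in>{1..k}. \<exists>w\<in>W (\<sigma> i). h i = a i w" by (auto simp: PiE_iff)
      then obtain w where w: "\<forall>i\<in>{1..k}. w i \<in> W (\<sigma> i) \<and> h i = a i (w i)" by metis
      \<comment> \<open>The element \<open>w i\<close> has to stand in coordinate
        \<open>\<sigma> i\<close>, hence the inverse permutation.\<close>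
      let ?f = "\<lambda>j\<in>{1..k}. w (?\<tau> j)"
      have \<tau>: "?\<tau> j \<in> {1..k}" "\<sigma> (?\<tau> j) = j" if "j \<in> {1..k}" for j
        using that \<sigma> by (metis bij_betw_imp_surj_on inv_into_into, metis bij_betw_inv_into_right)
      have "?f \<in> PiE {1..k} W"
        using w \<tau> by (auto simp: PiE_iff) (metis \<tau> atLeastAtMost_iff)
      moreover have "h = ?F ?f"
      proof
        fix i show "h i = ?F ?f i"
        proof (cases "i \<in> {1..k}")
          case True
          then have "\<sigma> i \<in> {1..k}" "?\<tau> (\<sigma> i) = i"
            using \<sigma> bij_betwE bij_betw_inv_into_left by (blast, metis)
          then show ?thesis using w True by simp
        next
          case False
          then show ?thesis using h by (auto simp: PiE_iff extensional_def)
        qed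
      qed
      ultimately show "h \<in> ?F ` (PiE {1..k} W)" by blast
    qed
  qed
  moreover have "G.conj_set g (blk W) = \<phi> ` ?F ` (PiE {1..k} W)"
    using assms(1) PiE_sub_P[of W] W unfolding blk_def rep_def image_image by (intro image_cong) auto
  ultimately show ?thesis unfolding blk_def by simp
qed

lemma conj_\<phi>:
  assumes "u \<in> carrier P" "f \<in> carrier P"
  shows "\<phi> u \<otimes>\<^bsub>G\<^esub> \<phi> f \<otimes>\<^bsub>G\<^esub> inv\<^bsub>G\<^esub> \<phi> u = \<phi> (\<lambda>i\<in>{1..k}. u i \<otimes>\<^bsub>S\<^esub> f i \<otimes>\<^bsub>S\<^esub> inv\<^bsub>S\<^esub> u i)"
proof -
  have "\<phi> u \<otimes>\<^bsub>G\<^esub> \<phi> f \<otimes>\<^bsub>G\<^esub> inv\<^bsub>G\<^esub> \<phi> u = \<phi> (u \<otimes>\<^bsub>P\<^esub> f \<otimes>\<^bsub>P\<^esub> inv\<^bsub>P\<^esub> u)"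
    using assms by (metis \<phi>.hom_inv \<phi>.hom_mult P.inv_closed P.m_closed)
  moreover have "inv\<^bsub>P\<^esub> u = (\<lambda>i\<in>{1..k}. inv\<^bsub>S\<^esub> u i)" using assms by (intro inv_product_group) auto
  moreover have "u \<otimes>\<^bsub>P\<^esub> f \<otimes>\<^bsub>P\<^esub> (\<lambda>i\<in>{1..k}. inv\<^bsub>S\<^esub> u i) = (\<lambda>i\<in>{1..k}. u i \<otimes>\<^bsub>S\<^esub> f i \<otimes>\<^bsub>S\<^esub> inv\<^bsub>S\<^esub> u i)"
    by (auto simp: fun_eq_iff)
  ultimately show ?thesis by simp
qed

lemma conj_blk_\<phi>:
  assumes "u \<in> carrier P" and W: "\<And>i. i \<in> {1..k} \<Longrightarrow> W i \<subseteq> carrier S"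
  shows "G.conj_set (\<phi> u) (blk W) = blk (\<lambda>i. S.conj_set (u i) (W i))"
proof -
  let ?F = "\<lambda>f. \<lambda>i\<in>{1..k}. u i \<otimes>\<^bsub>S\<^esub> f i \<otimes>\<^bsub>S\<^esub> inv\<^bsub>S\<^esub> u i"
  have "?F ` (PiE {1..k} W) = (\<Pi>\<^sub>E i\<in>{1..k}. S.conj_set (u i) (W i))"
  proof
    show "?F ` (PiE {1..k} W) \<subseteq> (\<Pi>\<^sub>E i\<in>{1..k}. S.conj_set (u i) (W i))"
      by (auto simp: PiE_iff)
    show "(\<Pi>\<^sub>E i\<in>{1..k}. S.conj_set (u i) (W i)) \<subseteq> ?F ` (PiE {1..k} W)"
    proof
      fix h assume h: "h \<in> (\<Pi>\<^sub>E i\<in>{1..k}. S.conj_set (u i) (W i))"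
      then have "\<forall>i\<in>{1..k}. \<exists>w\<in>W i. h i = u i \<otimes>\<^bsub>S\<^esub> w \<otimes>\<^bsub>S\<^esub> inv\<^bsub>S\<^esub> u i" by (auto simp: PiE_iff)
      then obtain w where w: "\<forall>i\<in>{1..k}. w i \<in> W i \<and> h i = u i \<otimes>\<^bsub>S\<^esub> w i \<otimes>\<^bsub>S\<^esub> inv\<^bsub>S\<^esub> u i" by metis
      then have "(\<lambda>i\<in>{1..k}. w i) \<in> PiE {1..k} W" "h = ?F (\<lambda>i\<in>{1..k}. w i)"
        using h by (auto simp: PiE_iff extensional_def fun_eq_iff)
      then show "h \<in> ?F ` (PiE {1..k} W)" by blast
    qed
  qed
  moreover have "G.conj_set (\<phi> u) (blk W) = \<phi> ` ?F ` (PiE {1..k} W)"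
    using conj_\<phi>[OF assms(1)] PiE_sub_P[of W] W unfolding blk_def image_image by (intro image_cong) auto
  ultimately show ?thesis unfolding blk_def by simp
qed

lemma power_normalizer_iff:
  assumes "V \<subseteq> carrier S"
  shows "g \<in> power_normalizer G \<phi> k V \<longleftrightarrow> g \<in> carrier G \<and> G.conj_set g (blk (\<lambda>_. V)) = blk (\<lambda>_. V)"
proof -
  have "blk (\<lambda>_. V) \<subseteq> carrier G" using blk_sub[of "\<lambda>_. V"] assms N_sub by blast
  then show ?thesis unfolding power_normalizer_def using G.normalizer_iff by (simp add: blk_def)
qed

lemma power_normalizer_subgroup:
  assumes "V \<subseteq> carrier S"
  shows "subgroup (power_normalizer G \<phi> k V) G"
proof -
  have "blk (\<lambda>_. V) \<subseteq> carrier G" using blk_sub[of "\<lambda>_. V"] assms N_sub by blast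
  then show ?thesis unfolding power_normalizer_def using G.normalizer_imp_subgroup by (simp add: blk_def)
qed

text \<open>Elements of N act coordinatewise by inner automorphisms, so one of them normalizes the
  power exactly when each of its coordinates normalizes V.\<close>

lemma power_normalizer_Int_N:
  assumes V: "subgroup V S" "normalizer S V = V"
  shows "power_normalizer G \<phi> k V \<inter> N = blk (\<lambda>_. V)"
proof -
  have sub: "V \<subseteq> carrier S" and ne: "V \<noteq> {}"
    using V subgroup.subset subgroup.one_closed by blast+
  have "\<phi> u \<in> power_normalizer G \<phi> k V \<longleftrightarrow> u \<in> pow_set V k" if u: "u \<in> carrier P" for u
  proof -
    have ui: "u i \<in> carrier S" if "i \<in> {1..k}" for i using u that by auto
    have "\<phi> u \<in> power_normalizer G \<phi> k V \<longleftrightarrow> blk (\<lambda>i. S.conj_set (u i) V) = blk (\<lambda>_. V)"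
      using power_normalizer_iff[OF sub] conj_blk_\<phi>[OF u, of "\<lambda>_. V"] sub u by simp
    also have "\<dots> \<longleftrightarrow> (\<forall>i\<in>{1..k}. S.conj_set (u i) V = V)"
    proof
      assume *: "blk (\<lambda>i. S.conj_set (u i) V) = blk (\<lambda>_. V)"
      show "\<forall>i\<in>{1..k}. S.conj_set (u i) V = V"
      proof
        fix i assume "i \<in> {1..k}"
        then show "S.conj_set (u i) V = V"
          using blk_eqD[OF *, of i] sub ne S.conj_set_carrier[OF sub ui] by simp
      qed
    next
      assume "\<forall>i\<in>{1..k}. S.conj_set (u i) V = V"
      then show "blk (\<lambda>i. S.conj_set (u i) V) = blk (\<lambda>_. V)" by (intro blk_cong) auto
    qed
    also have "\<dots> \<longleftrightarrow> (\<forall>i\<in>{1..k}. u i \<in> normalizer S V)"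
      using S.normalizer_iff[OF sub] ui by auto
    also have "\<dots> \<longleftrightarrow> u \<in> pow_set V k" using V u by (auto simp: PiE_iff)
    finally show ?thesis .
  qed
  moreover have "pow_set V k \<subseteq> carrier P" using PiE_sub_P[of "\<lambda>_. V"] sub by blast
  ultimately show ?thesis unfolding blk_def \<phi>_N[symmetric] by blast
qed

lemma conj_class_family:
  assumes "\<And>i. i \<in> {1..k} \<Longrightarrow> A i \<in> conj_class S (W i)"
  obtains u where "u \<in> carrier P" "\<And>i. i \<in> {1..k} \<Longrightarrow> A i = S.conj_set (u i) (W i)"
proof -
  have "\<forall>i\<in>{1..k}. \<exists>s\<in>carrier S. A i = S.conj_set s (W i)" using assms S.conj_class_iff by blast
  then obtain u where "\<forall>i\<in>{1..k}. u i \<in> carrier S \<and> A i = S.conj_set (u i) (W i)" by metis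
  then show ?thesis by (intro that[of "\<lambda>i\<in>{1..k}. u i"]) auto
qed

text \<open>The Frattini argument: stability makes every G-conjugate of \<open>V\<^sup>k\<close> already N-conjugate to it.\<close>

lemma frattini:
  assumes V: "V \<subseteq> carrier S" "stable_class S X V" and g: "g \<in> carrier G"
  obtains x b where "x \<in> N" "b \<in> power_normalizer G \<phi> k V" "g = x \<otimes>\<^bsub>G\<^esub> b"
proof -
  obtain a \<sigma> where rep: "rep g a \<sigma>" using rep_coord[OF g] by metis
  then have "a i ` V \<in> conj_class S V" if "i \<in> {1..k}" for i
    using that V unfolding rep_def stable_class_def by blast
  then obtain u where u: "u \<in> carrier P" "\<And>i. i \<in> {1..k} \<Longrightarrow> a i ` V = S.conj_set (u i) V"
    using conj_class_family[of "\<lambda>i. a i ` V" "\<lambda>_. V"] by metis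
  have B: "blk (\<lambda>_. V) \<subseteq> carrier G" using blk_sub[of "\<lambda>_. V"] V N_sub by blast
  have \<phi>u: "\<phi> u \<in> carrier G" using \<phi>.hom_closed u(1) by blast
  have "G.conj_set g (blk (\<lambda>_. V)) = blk (\<lambda>i. a i ` V)"
    using conj_blk[OF rep, of "\<lambda>_. V"] V by simp
  also have "\<dots> = blk (\<lambda>i. S.conj_set (u i) V)" using u(2) by (rule blk_cong)
  also have "\<dots> = G.conj_set (\<phi> u) (blk (\<lambda>_. V))"
    using conj_blk_\<phi>[OF u(1), of "\<lambda>_. V"] V by simp
  finally have "G.conj_set (inv\<^bsub>G\<^esub> \<phi> u \<otimes>\<^bsub>G\<^esub> g) (blk (\<lambda>_. V)) = blk (\<lambda>_. V)"
    using G.conj_set_mult[OF B _ g, of "inv\<^bsub>G\<^esub> \<phi> u"] G.conj_set_inv[OF B \<phi>u] \<phi>u by simp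
  then have "inv\<^bsub>G\<^esub> \<phi> u \<otimes>\<^bsub>G\<^esub> g \<in> power_normalizer G \<phi> k V"
    using power_normalizer_iff[OF V(1)] g \<phi>u by simp
  moreover have "g = \<phi> u \<otimes>\<^bsub>G\<^esub> (inv\<^bsub>G\<^esub> \<phi> u \<otimes>\<^bsub>G\<^esub> g)" using g \<phi>u by (simp add: G.cancel_left2)
  ultimately show ?thesis using that[of "\<phi> u"] u \<phi>_N by blast
qed

lemma N_power_normalizer:
  assumes V: "V \<subseteq> carrier S" "stable_class S X V"
  shows "N <#>\<^bsub>G\<^esub> power_normalizer G \<phi> k V = carrier G"
proof
  show "N <#>\<^bsub>G\<^esub> power_normalizer G \<phi> k V \<subseteq> carrier G"
    using N_sub subgroup.subset[OF power_normalizer_subgroup[OF V(1)]] by (rule G.set_mult_closed)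
  show "carrier G \<subseteq> N <#>\<^bsub>G\<^esub> power_normalizer G \<phi> k V"
  proof
    fix g assume "g \<in> carrier G"
    then obtain x b where "x \<in> N" "b \<in> power_normalizer G \<phi> k V" "g = x \<otimes>\<^bsub>G\<^esub> b"
      using frattini[OF V] by metis
    then show "g \<in> N <#>\<^bsub>G\<^esub> power_normalizer G \<phi> k V" unfolding set_mult_def by blast
  qed
qed

lemma power_normalizer_N:
  assumes V: "V \<subseteq> carrier S" "stable_class S X V"
  shows "power_normalizer G \<phi> k V <#>\<^bsub>G\<^esub> N = carrier G"
  using N_power_normalizer[OF V] normal.set_mult_commute_subgroup[OF N_normal power_normalizer_subgroup[OF V(1)]]
  by simp

lemma card_power_normalizer:
  assumes V: "subgroup V S" "normalizer S V = V" "stable_class S X V"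
  shows "card (power_normalizer G \<phi> k V) = order (G Mod N) * card V ^ k"
proof -
  have sub: "V \<subseteq> carrier S" using V subgroup.subset by blast
  have "card (blk (\<lambda>_. V)) = card (pow_set V k)"
    unfolding blk_def using PiE_sub_P[of "\<lambda>_. V"] sub by (intro card_image inj_on_subset[OF \<phi>_inj]) blast
  also have "\<dots> = card V ^ k" by (simp add: card_PiE)
  finally show ?thesis
    using normal.card_supplement[OF N_normal finite_G power_normalizer_subgroup[OF sub] N_power_normalizer[OF sub V(3)]]
      power_normalizer_Int_N[OF V(1,2)] by simp
qed

lemma normal_conj_set:
  assumes "subgroup M G" "\<And>g. g \<in> carrier G \<Longrightarrow> G.conj_set g M \<subseteq> M"
  shows "M \<lhd> G"
  using assms G.normal_inv_iff by blast

lemma blk_subgroup: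
  assumes "\<And>i. i \<in> {1..k} \<Longrightarrow> subgroup (W i) S"
  shows "subgroup (blk W) G"
proof -
  have "subgroup (PiE {1..k} W) P"
    using assms PiE_subgroup_product_group[of "{1..k}" "\<lambda>_. S" W] by simp
  then show ?thesis unfolding blk_def using \<phi>.subgroup_img_is_subgroup by blast
qed

section \<open>Transitivity of G on the direct factors\<close>

definition factor :: "nat \<Rightarrow> 'g set" where
  "factor j = blk (\<lambda>i. if i = j then carrier S else {\<one>\<^bsub>S\<^esub>})"

lemma factor_sub: "factor j \<subseteq> carrier G"
  unfolding factor_def by (rule order.trans[OF blk_sub N_sub]) auto

lemma factor_inj:
  assumes "factor i = factor j" "i \<in> {1..k}"
  shows "i = j"
proof (rule ccontr)
  assume "i \<noteq> j"
  then show False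
    using blk_eqD[OF assms(1)[unfolded factor_def] _ _ _ assms(2)] S_nontrivial by (force split: if_splits)
qed

lemma conj_factor:
  assumes "rep g a \<sigma>" "i \<in> {1..k}"
  shows "G.conj_set g (factor (\<sigma> i)) = factor i"
proof -
  have "G.conj_set g (factor (\<sigma> i)) = blk (\<lambda>j. a j ` (if \<sigma> j = \<sigma> i then carrier S else {\<one>\<^bsub>S\<^esub>}))"
    unfolding factor_def by (rule conj_blk[OF assms(1)]) auto
  also have "\<dots> = factor i"
    unfolding factor_def
  proof (rule blk_cong)
    fix j assume j: "j \<in> {1..k}"
    then have "\<sigma> j = \<sigma> i \<longleftrightarrow> j = i"
      using assms unfolding rep_def bij_betw_def inj_on_def by blast
    moreover have "a j \<in> X" using assms j unfolding rep_def by blast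
    ultimately show "a j ` (if \<sigma> j = \<sigma> i then carrier S else {\<one>\<^bsub>S\<^esub>}) = (if j = i then carrier S else {\<one>\<^bsub>S\<^esub>})"
      using bij_betw_imp_surj_on[OF X_bij, of "a j"] X_one[of "a j"] by (cases "j = i") simp_all
  qed
  finally show ?thesis .
qed

lemma rep_factor:
  assumes "rep g a \<sigma>" "j \<in> {1..k}" "i \<in> {1..k}" "G.conj_set g (factor i) = factor j"
  shows "\<sigma> j = i"
proof -
  have "i \<in> \<sigma> ` {1..k}" using assms(1,3) unfolding rep_def bij_betw_def by blast
  then obtain l where l: "l \<in> {1..k}" "\<sigma> l = i" by blast
  then have "factor l = factor j" using conj_factor[OF assms(1) l(1)] assms(4) by simp
  then show ?thesis using factor_inj l by blast
qed

text \<open>The product of the factors in the G-orbit of the first one is a normal subgroup of G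
  inside N. It is nontrivial because it contains the first factor, so minimality of N makes it N,
  and every factor lies in the orbit.\<close>

lemma transitive:
  assumes j: "j \<in> {1..k}"
  shows "\<exists>g\<in>carrier G. G.conj_set g (factor 1) = factor j"
proof -
  define Orb where "Orb = {j \<in> {1..k}. \<exists>g\<in>carrier G. G.conj_set g (factor 1) = factor j}"
  define W where "W i = (if i \<in> Orb then carrier S else {\<one>\<^bsub>S\<^esub>})" for i
  have Orb: "finite Orb" unfolding Orb_def by simp
  have W_sub: "W i \<subseteq> carrier S" for i unfolding W_def by simp
  have invariant: "\<sigma> i \<in> Orb \<longleftrightarrow> i \<in> Orb" if g: "g \<in> carrier G" "rep g a \<sigma>" and i: "i \<in> {1..k}" for g a \<sigma> i
  proof -
    have \<sigma>: "bij_betw \<sigma> {1..k} {1..k}" using g rep_def by simp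
    have sub: "{i \<in> {1..k}. \<sigma> i \<in> Orb} \<subseteq> Orb"
    proof clarify
      fix i assume i: "i \<in> {1..k}" "\<sigma> i \<in> Orb"
      then obtain h where h: "h \<in> carrier G" "G.conj_set h (factor 1) = factor (\<sigma> i)"
        unfolding Orb_def by blast
      have "G.conj_set (g \<otimes>\<^bsub>G\<^esub> h) (factor 1) = factor i"
        using G.conj_set_mult[OF factor_sub g(1) h(1)] h(2) conj_factor[OF g(2) i(1)] by simp
      then show "i \<in> Orb" using i g h unfolding Orb_def by blast
    qed
    \<comment> \<open>Only one inclusion is proved directly; equality follows by counting, since
      \<open>\<sigma>\<close> maps the preimage of the orbit bijectively onto the orbit.\<close>
    have "bij_betw \<sigma> {i \<in> {1..k}. \<sigma> i \<in> Orb} Orb"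
      unfolding bij_betw_def
    proof
      show "inj_on \<sigma> {i \<in> {1..k}. \<sigma> i \<in> Orb}"
        using \<sigma> by (auto simp: bij_betw_def intro: inj_on_subset)
      have "Orb \<subseteq> \<sigma> ` {1..k}" using bij_betw_imp_surj_on[OF \<sigma>] Orb_def by auto
      then show "\<sigma> ` {i \<in> {1..k}. \<sigma> i \<in> Orb} = Orb" by blast
    qed
    then have "card {i \<in> {1..k}. \<sigma> i \<in> Orb} = card Orb" by (rule bij_betw_same_card)
    then have "{i \<in> {1..k}. \<sigma> i \<in> Orb} = Orb" using sub Orb card_subset_eq by metis
    then show ?thesis using i by blast
  qed
  have "blk W \<lhd> G"
  proof (rule normal_conj_set)
    show "subgroup (blk W) G"
      using S.subgroup_self S.triv_subgroup by (intro blk_subgroup) (simp add: W_def)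
    fix g assume g: "g \<in> carrier G"
    obtain a \<sigma> where rep: "rep g a \<sigma>" using rep_coord[OF g] by metis
    have "G.conj_set g (blk W) = blk (\<lambda>i. a i ` W (\<sigma> i))" using conj_blk[OF rep W_sub] .
    also have "\<dots> = blk W"
    proof (rule blk_cong)
      fix i assume i: "i \<in> {1..k}"
      then have "a i \<in> X" using rep rep_def by blast
      then show "a i ` W (\<sigma> i) = W i"
        unfolding W_def using invariant[OF g rep i] X_bij X_one by (auto simp: bij_betw_imp_surj_on)
    qed
    finally show "G.conj_set g (blk W) \<subseteq> blk W" by simp
  qed
  moreover have "blk W \<subseteq> N" using W_sub by (intro blk_sub)
  ultimately consider "blk W = {\<one>\<^bsub>G\<^esub>}" | "blk W = N" using N_minimal by blast
  moreover have triv: "blk (\<lambda>_. {\<one>\<^bsub>S\<^esub>}) = {\<one>\<^bsub>G\<^esub>}"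
    unfolding blk_def using \<phi>.hom_one by (simp add: PiE_singleton)
  moreover have full: "blk (\<lambda>_. carrier S) = N" unfolding blk_def using \<phi>_N by simp
  ultimately show ?thesis
  proof cases
    case 1
    have eq: "W i = {\<one>\<^bsub>S\<^esub>}" if "i \<in> {1..k}" for i
      using blk_eqD[of "\<lambda>_. {\<one>\<^bsub>S\<^esub>}" W i] 1 triv W_sub that by simp
    have "\<exists>g\<in>carrier G. G.conj_set g (factor 1) = factor 1"
      using G.conj_set_one[OF factor_sub] by (rule bexI) simp
    then have "1 \<in> Orb" using k unfolding Orb_def by simp
    then show ?thesis using eq[of 1] k S_nontrivial unfolding W_def by simp
  next
    case 2
    have "W j = carrier S"
      using blk_eqD[of "\<lambda>_. carrier S" W j] 2 full W_sub j S.one_closed by auto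
    then have "j \<in> Orb" using S_nontrivial unfolding W_def by (auto split: if_splits)
    then show ?thesis unfolding Orb_def by blast
  qed
qed

text \<open>A subgroup L between \<open>V\<^sup>k\<close> and \<open>S\<^sup>k\<close> meets the i-th factor in a normal subgroup of its
  i-th projection containing V; for normally saturating V the two coincide, so L is a product.\<close>

lemma saturated_product:
  assumes V: "normally_saturating S V" and L: "subgroup L P" "pow_set V k \<subseteq> L"
  obtains W where "\<And>i. i \<in> {1..k} \<Longrightarrow> subgroup (W i) S" "\<And>i. i \<in> {1..k} \<Longrightarrow> V \<subseteq> W i"
    "L = PiE {1..k} W"
proof -
  define W where "W i = (\<lambda>f. f i) ` L" for i
  define E where "E i = {s \<in> carrier S. factor_emb S k i s \<in> L}" for i
  have V_sub: "subgroup V S" using V normally_saturating_def by blast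
  have VS: "V \<subseteq> carrier S" and V1: "\<one>\<^bsub>S\<^esub> \<in> V"
    using V_sub subgroup.subset subgroup.one_closed by blast+
  have L_P: "L \<subseteq> carrier P" using L subgroup.subset by blast
  have emb_P: "factor_emb S k i s \<in> carrier P" if "s \<in> carrier S" for i s
    using that unfolding factor_emb_def by auto
  have emb_mult: "factor_emb S k i s \<otimes>\<^bsub>P\<^esub> factor_emb S k i t = factor_emb S k i (s \<otimes>\<^bsub>S\<^esub> t)" for i s t
    unfolding factor_emb_def by (auto simp: fun_eq_iff)
  have emb_inv: "inv\<^bsub>P\<^esub> factor_emb S k i s = factor_emb S k i (inv\<^bsub>S\<^esub> s)" if "s \<in> carrier S" for i s
    using emb_P[OF that] inv_product_group[of "factor_emb S k i s" "{1..k}" "\<lambda>_. S"]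
    unfolding factor_emb_def by (auto simp: fun_eq_iff)
  have W: "subgroup (W i) S" if i: "i \<in> {1..k}" for i
  proof (rule S.subgroupI)
    show "W i \<subseteq> carrier S" using L_P i unfolding W_def by (auto dest!: subsetD)
    show "W i \<noteq> {}" using subgroup.one_closed[OF L(1)] unfolding W_def by blast
    fix s assume "s \<in> W i"
    then obtain f where f: "f \<in> L" "s = f i" unfolding W_def by blast
    then have "f \<in> carrier P" using L_P by blast
    then have "inv\<^bsub>S\<^esub> s = (inv\<^bsub>P\<^esub> f) i" using f i by simp
    then show "inv\<^bsub>S\<^esub> s \<in> W i" using subgroup.m_inv_closed[OF L(1) f(1)] unfolding W_def by blast
    fix t assume "t \<in> W i"
    then obtain h where h: "h \<in> L" "t = h i" unfolding W_def by blast
    have "s \<otimes>\<^bsub>S\<^esub> t = (f \<otimes>\<^bsub>P\<^esub> h) i" using f h i by simp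
    then show "s \<otimes>\<^bsub>S\<^esub> t \<in> W i" using subgroup.m_closed[OF L(1) f(1) h(1)] unfolding W_def by blast
  qed
  have E: "subgroup (E i) S" for i
  proof (rule S.subgroupI)
    show "E i \<subseteq> carrier S" unfolding E_def by blast
    have "factor_emb S k i \<one>\<^bsub>S\<^esub> = \<one>\<^bsub>P\<^esub>" unfolding factor_emb_def by (auto simp: fun_eq_iff)
    then show "E i \<noteq> {}" using subgroup.one_closed[OF L(1)] unfolding E_def by force
    fix s assume s: "s \<in> E i"
    then show "inv\<^bsub>S\<^esub> s \<in> E i"
      using subgroup.m_inv_closed[OF L(1), of "factor_emb S k i s"] emb_inv[of s i] unfolding E_def by simp
    fix t assume t: "t \<in> E i"
    then show "s \<otimes>\<^bsub>S\<^esub> t \<in> E i"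
      using s subgroup.m_closed[OF L(1), of "factor_emb S k i s" "factor_emb S k i t"]
      unfolding E_def emb_mult by simp
  qed
  have VE: "V \<subseteq> E i" for i
  proof
    fix v assume v: "v \<in> V"
    then have "factor_emb S k i v \<in> pow_set V k" using V1 unfolding factor_emb_def by auto
    then show "v \<in> E i" using v VS L unfolding E_def by blast
  qed
  have EW: "E i \<subseteq> W i" if i: "i \<in> {1..k}" for i
  proof
    fix s assume "s \<in> E i"
    then show "s \<in> W i"
      using i unfolding E_def W_def by (intro image_eqI[of _ _ "factor_emb S k i s"]) (auto simp: factor_emb_def)
  qed
  have WE: "W i \<subseteq> E i" if i: "i \<in> {1..k}" for i
  proof -
    have "normal_closure S (W i) V \<subseteq> E i"
    proof (rule S.normal_closure_subset[OF E])
      fix w v assume w: "w \<in> W i" and v: "v \<in> V"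
      obtain f where f: "f \<in> L" "w = f i" using w unfolding W_def by blast
      have fP: "f \<in> carrier P" using f L_P by blast
      have vE: "factor_emb S k i v \<in> L" "v \<in> carrier S" using VE v VS unfolding E_def by blast+
      have *: "f \<otimes>\<^bsub>P\<^esub> factor_emb S k i v \<otimes>\<^bsub>P\<^esub> inv\<^bsub>P\<^esub> f \<in> L"
        using subgroup.m_closed[OF L(1) subgroup.m_closed[OF L(1) f(1) vE(1)] subgroup.m_inv_closed[OF L(1) f(1)]] .
      have inv: "inv\<^bsub>P\<^esub> f = (\<lambda>i\<in>{1..k}. inv\<^bsub>S\<^esub> f i)" using fP by (intro inv_product_group) auto
      \<comment> \<open>Only coordinate i of f acts on the i-th factor, so any f in L projecting to
        w serves.\<close>
      have "f \<otimes>\<^bsub>P\<^esub> factor_emb S k i v \<otimes>\<^bsub>P\<^esub> inv\<^bsub>P\<^esub> f = factor_emb S k i (w \<otimes>\<^bsub>S\<^esub> v \<otimes>\<^bsub>S\<^esub> inv\<^bsub>S\<^esub> w)"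
        unfolding inv using fP f unfolding factor_emb_def by (auto simp: fun_eq_iff PiE_iff)
      moreover have "w \<in> carrier S" using fP f i by auto
      ultimately show "w \<otimes>\<^bsub>S\<^esub> v \<otimes>\<^bsub>S\<^esub> inv\<^bsub>S\<^esub> w \<in> E i" using * vE unfolding E_def by simp
    qed
    moreover have "V \<subseteq> W i" using VE EW i by blast
    ultimately show ?thesis using V W[OF i] unfolding normally_saturating_def by blast
  qed
  have "PiE {1..k} W \<subseteq> L"
  proof
    fix f assume f: "f \<in> PiE {1..k} W"
    have fi: "f i \<in> carrier S" "factor_emb S k i (f i) \<in> L" if "i \<in> {1..k}" for i
      using f that WE unfolding E_def by blast+
    \<comment> \<open>Assemble f one coordinate at a time, each new coordinate being an element of L
      supported on a single factor.\<close>
    have "(\<lambda>i\<in>{1..k}. if i \<in> A then f i else \<one>\<^bsub>S\<^esub>) \<in> L" if "finite A" "A \<subseteq> {1..k}" for A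
      using that
    proof (induction A rule: finite_induct)
      case empty
      have "(\<lambda>i\<in>{1..k}. if i \<in> {} then f i else \<one>\<^bsub>S\<^esub>) = \<one>\<^bsub>P\<^esub>" by (auto simp: fun_eq_iff)
      then show ?case using subgroup.one_closed[OF L(1)] by metis
    next
      case (insert j A)
      have "(\<lambda>i\<in>{1..k}. if i \<in> insert j A then f i else \<one>\<^bsub>S\<^esub>) =
          factor_emb S k j (f j) \<otimes>\<^bsub>P\<^esub> (\<lambda>i\<in>{1..k}. if i \<in> A then f i else \<one>\<^bsub>S\<^esub>)"
        using insert fi(1) unfolding factor_emb_def by (auto simp: fun_eq_iff)
      moreover have "\<dots> \<in> L"
        using subgroup.m_closed[OF L(1) fi(2)[of j] insert.IH] insert.prems by blast
      ultimately show ?case by (simp only:)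
    qed
    from this[of "{1..k}"] have "(\<lambda>i\<in>{1..k}. if i \<in> {1..k} then f i else \<one>\<^bsub>S\<^esub>) \<in> L"
      by blast
    moreover have "(\<lambda>i\<in>{1..k}. if i \<in> {1..k} then f i else \<one>\<^bsub>S\<^esub>) = f"
      using f by (auto simp: fun_eq_iff PiE_iff extensional_def)
    ultimately show "f \<in> L" by (simp only:)
  qed
  moreover have "L \<subseteq> PiE {1..k} W" using L_P unfolding W_def by (auto simp: PiE_iff)
  ultimately show ?thesis using that[of W] W VE EW by blast
qed

section \<open>The coordinate closure realised by conjugation in G\<close>

lemma first_coord_stabilizer:
  assumes g: "g \<in> first_factor_stabilizer S k G \<phi>" and rep: "rep g a \<sigma>"
    and cc: "coord_conj S k G \<phi> g = (\<lambda>f\<in>carrier P. \<lambda>i\<in>{1..k}. a i (f (\<sigma> i)))"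
  shows "\<sigma> 1 = 1" "first_coord_aut S k G \<phi> g = restrict (a 1) (carrier S)"
proof -
  have emb_P: "factor_emb S k 1 s \<in> carrier P" if "s \<in> carrier S" for s
    using that unfolding factor_emb_def by auto
  have \<sigma>1: "\<sigma> 1 \<in> {1..k}" using rep k unfolding rep_def bij_betw_def by auto
  show *: "\<sigma> 1 = 1"
  proof (rule ccontr)
    assume "\<sigma> 1 \<noteq> 1"
    \<comment> \<open>A nontrivial s gives the contradiction: if \<open>\<sigma> 1\<close> were
      another index, the first coordinate of a conjugate of the first factor would come from a
      trivial coordinate.\<close>
    obtain s where s: "s \<in> carrier S" "s \<noteq> \<one>\<^bsub>S\<^esub>" using S_nontrivial S.one_closed by blast
    have "factor_emb S k 1 s \<in> coord_conj S k G \<phi> g ` factor_emb S k 1 ` carrier S"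
      using g s unfolding first_factor_stabilizer_def by blast
    then obtain t where t: "t \<in> carrier S" "factor_emb S k 1 s = coord_conj S k G \<phi> g (factor_emb S k 1 t)"
      by blast
    then have "factor_emb S k 1 s 1 = a 1 (factor_emb S k 1 t (\<sigma> 1))"
      using cc emb_P k by simp
    moreover have "factor_emb S k 1 t (\<sigma> 1) = \<one>\<^bsub>S\<^esub>"
      using \<sigma>1 \<open>\<sigma> 1 \<noteq> 1\<close> unfolding factor_emb_def by simp
    moreover have "factor_emb S k 1 s 1 = s" using k unfolding factor_emb_def by simp
    moreover have "a 1 \<in> X" using rep k unfolding rep_def by simp
    ultimately show False using X_one[of "a 1"] s by simp
  qed
  show "first_coord_aut S k G \<phi> g = restrict (a 1) (carrier S)"
    unfolding first_coord_aut_def cc using emb_P k * by (auto simp: fun_eq_iff factor_emb_def)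
qed

text \<open>Up to an inner automorphism of S, an element of X is induced on the first factor by an
  element of G fixing that factor. Stability under X can thus be tested by conjugation in G.\<close>

lemma closure_elim:
  assumes "x \<in> X"
  obtains g a \<sigma> s where "g \<in> carrier G" "rep g a \<sigma>" "\<sigma> 1 = 1" "s \<in> carrier S"
    "\<forall>y\<in>carrier S. x y = a 1 (s \<otimes>\<^bsub>S\<^esub> y \<otimes>\<^bsub>S\<^esub> inv\<^bsub>S\<^esub> s)"
proof -
  obtain g s where g: "g \<in> first_factor_stabilizer S k G \<phi>" and s: "s \<in> carrier S"
    and x: "x = first_coord_aut S k G \<phi> g \<otimes>\<^bsub>AutoGroup S\<^esub> (\<lambda>y\<in>carrier S. s \<otimes>\<^bsub>S\<^esub> y \<otimes>\<^bsub>S\<^esub> inv\<^bsub>S\<^esub> s)"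
    using assms unfolding closure[symmetric] coordinate_closure_def set_mult_def inner_auts_def by blast
  have gG: "g \<in> carrier G" using g unfolding first_factor_stabilizer_def by blast
  obtain a \<sigma> where rep: "rep g a \<sigma>"
    and cc: "coord_conj S k G \<phi> g = (\<lambda>f\<in>carrier P. \<lambda>i\<in>{1..k}. a i (f (\<sigma> i)))"
    using rep_coord[OF gG] by blast
  note fc = first_coord_stabilizer[OF g rep cc]
  have a1: "a 1 \<in> X" using rep k unfolding rep_def by simp
  then have "a 1 \<in> Bij (carrier S)" using X_auto unfolding auto_def by blast
  then have "first_coord_aut S k G \<phi> g \<in> Bij (carrier S)"
    using fc(2) by (metis Bij_imp_extensional extensional_restrict)
  moreover have "(\<lambda>y\<in>carrier S. s \<otimes>\<^bsub>S\<^esub> y \<otimes>\<^bsub>S\<^esub> inv\<^bsub>S\<^esub> s) \<in> Bij (carrier S)"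
    using S.conjugation_is_bij[OF s] by (simp add: Bij_def)
  ultimately have "x y = a 1 (s \<otimes>\<^bsub>S\<^esub> y \<otimes>\<^bsub>S\<^esub> inv\<^bsub>S\<^esub> s)" if "y \<in> carrier S" for y
    using that s unfolding x AutoGroup_def BijGroup_def fc(2) by (simp add: compose_def)
  then show ?thesis using that[OF gG rep fc(1) s] by blast
qed

text \<open>Conjugation preserves cardinality and S is finite, so containment forces
  equality.\<close>

lemma conj_superset_eq:
  assumes "V \<subseteq> W" "W \<subseteq> carrier S" "s \<in> carrier S" "V = S.conj_set s W"
  shows "V = W"
proof -
  have fin: "finite W" using assms(2) finite_S finite_subset by blast
  have "inj_on (\<lambda>x. s \<otimes>\<^bsub>S\<^esub> x \<otimes>\<^bsub>S\<^esub> inv\<^bsub>S\<^esub> s) W"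
    using assms(2,3) by (intro inj_onI) (simp add: subset_iff S.m_assoc)
  then have "card V = card W" using assms(4) card_image by blast
  then show ?thesis using assms(1) fin card_subset_eq by blast
qed

theorem maximal_power_normalizer:
  assumes V: "normally_saturating S V" "normalizer S V = V" "V \<noteq> carrier S" "stable_class S X V"
    and max: "\<And>W. \<lbrakk>subgroup W S; V \<subseteq> W; stable_class S X W\<rbrakk> \<Longrightarrow> W = V \<or> W = carrier S"
  shows "maximal_subgroup G (power_normalizer G \<phi> k V)"
proof -
  have V_sub: "subgroup V S" using V normally_saturating_def by blast
  have VS: "V \<subseteq> carrier S" using V_sub subgroup.subset by blast
  note B_sub = power_normalizer_subgroup[OF VS]
  note B_N = power_normalizer_Int_N[OF V_sub V(2)]
  have blk_full: "blk (\<lambda>_. carrier S) = N" unfolding blk_def using \<phi>_N by simp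
  have "blk (\<lambda>_. V) \<noteq> N"
  proof
    assume "blk (\<lambda>_. V) = N"
    then have "carrier S = V"
      using blk_eqD[of "\<lambda>_. carrier S" "\<lambda>_. V" 1] blk_full VS k S.one_closed by auto
    then show False using V by simp
  qed
  then have proper: "power_normalizer G \<phi> k V \<noteq> carrier G" using B_N N_sub by blast
  have "H = carrier G" if H: "subgroup H G" "power_normalizer G \<phi> k V \<subset> H" for H
  proof -
    define L where "L = {f \<in> carrier P. \<phi> f \<in> H}"
    have L: "subgroup L P"
    proof (rule P.subgroupI)
      show "L \<subseteq> carrier P" unfolding L_def by blast
      have "\<phi> \<one>\<^bsub>P\<^esub> \<in> H" unfolding \<phi>.hom_one using subgroup.one_closed[OF H(1)] .
      then show "L \<noteq> {}" using P.one_closed unfolding L_def by blast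
    next
      fix f assume "f \<in> L"
      then have f: "f \<in> carrier P" "\<phi> f \<in> H" unfolding L_def by blast+
      then have "\<phi> (inv\<^bsub>P\<^esub> f) \<in> H" using subgroup.m_inv_closed[OF H(1)] \<phi>.hom_inv by metis
      then show "inv\<^bsub>P\<^esub> f \<in> L" using P.inv_closed[OF f(1)] unfolding L_def by blast
      fix h assume "h \<in> L"
      then have h: "h \<in> carrier P" "\<phi> h \<in> H" unfolding L_def by blast+
      then have "\<phi> (f \<otimes>\<^bsub>P\<^esub> h) \<in> H" using subgroup.m_closed[OF H(1)] \<phi>.hom_mult f by metis
      then show "f \<otimes>\<^bsub>P\<^esub> h \<in> L" using P.m_closed[OF f(1) h(1)] unfolding L_def by blast
    qed
    have "pow_set V k \<subseteq> L"
      using B_N H(2) PiE_sub_P[of "\<lambda>_. V"] VS unfolding L_def blk_def by blast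
    then obtain W where W: "\<And>i. i \<in> {1..k} \<Longrightarrow> subgroup (W i) S" "\<And>i. i \<in> {1..k} \<Longrightarrow> V \<subseteq> W i"
      and LW: "L = PiE {1..k} W"
      using saturated_product[OF V(1) L] by metis
    have WS: "W i \<subseteq> carrier S" and W1: "\<one>\<^bsub>S\<^esub> \<in> W i" if "i \<in> {1..k}" for i
      using W(1)[OF that] subgroup.subset subgroup.one_closed by blast+
    have HN: "H \<inter> N = blk W" unfolding blk_def LW[symmetric] L_def \<phi>_N[symmetric] by blast
    have conj_H: "G.conj_set h (blk W) = blk W" if h: "h \<in> H" for h
    proof -
      have hG: "h \<in> carrier G" using h H subgroup.mem_carrier by metis
      have sub: "G.conj_set h (blk W) \<subseteq> blk W" if h: "h \<in> H" for h
      proof -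
        have "h \<in> carrier G" using h H subgroup.mem_carrier by metis
        then have "h \<otimes>\<^bsub>G\<^esub> x \<otimes>\<^bsub>G\<^esub> inv\<^bsub>G\<^esub> h \<in> H \<inter> N" if "x \<in> H \<inter> N" for x
          using that h H(1) conj_N by (simp add: subgroup.m_closed subgroup.m_inv_closed)
        then show ?thesis unfolding HN by blast
      qed
      have BG: "blk W \<subseteq> carrier G" using HN N_sub by blast
      have "blk W = G.conj_set h (G.conj_set (inv\<^bsub>G\<^esub> h) (blk W))"
        using G.conj_set_inv[OF BG, of "inv\<^bsub>G\<^esub> h"] hG by simp
      also have "\<dots> \<subseteq> G.conj_set h (blk W)"
        using sub[of "inv\<^bsub>G\<^esub> h"] h H subgroup.m_inv_closed by (metis image_mono)
      finally show ?thesis using sub h by blast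
    qed
    \<comment> \<open>Split g as x b with x in N and b in the normalizer of the power, hence in H.
      Then b fixes the product of the \<open>W i\<close>, and x acts on each factor by an inner
      automorphism.\<close>
    have conj_W: "\<exists>s\<in>carrier S. a i ` W (\<sigma> i) = S.conj_set s (W i)"
      if g: "g \<in> carrier G" and rep: "rep g a \<sigma>" and i: "i \<in> {1..k}" for g a \<sigma> i
    proof -
      obtain x b where xb: "x \<in> N" "b \<in> power_normalizer G \<phi> k V" "g = x \<otimes>\<^bsub>G\<^esub> b"
        using frattini[OF VS V(4) g] by metis
      obtain u where u: "u \<in> carrier P" "x = \<phi> u" using xb \<phi>_N by blast
      have b: "b \<in> H" "b \<in> carrier G" using xb H subgroup.mem_carrier[OF B_sub] by blast+
      have BG: "blk W \<subseteq> carrier G" using HN N_sub by blast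
      have "blk (\<lambda>i. a i ` W (\<sigma> i)) = G.conj_set g (blk W)" using conj_blk[OF rep WS] by simp
      also have "\<dots> = G.conj_set x (blk W)"
        using G.conj_set_mult[OF BG _ b(2), of x] xb conj_H[OF b(1)] N_sub by auto
      also have "\<dots> = blk (\<lambda>i. S.conj_set (u i) (W i))" unfolding u(2) using conj_blk_\<phi>[OF u(1) WS] .
      finally have *: "blk (\<lambda>i. S.conj_set (u i) (W i)) = blk (\<lambda>i. a i ` W (\<sigma> i))" by simp
      have \<sigma>: "\<sigma> j \<in> {1..k}" "a j \<in> X" if "j \<in> {1..k}" for j
        using rep that unfolding rep_def bij_betw_def by blast+
      have "S.conj_set (u i) (W i) = a i ` W (\<sigma> i)"
      proof (rule blk_eqD[OF * _ _ _ i])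
        fix j assume j: "j \<in> {1..k}"
        show "S.conj_set (u j) (W j) \<subseteq> carrier S" using WS[OF j] u j by (intro S.conj_set_carrier) auto
        show "S.conj_set (u j) (W j) \<noteq> {}" using W1[OF j] by blast
        show "a j ` W (\<sigma> j) \<subseteq> carrier S" using WS[OF \<sigma>(1)[OF j]] X_closed \<sigma>(2)[OF j] by blast
      qed
      moreover have "u i \<in> carrier S" using u(1) i by auto
      ultimately show ?thesis by metis
    qed
    have k1: "1 \<in> {1..k}" using k by simp
    \<comment> \<open>Elements of X come from elements of G with \<open>\<sigma> 1 = 1\<close>, up
      to inner automorphisms; for these \<open>conj_W\<close> compares \<open>W 1\<close> with
      itself.\<close>
    have "stable_class S X (W 1)"
      unfolding stable_class_def
    proof
      fix x assume "x \<in> X"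
      then obtain g a \<sigma> s where x: "g \<in> carrier G" "rep g a \<sigma>" "\<sigma> 1 = 1" "s \<in> carrier S"
        "\<forall>y\<in>carrier S. x y = a 1 (s \<otimes>\<^bsub>S\<^esub> y \<otimes>\<^bsub>S\<^esub> inv\<^bsub>S\<^esub> s)"
        using closure_elim by blast
      have a1: "a 1 \<in> X" using x k unfolding rep_def by simp
      interpret a: group_hom S S "a 1" using X_group_hom[OF a1] .
      obtain t where t: "t \<in> carrier S" "a 1 ` W 1 = S.conj_set t (W 1)"
        using conj_W[OF x(1,2) k1] x(3) by auto
      have "x ` W 1 = S.conj_set (a 1 s) (a 1 ` W 1)"
      proof -
        have "x y = a 1 s \<otimes>\<^bsub>S\<^esub> a 1 y \<otimes>\<^bsub>S\<^esub> inv\<^bsub>S\<^esub> (a 1 s)" if "y \<in> W 1" for y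
        proof -
          have "y \<in> carrier S" using that WS[OF k1] by blast
          then show ?thesis using x(4,5) by (simp del: One_nat_def)
        qed
        then show ?thesis by (auto simp: image_image intro!: image_cong)
      qed
      also have "\<dots> = S.conj_set (a 1 s \<otimes>\<^bsub>S\<^esub> t) (W 1)"
        using S.conj_set_mult[OF WS[OF k1] a.hom_closed[OF x(4)] t(1)] t(2) by (simp del: One_nat_def)
      finally show "x ` W 1 \<in> conj_class S (W 1)"
        using S.conj_class_iff t x by (metis S.m_closed a.hom_closed)
    qed
    then consider "W 1 = V" | "W 1 = carrier S" using max W k1 by blast
    then show ?thesis
    proof cases
      case 1
      \<comment> \<open>An element of G moving factor 1 to factor i shows that \<open>W i\<close> is
        conjugate to an X-image of V, hence to V by stability; as it contains V, the two
        agree.\<close>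
      have WV: "W i = V" if i: "i \<in> {1..k}" for i
      proof -
        obtain g where g: "g \<in> carrier G" "G.conj_set g (factor 1) = factor i"
          using transitive[OF i] by blast
        obtain a \<sigma> where rep: "rep g a \<sigma>" using rep_coord[OF g(1)] by metis
        have \<sigma>: "\<sigma> i = 1" using rep_factor[OF rep i k1 g(2)] .
        obtain s where s: "s \<in> carrier S" "a i ` V = S.conj_set s (W i)"
          using conj_W[OF g(1) rep i] \<sigma> 1 by auto
        have "a i \<in> X" using rep i unfolding rep_def by blast
        then obtain t where t: "t \<in> carrier S" "a i ` V = S.conj_set t V"
          using V(4) S.conj_class_iff unfolding stable_class_def by blast
        have "V = S.conj_set (inv\<^bsub>S\<^esub> t) (S.conj_set s (W i))"
          using S.conj_set_inv[OF VS t(1)] t s by simp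
        also have "\<dots> = S.conj_set (inv\<^bsub>S\<^esub> t \<otimes>\<^bsub>S\<^esub> s) (W i)"
          using S.conj_set_mult[OF WS[OF i]] t s by simp
        finally have "V = S.conj_set (inv\<^bsub>S\<^esub> t \<otimes>\<^bsub>S\<^esub> s) (W i)" .
        then have "V = W i"
          by (rule conj_superset_eq[OF W(2)[OF i] WS[OF i], rotated]) (use s t in simp)
        then show ?thesis by simp
      qed
      have "H \<subseteq> power_normalizer G \<phi> k V"
      proof
        fix h assume h: "h \<in> H"
        have "blk W = blk (\<lambda>_. V)" using WV by (rule blk_cong)
        then show "h \<in> power_normalizer G \<phi> k V"
          using power_normalizer_iff[OF VS] conj_H[OF h] subgroup.mem_carrier[OF H(1) h] by simp
      qed
      then show ?thesis using H(2) by blast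
    next
      case 2
      have WV: "W i = carrier S" if i: "i \<in> {1..k}" for i
      proof -
        obtain g where g: "g \<in> carrier G" "G.conj_set g (factor 1) = factor i"
          using transitive[OF i] by blast
        obtain a \<sigma> where rep: "rep g a \<sigma>" using rep_coord[OF g(1)] by metis
        have \<sigma>: "\<sigma> i = 1" using rep_factor[OF rep i k1 g(2)] .
        have "a i \<in> X" using rep i unfolding rep_def by blast
        then have "a i ` carrier S = carrier S" using X_bij bij_betw_imp_surj_on by blast
        then obtain s where s: "s \<in> carrier S" "carrier S = S.conj_set s (W i)"
          using conj_W[OF g(1) rep i] \<sigma> 2 by auto
        then have "card (carrier S) \<le> card (W i)"
          by (metis card_image_le finite_S finite_subset WS[OF i])
        then show ?thesis using WS[OF i] finite_S by (simp add: card_seteq)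
      qed
      have "blk W = N" using blk_cong[of W "\<lambda>_. carrier S"] WV blk_full by simp
      then have "N \<subseteq> H" using HN by blast
      then have "N <#>\<^bsub>G\<^esub> power_normalizer G \<phi> k V \<subseteq> H"
        using H subgroup.m_closed[OF H(1)] unfolding set_mult_def by blast
      then show ?thesis using N_power_normalizer[OF VS V(4)] subgroup.subset[OF H(1)] by blast
    qed
  qed
  then show ?thesis using B_sub proper unfolding maximal_subgroup_def by blast
qed

text \<open>Intersecting with N recovers the k-th powers from their normalizers, so the powers of V
  and W are conjugate under G. Comparing first coordinates presents W as the image of V under an
  element of X, and stability of V finishes.\<close>

lemma conj_class_power_normalizer:
  assumes V: "subgroup V S" "normalizer S V = V" "stable_class S X V"
    and W: "subgroup W S" "normalizer S W = W"
    and conj: "power_normalizer G \<phi> k W \<in> conj_class G (power_normalizer G \<phi> k V)"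
  shows "conj_class S W = conj_class S V"
proof -
  have VS: "V \<subseteq> carrier S" "W \<subseteq> carrier S" and ne: "W \<noteq> {}"
    using V W subgroup.subset subgroup.one_closed by blast+
  obtain g where g: "g \<in> carrier G" "power_normalizer G \<phi> k W = G.conj_set g (power_normalizer G \<phi> k V)"
    using conj G.conj_class_iff by blast
  have "blk (\<lambda>_. W) = G.conj_set g (power_normalizer G \<phi> k V) \<inter> N"
    using power_normalizer_Int_N[OF W] g by simp
  also have "\<dots> = G.conj_set g (power_normalizer G \<phi> k V \<inter> N)"
  proof
    have B: "power_normalizer G \<phi> k V \<subseteq> carrier G" using power_normalizer_subgroup[OF VS(1)] subgroup.subset by blast
    show "G.conj_set g (power_normalizer G \<phi> k V) \<inter> N \<subseteq> G.conj_set g (power_normalizer G \<phi> k V \<inter> N)"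
    proof clarify
      fix x assume x: "x \<in> power_normalizer G \<phi> k V" "g \<otimes>\<^bsub>G\<^esub> x \<otimes>\<^bsub>G\<^esub> inv\<^bsub>G\<^esub> g \<in> N"
      then have xG: "x \<in> carrier G" using B by blast
      have "inv\<^bsub>G\<^esub> g \<otimes>\<^bsub>G\<^esub> (g \<otimes>\<^bsub>G\<^esub> x \<otimes>\<^bsub>G\<^esub> inv\<^bsub>G\<^esub> g) \<otimes>\<^bsub>G\<^esub> inv\<^bsub>G\<^esub> (inv\<^bsub>G\<^esub> g) \<in> N"
        using conj_N[of "inv\<^bsub>G\<^esub> g"] x g by blast
      then have "x \<in> N" using g xG by (simp add: G.group_simps)
      then show "g \<otimes>\<^bsub>G\<^esub> x \<otimes>\<^bsub>G\<^esub> inv\<^bsub>G\<^esub> g \<in> G.conj_set g (power_normalizer G \<phi> k V \<inter> N)" using x by blast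
    qed
    show "G.conj_set g (power_normalizer G \<phi> k V \<inter> N) \<subseteq> G.conj_set g (power_normalizer G \<phi> k V) \<inter> N"
      using conj_N[OF g(1)] by blast
  qed
  also have "\<dots> = G.conj_set g (blk (\<lambda>_. V))" using power_normalizer_Int_N[OF V(1,2)] by simp
  finally have *: "blk (\<lambda>_. W) = G.conj_set g (blk (\<lambda>_. V))" .
  obtain a \<sigma> where rep: "rep g a \<sigma>" using rep_coord[OF g(1)] by metis
  have "blk (\<lambda>_. W) = blk (\<lambda>i. a i ` V)" using * conj_blk[OF rep, of "\<lambda>_. V"] VS by simp
  moreover have aX: "a i \<in> X" if "i \<in> {1..k}" for i using rep that unfolding rep_def by blast
  moreover have "a i ` V \<subseteq> carrier S" if "i \<in> {1..k}" for i
    using X_closed[OF aX[OF that]] VS by blast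
  ultimately have "W = a 1 ` V"
    using blk_eqD[of "\<lambda>_. W" "\<lambda>i. a i ` V" 1] VS ne k by simp
  then have "W \<in> conj_class S V" using V(3) aX[of 1] k unfolding stable_class_def by simp
  then show ?thesis using S.conj_class_eq[OF VS(1)] by simp
qed

end

section \<open>Root systems\<close>

lemma coroot_inner: "coroot r \<bullet> s = 2 * (r \<bullet> s) / (r \<bullet> r)"
  by (simp add: coroot_def)

lemma coroot_inner_self: "r \<noteq> 0 \<Longrightarrow> coroot r \<bullet> r = 2"
  by (simp add: coroot_inner)

lemma coroot_minus: "coroot (- r) = - coroot r"
  by (simp add: coroot_def)

lemma inner_reflection: "r \<noteq> 0 \<Longrightarrow> reflection r s \<bullet> reflection r s = s \<bullet> s"
  by (simp add: reflection_def coroot_def inner_diff_left inner_diff_right inner_commute field_simps)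

text \<open>A reflection preserves lengths and therefore commutes with passing to coroots.\<close>

lemma coroot_reflection:
  assumes "a \<noteq> 0"
  shows "coroot (reflection a r) = coroot r - (coroot r \<bullet> a) *\<^sub>R coroot a"
proof -
  have "coroot (reflection a r) = (2 / (r \<bullet> r)) *\<^sub>R reflection a r"
    using inner_reflection[OF assms] by (simp add: coroot_def)
  also have "\<dots> = coroot r - (2 / (r \<bullet> r) * (coroot a \<bullet> r)) *\<^sub>R a"
    by (simp add: reflection_def coroot_def scaleR_diff_right)
  also have "(2 / (r \<bullet> r) * (coroot a \<bullet> r)) *\<^sub>R a = (coroot r \<bullet> a) *\<^sub>R coroot a"
    by (simp add: coroot_def inner_commute)
  finally show ?thesis .
qed

locale root_system =
  fixes \<Phi> \<Delta> :: "'v::euclidean_space set"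
  assumes irreducible: "irreducible_root_system \<Phi>" and simple: "simple_system \<Phi> \<Delta>"
begin

lemma finite_\<Phi>: "finite \<Phi>" and zero_notin: "0 \<notin> \<Phi>"
  and reflection_mem: "\<lbrakk>r \<in> \<Phi>; s \<in> \<Phi>\<rbrakk> \<Longrightarrow> reflection r s \<in> \<Phi>"
  and coroot_Ints: "\<lbrakk>r \<in> \<Phi>; s \<in> \<Phi>\<rbrakk> \<Longrightarrow> coroot r \<bullet> s \<in> \<int>"
  using irreducible by (simp_all add: irreducible_root_system_def)

lemma reduced: "\<lbrakk>r \<in> \<Phi>; a *\<^sub>R r \<in> \<Phi>\<rbrakk> \<Longrightarrow> a = 1 \<or> a = - 1"
proof -
  have "\<forall>r\<in>\<Phi>. \<forall>a. a *\<^sub>R r \<in> \<Phi> \<longrightarrow> a = 1 \<or> a = - 1"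
    using irreducible unfolding irreducible_root_system_def by (elim conjE)
  then show "\<lbrakk>r \<in> \<Phi>; a *\<^sub>R r \<in> \<Phi>\<rbrakk> \<Longrightarrow> a = 1 \<or> a = - 1" by blast
qed

lemma \<Delta>_sub: "\<Delta> \<subseteq> \<Phi>" and independent_\<Delta>: "independent \<Delta>" and span_\<Delta>: "span \<Delta> = UNIV"
  and coeff_Nats: "r \<in> \<Phi> \<Longrightarrow> (\<forall>a\<in>\<Delta>. representation \<Delta> r a \<in> \<nat>) \<or> (\<forall>a\<in>\<Delta>. - representation \<Delta> r a \<in> \<nat>)"
  using simple unfolding simple_system_def by blast+

lemma finite_\<Delta>: "finite \<Delta>"
  using finite_\<Phi> \<Delta>_sub finite_subset by blast

lemma root_nonzero: "r \<in> \<Phi> \<Longrightarrow> r \<noteq> 0"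
  using zero_notin by blast

lemma minus_mem: assumes "r \<in> \<Phi>" shows "- r \<in> \<Phi>"
proof -
  have "reflection r r = - r"
    using coroot_inner_self[OF root_nonzero[OF assms]] by (simp add: reflection_def scaleR_2)
  then show ?thesis using reflection_mem[OF assms assms] by simp
qed

lemma scaled_notin: "\<lbrakk>r \<in> \<Phi>; a \<noteq> 1; a \<noteq> - 1\<rbrakk> \<Longrightarrow> a *\<^sub>R r \<notin> \<Phi>"
  using reduced by blast

text \<open>Cauchy-Schwarz is strict because proportional roots are equal or opposite, so the
  integers \<open>coroot r \<bullet> s\<close> and \<open>coroot s \<bullet> r\<close> have a
  product below four. Unless the roots are orthogonal the product is positive, which bounds each
  factor by three.\<close>

lemma abs_coroot_le_3:
  assumes r: "r \<in> \<Phi>" and s: "s \<in> \<Phi>" and ne: "s \<noteq> r" "s \<noteq> - r"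
  shows "\<bar>coroot r \<bullet> s\<bar> \<le> 3"
proof (cases "r \<bullet> s = 0")
  case True
  then show ?thesis by (simp add: coroot_inner)
next
  case False
  have r0: "r \<noteq> 0" and s0: "s \<noteq> 0" using r s root_nonzero by blast+
  have "\<bar>r \<bullet> s\<bar> \<noteq> norm r * norm s"
  proof
    assume "\<bar>r \<bullet> s\<bar> = norm r * norm s"
    then have "norm r *\<^sub>R s = norm s *\<^sub>R r \<or> norm r *\<^sub>R s = - norm s *\<^sub>R r"
      by (rule norm_cauchy_schwarz_abs_eq[THEN iffD1])
    then have "\<exists>b. norm r *\<^sub>R s = b *\<^sub>R r" by blast
    then obtain b where "norm r *\<^sub>R s = b *\<^sub>R r" by blast
    moreover have "s = inverse (norm r) *\<^sub>R (norm r *\<^sub>R s)" using r0 by simp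
    ultimately obtain a where a: "s = a *\<^sub>R r" by (metis scaleR_scaleR)
    then have "a = 1 \<or> a = - 1" using reduced r s by blast
    then show False using a ne by auto
  qed
  then have "\<bar>r \<bullet> s\<bar> < norm r * norm s"
    using Cauchy_Schwarz_ineq2[of r s] by linarith
  then have "\<bar>r \<bullet> s\<bar> ^ 2 < (norm r * norm s) ^ 2"
    by (intro power_strict_mono) auto
  then have lt: "(r \<bullet> s)\<^sup>2 < (r \<bullet> r) * (s \<bullet> s)"
    by (simp add: power_mult_distrib power2_norm_eq_inner)
  have pos: "r \<bullet> r > 0" "s \<bullet> s > 0" using r0 s0 by auto
  have "(coroot r \<bullet> s) * (coroot s \<bullet> r) = 4 * (r \<bullet> s)\<^sup>2 / ((r \<bullet> r) * (s \<bullet> s))"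
    by (simp add: coroot_inner inner_commute[of s r] power2_eq_square)
  also have "\<dots> < 4" using lt pos by (simp add: divide_less_eq)
  finally have prod: "(coroot r \<bullet> s) * (coroot s \<bullet> r) < 4" .
  obtain m n where m: "coroot r \<bullet> s = of_int m" and n: "coroot s \<bullet> r = of_int n"
    using coroot_Ints r s by (metis Ints_cases)
  have "0 < (coroot r \<bullet> s) * (coroot s \<bullet> r)"
    using False pos unfolding coroot_inner inner_commute[of s r]
    by (auto simp: zero_less_mult_iff zero_less_divide_iff)
  then have mn: "0 < m * n" "m * n < 4"
    using prod unfolding m n by (simp_all flip: of_int_mult)
  then have "n \<noteq> 0" by auto
  then have "\<bar>m\<bar> * 1 \<le> \<bar>m\<bar> * \<bar>n\<bar>" by (intro mult_left_mono) auto
  then have "\<bar>m\<bar> \<le> 3" using mn by (simp flip: abs_mult)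
  then show ?thesis unfolding m by linarith
qed

lemma string_length:
  assumes r: "r \<in> \<Phi>" and s: "s \<in> insert 0 \<Phi>" and s4: "s + 4 *\<^sub>R r \<in> insert 0 \<Phi>"
  shows False
proof -
  have multiple: "s \<noteq> a *\<^sub>R r" for a
  proof
    assume a: "s = a *\<^sub>R r"
    then have *: "s + 4 *\<^sub>R r = (a + 4) *\<^sub>R r" by (simp add: scaleR_left_distrib)
    have "a = 0 \<or> a = 1 \<or> a = - 1" using s a reduced[OF r, of a] r root_nonzero[OF r] by auto
    moreover have "a + 4 = 0 \<or> a + 4 = 1 \<or> a + 4 = - 1"
      using s4 * reduced[OF r, of "a + 4"] root_nonzero[OF r] by auto
    ultimately show False by auto
  qed
  have s\<Phi>: "s \<in> \<Phi>" using s multiple[of 0] by auto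
  have "s + 4 *\<^sub>R r \<noteq> a *\<^sub>R r" for a
    using multiple[of "a - 4"] by (metis add_diff_cancel_right' scaleR_left_diff_distrib)
  from this[of 0] this[of 1] this[of "- 1"]
  have s4\<Phi>: "s + 4 *\<^sub>R r \<in> \<Phi>" "s + 4 *\<^sub>R r \<noteq> r" "s + 4 *\<^sub>R r \<noteq> - r" using s4 by auto
  have "s \<noteq> r" "s \<noteq> - r" using multiple[of 1] multiple[of "- 1"] by auto
  then have "\<bar>coroot r \<bullet> s\<bar> \<le> 3" using abs_coroot_le_3 r s\<Phi> by blast
  moreover have "\<bar>coroot r \<bullet> (s + 4 *\<^sub>R r)\<bar> \<le> 3" using abs_coroot_le_3[OF r s4\<Phi>] .
  moreover have "coroot r \<bullet> (s + 4 *\<^sub>R r) = coroot r \<bullet> s + 8"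
    using coroot_inner_self[OF root_nonzero[OF r]] by (simp add: inner_add_right)
  ultimately show False by linarith
qed

lemma span_coroots: "span (coroot ` \<Delta>) = UNIV"
proof -
  have "\<Delta> \<subseteq> span (coroot ` \<Delta>)"
  proof
    fix a assume a: "a \<in> \<Delta>"
    then have "a \<noteq> 0" using \<Delta>_sub root_nonzero by blast
    then have "a = ((a \<bullet> a) / 2) *\<^sub>R coroot a" by (simp add: coroot_def)
    then show "a \<in> span (coroot ` \<Delta>)" using a by (metis image_eqI span_base span_scale)
  qed
  then show ?thesis using span_minimal[OF _ subspace_span] span_\<Delta> by blast
qed

lemma card_\<Delta>: "card \<Delta> = DIM('v)"
  using dim_eq_card_independent[OF independent_\<Delta>] dim_span[of \<Delta>] span_\<Delta> dim_UNIV by metis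

lemma independent_coroots: "independent (coroot ` \<Delta>)"
  using span_coroots card_\<Delta> card_image_le[OF finite_\<Delta>, of coroot] finite_\<Delta>
  by (intro card_le_dim_spanning[of _ UNIV]) (auto simp: dim_UNIV)

lemma inj_coroot: "inj_on coroot \<Delta>"
proof -
  have "card (coroot ` \<Delta>) = DIM('v)"
    using dim_eq_card_independent[OF independent_coroots] dim_span[of "coroot ` \<Delta>"] span_coroots dim_UNIV
    by metis
  then show ?thesis using card_\<Delta> finite_\<Delta> by (simp add: eq_card_imp_inj_on)
qed

text \<open>Induction on the height of r. If r is not simple, some simple a has positive inner
  product with r; reflecting in a lowers the height, keeps the root positive, and changes the coroot
  by an integral multiple of the coroot of a.\<close>

lemma coroot_integral_positive:
  assumes "r \<in> \<Phi>" "\<forall>a\<in>\<Delta>. representation \<Delta> r a \<in> \<nat>"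
  shows "\<forall>b. representation (coroot ` \<Delta>) (coroot r) b \<in> \<int>"
proof -
  have "real n = (\<Sum>a\<in>\<Delta>. representation \<Delta> r a) \<Longrightarrow> r \<in> \<Phi> \<Longrightarrow> \<forall>a\<in>\<Delta>. representation \<Delta> r a \<in> \<nat> \<Longrightarrow>
      \<forall>b. representation (coroot ` \<Delta>) (coroot r) b \<in> \<int>" for n r
  proof (induction n arbitrary: r rule: less_induct)
    case (less n)
    show ?case
    proof (cases "r \<in> \<Delta>")
      case True
      then show ?thesis using representation_basis[OF independent_coroots, of "coroot r"] by simp
    next
      case False
      let ?n = "representation \<Delta> r"
      have nonneg: "0 \<le> ?n a" if "a \<in> \<Delta>" for a using less.prems(3) that by (auto elim!: Nats_cases)
      have sum: "(\<Sum>a\<in>\<Delta>. ?n a *\<^sub>R a) = r"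
        using sum_representation_eq[OF independent_\<Delta>, of r \<Delta>] span_\<Delta> finite_\<Delta> by simp
      have "0 < r \<bullet> r" using root_nonzero less.prems by simp
      also have "r \<bullet> r = (\<Sum>a\<in>\<Delta>. ?n a * (a \<bullet> r))"
        by (subst (1) sum[symmetric]) (simp add: inner_sum_left)
      finally obtain a where a: "a \<in> \<Delta>" "0 < ?n a * (a \<bullet> r)"
        by (meson not_less sum_nonpos)
      then have ar: "0 < a \<bullet> r" using nonneg[OF a(1)] by (simp add: zero_less_mult_iff)
      have a\<Phi>: "a \<in> \<Phi>" "a \<noteq> 0" using a \<Delta>_sub root_nonzero by blast+
      define r' where "r' = reflection a r"
      have r'\<Phi>: "r' \<in> \<Phi>" unfolding r'_def using reflection_mem a\<Phi> less.prems by blast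
      obtain m where m: "coroot a \<bullet> r = of_int m" using coroot_Ints[OF a\<Phi>(1) less.prems(2)] by (metis Ints_cases)
      have "0 < coroot a \<bullet> r" using ar a\<Phi> by (simp add: coroot_inner)
      then have m1: "1 \<le> m" using m by simp
      have rep': "representation \<Delta> r' b = ?n b - (if b = a then of_int m else 0)" for b
        unfolding r'_def reflection_def m
        using representation_diff[OF independent_\<Delta>] representation_scale[OF independent_\<Delta>]
          representation_basis[OF independent_\<Delta> a(1)] span_\<Delta> by simp
      \<comment> \<open>A positive root that is not simple involves a second simple root. The
        reflection in a leaves that coefficient alone, which prevents the reflected root from being
        negative.\<close>
      have "\<exists>b\<in>\<Delta>. b \<noteq> a \<and> ?n b \<noteq> 0"
      proof (rule ccontr)
        assume "\<not> ?thesis"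
        then have "(\<Sum>b\<in>\<Delta>. ?n b *\<^sub>R b) = (\<Sum>b\<in>\<Delta>. if b = a then ?n a *\<^sub>R a else 0)"
          by (intro sum.cong) auto
        also have "\<dots> = ?n a *\<^sub>R a" using a finite_\<Delta> by simp
        finally have *: "r = ?n a *\<^sub>R a" unfolding sum .
        then have "?n a = 1 \<or> ?n a = - 1" using reduced[OF a\<Phi>(1)] less.prems(2) by metis
        then have "?n a = 1" using nonneg[OF a(1)] by auto
        then show False using * a False by simp
      qed
      then obtain b where b: "b \<in> \<Delta>" "b \<noteq> a" "?n b \<noteq> 0" by blast
      then have "\<not> - representation \<Delta> r' b \<in> \<nat>" using rep'[of b] nonneg[of b] by (auto elim!: Nats_cases)
      then have pos': "\<forall>a\<in>\<Delta>. representation \<Delta> r' a \<in> \<nat>" using coeff_Nats[OF r'\<Phi>] b by blast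
      have "(\<Sum>b\<in>\<Delta>. representation \<Delta> r' b) = real n - of_int m"
        unfolding less.prems(1) rep' using a finite_\<Delta> by (simp add: sum_subtractf)
      moreover have "0 \<le> (\<Sum>b\<in>\<Delta>. representation \<Delta> r' b)"
        using pos' by (intro sum_nonneg) (auto elim!: Nats_cases)
      ultimately have "real (nat (int n - m)) = (\<Sum>b\<in>\<Delta>. representation \<Delta> r' b)" "nat (int n - m) < n"
        using m1 by auto
      then have IH: "\<forall>b. representation (coroot ` \<Delta>) (coroot r') b \<in> \<int>"
        using less.IH r'\<Phi> pos' by blast
      have eq: "coroot r = coroot r' + (coroot r \<bullet> a) *\<^sub>R coroot a"
        unfolding r'_def using coroot_reflection[OF a\<Phi>(2)] by simp
      have "representation (coroot ` \<Delta>) (coroot r) b =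
          representation (coroot ` \<Delta>) (coroot r') b + (coroot r \<bullet> a) * (if coroot a = b then 1 else 0)" for b
        by (subst eq) (use span_coroots representation_add[OF independent_coroots]
          representation_scale[OF independent_coroots] representation_basis[OF independent_coroots, of "coroot a"] a
          in simp)
      then show ?thesis using IH coroot_Ints[OF less.prems(2) a\<Phi>(1)] by simp
    qed
  qed
  moreover have "\<exists>n::nat. real n = (\<Sum>a\<in>\<Delta>. representation \<Delta> r a)"
  proof -
    have "(\<Sum>a\<in>A. representation \<Delta> r a) \<in> \<nat>" if "finite A" "A \<subseteq> \<Delta>" for A
      using that assms(2) by (induction A rule: finite_induct) auto
    from this[OF finite_\<Delta> order_refl] have "(\<Sum>a\<in>\<Delta>. representation \<Delta> r a) \<in> \<nat>" .
    then show ?thesis by (metis Nats_cases)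
  qed
  ultimately show ?thesis using assms by blast
qed

lemma coroot_integral:
  assumes "r \<in> \<Phi>"
  shows "representation (coroot ` \<Delta>) (coroot r) b \<in> \<int>"
proof (cases "\<forall>a\<in>\<Delta>. representation \<Delta> r a \<in> \<nat>")
  case True
  then show ?thesis using coroot_integral_positive assms by blast
next
  case False
  have "representation \<Delta> (- r) a = - representation \<Delta> r a" for a
    using representation_neg[OF independent_\<Delta>, of r] span_\<Delta> by auto
  then have "\<forall>a\<in>\<Delta>. representation \<Delta> (- r) a \<in> \<nat>" using False coeff_Nats[OF assms] by auto
  then have "representation (coroot ` \<Delta>) (coroot (- r)) b \<in> \<int>"
    using coroot_integral_positive minus_mem[OF assms] by blast
  then show ?thesis
    using representation_neg[OF independent_coroots, of "coroot r"] span_coroots by (simp add: coroot_minus)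
qed

text \<open>Integrality makes all the floors exact; the identity is then the expansion of the coroot
  of r in simple coroots, paired with s.\<close>

lemma sum_coroot_vec:
  assumes r: "r \<in> \<Phi>" and s: "s \<in> \<Phi>"
  shows "(\<Sum>a\<in>\<Delta>. coroot_vec \<Delta> r (Hb a) * \<lfloor>coroot a \<bullet> s\<rfloor>) = \<lfloor>coroot r \<bullet> s\<rfloor>"
proof -
  let ?m = "\<lambda>a. representation (coroot ` \<Delta>) (coroot r) (coroot a)"
  have floor: "of_int \<lfloor>x\<rfloor> = x" if "x \<in> \<int>" for x :: real using that by (auto elim: Ints_cases)
  have "of_int (\<Sum>a\<in>\<Delta>. coroot_vec \<Delta> r (Hb a) * \<lfloor>coroot a \<bullet> s\<rfloor>) = (\<Sum>a\<in>\<Delta>. ?m a * (coroot a \<bullet> s))"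
    using floor coroot_integral[OF r] coroot_Ints[OF _ s] \<Delta>_sub by (simp add: coroot_vec_def subset_iff)
  also have "\<dots> = (\<Sum>a\<in>\<Delta>. ?m a *\<^sub>R coroot a) \<bullet> s" by (simp add: inner_sum_left)
  also have "(\<Sum>a\<in>\<Delta>. ?m a *\<^sub>R coroot a) = (\<Sum>b\<in>coroot ` \<Delta>. representation (coroot ` \<Delta>) (coroot r) b *\<^sub>R b)"
    by (simp add: sum.reindex[OF inj_coroot])
  also have "\<dots> = coroot r"
    using sum_representation_eq[OF independent_coroots, of "coroot r"] span_coroots finite_\<Delta> by simp
  also have "coroot r \<bullet> s = of_int \<lfloor>coroot r \<bullet> s\<rfloor>" using floor coroot_Ints[OF r s] by simp
  finally show ?thesis using of_int_eq_iff by blast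
qed

end

section \<open>Integral representations of \<open>sl\<^sub>2\<close>\<close>

text \<open>Truncated exponentials in an integral representation of \<open>sl\<^sub>2\<close>, multiplied by six to clear
  denominators.\<close>

definition exp6 :: "int \<Rightarrow> (('i \<Rightarrow> int) \<Rightarrow> 'i \<Rightarrow> int) \<Rightarrow> ('i \<Rightarrow> int) \<Rightarrow> 'i \<Rightarrow> int" where
  "exp6 e E v = (\<lambda>j. 6 * v j + 6 * e * E v j + 3 * e\<^sup>2 * E (E v) j + e ^ 3 * E (E (E v)) j)"

definition int_linear :: "(('i \<Rightarrow> int) \<Rightarrow> 'i \<Rightarrow> int) \<Rightarrow> bool" where
  "int_linear E \<longleftrightarrow> (\<forall>x y. E (\<lambda>j. x j + y j) = (\<lambda>j. E x j + E y j)) \<and>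
     (\<forall>k x. E (\<lambda>j. k * x j) = (\<lambda>j. k * E x j))"

lemma int_linear_add: "int_linear E \<Longrightarrow> E (\<lambda>j. x j + y j) = (\<lambda>j. E x j + E y j)"
  and int_linear_scale: "int_linear E \<Longrightarrow> E (\<lambda>j. k * x j) = (\<lambda>j. k * E x j)"
  by (simp_all add: int_linear_def)

lemma int_linear_diff: "int_linear E \<Longrightarrow> E (\<lambda>j. x j - y j) = (\<lambda>j. E x j - E y j)"
  using int_linear_add[of E x "\<lambda>j. - 1 * y j"] int_linear_scale[of E "- 1" y] by simp

lemma int_linear_minus: "int_linear E \<Longrightarrow> E (\<lambda>j. - x j) = (\<lambda>j. - E x j)"
  using int_linear_scale[of E "- 1" x] by simp

lemmas int_linear_simps = int_linear_add int_linear_scale int_linear_diff int_linear_minus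

lemma int_linear_exp6: "int_linear E \<Longrightarrow> int_linear (exp6 e E)"
  unfolding int_linear_def[of "exp6 e E"] exp6_def
  by (simp add: int_linear_simps algebra_simps mult.left_commute)

text \<open>Each factor carries a clearing factor six, hence 36. Terms of degree one to three cancel
  binomially, and higher ones vanish.\<close>

lemma exp6_inverse:
  assumes "int_linear E" and E4: "\<And>v. E (E (E (E v))) = (\<lambda>j. 0)"
  shows "exp6 1 E (exp6 (- 1) E v) = (\<lambda>j. 36 * v j)"
proof -
  have E0: "E (\<lambda>j. 0) = (\<lambda>j. 0)" using int_linear_scale[OF assms(1), of 0 "\<lambda>j. 0"] by simp
  show ?thesis
    unfolding exp6_def by (simp add: int_linear_simps[OF assms(1)] E4 E0 fun_eq_iff)
qed

locale sl2 =
  fixes E F H :: "('i \<Rightarrow> int) \<Rightarrow> 'i \<Rightarrow> int"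
  assumes E: "int_linear E" and F: "int_linear F" and H: "int_linear H"
    and HE: "\<And>v. H (E v) = (\<lambda>j. E (H v) j + 2 * E v j)"
    and HF: "\<And>v. H (F v) = (\<lambda>j. F (H v) j - 2 * F v j)"
    and EF: "\<And>v. E (F v) = (\<lambda>j. F (E v) j + H v j)"
    and E4: "\<And>v. E (E (E (E v))) = (\<lambda>j. 0)"
    and F4: "\<And>v. F (F (F (F v))) = (\<lambda>j. 0)"
begin

lemmas lin = int_linear_simps[OF E] int_linear_simps[OF F] int_linear_simps[OF H]

text \<open>From [H, E] = 2 E one gets H exp(E) = exp(E) (H + 2 E); truncation loses nothing because
  the fourth power of E is zero.\<close>

lemma H_exp_E: "H (exp6 1 E v) = (\<lambda>j. exp6 1 E (H v) j + 2 * exp6 1 E (E v) j)"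
  unfolding exp6_def by (intro ext, simp add: lin HE E4)

lemma H_exp_F: "H (exp6 (- 1) F v) = (\<lambda>j. exp6 (- 1) F (H v) j + 2 * exp6 (- 1) F (F v) j)"
  unfolding exp6_def by (intro ext, simp add: lin HF F4)

text \<open>Commuting E past the vanishing fourth power of F gives 4 F^3 (H - 3) = 0. The relation
  is needed because the exponential is truncated: it is exactly the error term in E exp(-F) =
  exp(-F) (E - H - F).\<close>

lemma F3: "F (F (F (H v))) = (\<lambda>j. 3 * F (F (F v)) j)"
proof -
  have *: "E (F (F (F w))) = (\<lambda>j. F (F (F (E w))) j + 3 * F (F (H w)) j - 6 * F (F w) j)" for w
    by (intro ext, simp add: EF HF lin)
  have "E (F (F (F (F v)))) = (\<lambda>j. 4 * F (F (F (H v))) j - 12 * F (F (F v)) j)"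
    unfolding *[of "F v"] by (intro ext, simp add: EF HF lin F4)
  moreover have "E (F (F (F (F v)))) = (\<lambda>j. 0)"
    unfolding F4 using int_linear_scale[OF E, of 0 "\<lambda>j. 0"] by simp
  ultimately show ?thesis by (auto simp: fun_eq_iff)
qed

lemma E_exp_F: "E (exp6 (- 1) F v) =
    (\<lambda>j. exp6 (- 1) F (E v) j - exp6 (- 1) F (H v) j - exp6 (- 1) F (F v) j)"
  unfolding exp6_def by (intro ext, simp add: lin EF HF F4 F3)

text \<open>Moving H to the right through exp(E), exp(-F) and exp(E) turns it successively into H +
  2 E, then 2 E - H, and finally -H. A Weyl element thus negates the weight.\<close>

lemma H_weyl: "H (exp6 1 E (exp6 (- 1) F (exp6 1 E v))) =
    (\<lambda>j. - exp6 1 E (exp6 (- 1) F (exp6 1 E (H v))) j)"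
proof -
  note lins = int_linear_simps[OF int_linear_exp6[OF E, of 1]] int_linear_simps[OF int_linear_exp6[OF F, of "- 1"]]
  have EE: "E (exp6 1 E w) = exp6 1 E (E w)" for w
    unfolding exp6_def by (simp add: lin)
  have "H (exp6 1 E (exp6 (- 1) F w)) =
      (\<lambda>j. 2 * exp6 1 E (exp6 (- 1) F (E w)) j - exp6 1 E (exp6 (- 1) F (H w)) j)" for w
    by (intro ext, simp add: H_exp_E H_exp_F E_exp_F lins)
  from this[of "exp6 1 E v"] show ?thesis
    by (intro ext, simp add: H_exp_E EE lins)
qed

end

section \<open>The Chevalley Lie algebra\<close>

fun weight :: "'v::zero basis_index \<Rightarrow> 'v" where
  "weight (Hb a) = 0"
| "weight (Eb r) = r"

locale chevalley = root_system \<Phi> \<Delta> for \<Phi> \<Delta> :: "'v::euclidean_space set" +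
  fixes c :: "'v \<Rightarrow> 'v \<Rightarrow> int"
  assumes constants: "chevalley_constants \<Phi> \<Delta> c"
begin

abbreviation "I \<equiv> chev_basis \<Phi> \<Delta>"
abbreviation "bracket \<equiv> lie_bracket \<Phi> \<Delta> c"
abbreviation "ad r \<equiv> bracket (unit_vec (Eb r))"

lemma finite_I: "finite I"
  unfolding chev_basis_def using finite_\<Delta> finite_\<Phi> by simp

lemma mem_I [simp]: "Hb a \<in> I \<longleftrightarrow> a \<in> \<Delta>" "Eb r \<in> I \<longleftrightarrow> r \<in> \<Phi>"
  unfolding chev_basis_def by auto

lemma weight_I: "j \<in> I \<Longrightarrow> weight j \<in> insert 0 \<Phi>"
  by (cases j) auto

lemma int_linear_bracket: "int_linear (bracket x)"
  unfolding int_linear_def lie_bracket_def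
  by (simp add: fun_eq_iff algebra_simps sum.distrib sum_distrib_left mult.left_commute)

lemma bracket_add_left: "bracket (\<lambda>j. x j + y j) z j = bracket x z j + bracket y z j"
  unfolding lie_bracket_def by (simp add: algebra_simps sum.distrib)

lemma bracket_add_right: "bracket z (\<lambda>j. x j + y j) j = bracket z x j + bracket z y j"
  using int_linear_add[OF int_linear_bracket] by (metis (no_types))

lemma bracket_self: "bracket x x j = 0"
  using constants unfolding chevalley_constants_def by metis

lemma jacobi: "bracket x (bracket y z) j + bracket y (bracket z x) j + bracket z (bracket x y) j = 0"
  using constants unfolding chevalley_constants_def by blast

lemma structure_constant:
  "\<lbrakk>r \<in> \<Phi>; s \<in> \<Phi>; r + s \<in> \<Phi>\<rbrakk> \<Longrightarrow> \<bar>c r s\<bar> = int (Max {p. s - real p *\<^sub>R r \<in> \<Phi>}) + 1"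
  using constants unfolding chevalley_constants_def by blast

lemma bracket_antisym: "bracket x y = (\<lambda>j. - bracket y x j)"
proof
  fix j
  have "bracket (\<lambda>j. x j + y j) (\<lambda>j. x j + y j) j = 0" by (rule bracket_self)
  then show "bracket x y j = - bracket y x j"
    by (simp add: bracket_add_left bracket_add_right bracket_self)
qed

lemma ad_expand:
  assumes "a \<in> I"
  shows "bracket (unit_vec a) v j = (\<Sum>b\<in>I. v b * basis_bracket \<Phi> \<Delta> c a b j)"
proof -
  have "bracket (unit_vec a) v j = (\<Sum>a'\<in>I. if a' = a then (\<Sum>b\<in>I. v b * basis_bracket \<Phi> \<Delta> c a b j) else 0)"
    unfolding lie_bracket_def by (intro sum.cong) (auto simp: unit_vec_def)
  then show ?thesis using assms finite_I by simp
qed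

lemma bracket_unit:
  assumes "a \<in> I" "b \<in> I"
  shows "bracket (unit_vec a) (unit_vec b) = basis_bracket \<Phi> \<Delta> c a b"
proof
  fix j
  have "bracket (unit_vec a) (unit_vec b) j = (\<Sum>b'\<in>I. if b' = b then basis_bracket \<Phi> \<Delta> c a b j else 0)"
    unfolding ad_expand[OF assms(1)] by (intro sum.cong) (auto simp: unit_vec_def)
  then show "bracket (unit_vec a) (unit_vec b) j = basis_bracket \<Phi> \<Delta> c a b j"
    using assms finite_I by simp
qed

lemma basis_bracket_weight:
  assumes "a \<in> I" "b \<in> I" "basis_bracket \<Phi> \<Delta> c a b j \<noteq> 0"
  shows "j \<in> I \<and> weight j = weight a + weight b"
proof (cases a; cases b)
  fix r s assume "a = Eb r" "b = Eb s"
  then show ?thesis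
    using assms(3) by (auto simp: unit_vec_def coroot_vec_def split: if_splits basis_index.splits)
qed (use assms in \<open>auto simp: unit_vec_def split: if_splits\<close>)

lemma ad_weight:
  assumes "r \<in> \<Phi>" "ad r v j \<noteq> 0"
  shows "\<exists>b\<in>I. v b \<noteq> 0 \<and> j \<in> I \<and> weight j = weight b + r"
proof -
  obtain b where b: "b \<in> I" "v b * basis_bracket \<Phi> \<Delta> c (Eb r) b j \<noteq> 0"
    using assms ad_expand[of "Eb r" v j] by (metis (no_types, lifting) mem_I(2) sum.neutral)
  then show ?thesis using basis_bracket_weight[of "Eb r" b j] assms(1) by (auto simp: add.commute)
qed

lemma ad_pow_weight:
  assumes r: "r \<in> \<Phi>" and b: "b \<in> I" and "(ad r ^^ i) (unit_vec b) j \<noteq> 0"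
  shows "j \<in> I \<and> weight j = weight b + real i *\<^sub>R r"
  using assms(3)
proof (induction i arbitrary: j)
  case 0
  then show ?case using b by (auto simp: unit_vec_def split: if_splits)
next
  case (Suc i)
  then obtain m where "m \<in> I" "(ad r ^^ i) (unit_vec b) m \<noteq> 0" "j \<in> I" "weight j = weight m + r"
    using ad_weight[OF r] by fastforce
  then show ?case using Suc.IH[of m] by (simp add: scaleR_left_distrib)
qed

lemma ad_4: assumes r: "r \<in> \<Phi>" shows "ad r (ad r (ad r (ad r v))) = (\<lambda>j. 0)"
proof
  fix j show "ad r (ad r (ad r (ad r v))) j = 0"
  proof (rule ccontr)
    assume "\<not> ?thesis"
    then obtain j1 j2 j3 j4 where "j1 \<in> I" "j2 \<in> I" "j3 \<in> I" "j4 \<in> I" "j \<in> I"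
      "weight j = weight j1 + r" "weight j1 = weight j2 + r" "weight j2 = weight j3 + r" "weight j3 = weight j4 + r"
      using ad_weight[OF r] by meson
    moreover from this have "weight j = weight j4 + 4 *\<^sub>R r"
      by (simp add: scaleR_left_distrib[of 1 3 r, simplified] scaleR_left_distrib[of 1 2 r, simplified] scaleR_2)
    ultimately show False using string_length[OF r, of "weight j4"] weight_I by metis
  qed
qed

definition pairing :: "'v \<Rightarrow> 'v basis_index \<Rightarrow> int" where
  "pairing r j = \<lfloor>coroot r \<bullet> weight j\<rfloor>"

lemma of_int_pairing: "\<lbrakk>r \<in> \<Phi>; j \<in> I\<rbrakk> \<Longrightarrow> of_int (pairing r j) = coroot r \<bullet> weight j"
  unfolding pairing_def using coroot_Ints[of r "weight j"] weight_I[of j]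
  by (auto elim!: Ints_cases)

lemma pairing_shift:
  assumes "r \<in> \<Phi>" "j \<in> I" "b \<in> I" "weight j = weight b + of_int n *\<^sub>R r"
  shows "pairing r j = pairing r b + 2 * n"
proof -
  have "of_int (pairing r j) = (of_int (pairing r b + 2 * n) :: real)"
    using assms of_int_pairing coroot_inner_self[OF root_nonzero[OF assms(1)]]
    by (simp add: inner_add_right)
  then show ?thesis using of_int_eq_iff by blast
qed

text \<open>Each simple coroot scales a root vector by an integer, and \<open>sum_coroot_vec\<close>
  adds up these scalars.\<close>

lemma bracket_coroot_vec:
  assumes r: "r \<in> \<Phi>"
  shows "bracket (coroot_vec \<Delta> r) v j = (if j \<in> I then pairing r j * v j else 0)"
proof -
  have disj: "Hb ` \<Delta> \<inter> Eb ` \<Phi> = {}" by auto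
  have inj: "inj_on Hb \<Delta>" "inj_on Eb \<Phi>" by (auto simp: inj_on_def)
  have "bracket (coroot_vec \<Delta> r) v j =
      (\<Sum>a\<in>\<Delta>. \<Sum>b\<in>I. coroot_vec \<Delta> r (Hb a) * v b * basis_bracket \<Phi> \<Delta> c (Hb a) b j)"
    unfolding lie_bracket_def chev_basis_def[of \<Phi> \<Delta>]
    by (subst sum.union_disjoint) (use finite_\<Delta> finite_\<Phi> disj in \<open>auto simp: sum.reindex[OF inj(1)] sum.reindex[OF inj(2)] coroot_vec_def\<close>)
  also have "\<dots> = (\<Sum>a\<in>\<Delta>. \<Sum>s\<in>\<Phi>. coroot_vec \<Delta> r (Hb a) * v (Eb s) * (\<lfloor>coroot a \<bullet> s\<rfloor> * unit_vec (Eb s) j))"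
    unfolding chev_basis_def[of \<Phi> \<Delta>]
    by (intro sum.cong refl, subst sum.union_disjoint) (use finite_\<Delta> finite_\<Phi> disj in \<open>auto simp: sum.reindex[OF inj(1)] sum.reindex[OF inj(2)]\<close>)
  also have "\<dots> = (\<Sum>s\<in>\<Phi>. (\<Sum>a\<in>\<Delta>. coroot_vec \<Delta> r (Hb a) * \<lfloor>coroot a \<bullet> s\<rfloor>) * (v (Eb s) * unit_vec (Eb s) j))"
    by (subst sum.swap) (simp add: sum_distrib_right sum_distrib_left mult.assoc mult.left_commute)
  also have "\<dots> = (\<Sum>s\<in>\<Phi>. \<lfloor>coroot r \<bullet> s\<rfloor> * (v (Eb s) * unit_vec (Eb s) j))"
    using sum_coroot_vec[OF r] by (intro sum.cong) auto
  also have "\<dots> = (if j \<in> I then pairing r j * v j else 0)"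
  proof (cases j)
    case (Hb a)
    then show ?thesis by (simp add: unit_vec_def pairing_def)
  next
    case (Eb s)
    have "(\<Sum>s'\<in>\<Phi>. \<lfloor>coroot r \<bullet> s'\<rfloor> * (v (Eb s') * unit_vec (Eb s') j)) =
        (\<Sum>s'\<in>\<Phi>. if s' = s then \<lfloor>coroot r \<bullet> s\<rfloor> * v (Eb s) else 0)"
      using Eb by (intro sum.cong) (auto simp: unit_vec_def)
    then show ?thesis using Eb finite_\<Phi> by (simp add: pairing_def)
  qed
  finally show ?thesis .
qed

lemma ad_minus_root:
  assumes r: "r \<in> \<Phi>"
  shows "ad r (unit_vec (Eb (- r))) = coroot_vec \<Delta> r"
  using bracket_unit[of "Eb r" "Eb (- r)"] r minus_mem by (auto simp: fun_eq_iff)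

lemma ad_coroot_vec:
  assumes r: "r \<in> \<Phi>"
  shows "ad r (coroot_vec \<Delta> r) = (\<lambda>j. - 2 * unit_vec (Eb r) j)"
proof
  fix j
  have "pairing r (Eb r) = 2"
    using of_int_pairing[of r "Eb r"] r coroot_inner_self[OF root_nonzero[OF r]] by simp
  then show "ad r (coroot_vec \<Delta> r) j = - 2 * unit_vec (Eb r) j"
    using bracket_antisym[of "unit_vec (Eb r)" "coroot_vec \<Delta> r"] bracket_coroot_vec[OF r, of "unit_vec (Eb r)" j] r
    by (auto simp: unit_vec_def)
qed

lemma ad_self: assumes r: "r \<in> \<Phi>" shows "ad r (unit_vec (Eb r)) = (\<lambda>j. 0)"
  using bracket_self by (intro ext)

text \<open>The relations of H with E and F hold because bracketing with a root vector shifts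
  weights by the root, so pairings change by 2 or -2. The relation between E and F is the Jacobi
  identity.\<close>

lemma sl2_root:
  assumes r: "r \<in> \<Phi>"
  shows "sl2 (ad r) (ad (- r)) (bracket (coroot_vec \<Delta> r))"
proof
  have r': "- r \<in> \<Phi>" using minus_mem r .
  show "int_linear (ad r)" "int_linear (ad (- r))" "int_linear (bracket (coroot_vec \<Delta> r))"
    by (rule int_linear_bracket)+
  show "ad r (ad r (ad r (ad r v))) = (\<lambda>j. 0)" "ad (- r) (ad (- r) (ad (- r) (ad (- r) v))) = (\<lambda>j. 0)" for v
    using ad_4 r r' by blast+
  \<comment> \<open>The multiplier n treats both root vectors at once: it is 1 for r and -1 for the
    opposite root.\<close>
  have shift: "bracket (coroot_vec \<Delta> r) (ad s v) j = ad s (bracket (coroot_vec \<Delta> r) v) j + 2 * n * ad s v j"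
    if s: "s \<in> \<Phi>" "s = of_int n *\<^sub>R r" for s n v j
  proof (cases "j \<in> I")
    case True
    have *: "pairing r j * (v b * basis_bracket \<Phi> \<Delta> c (Eb s) b j) =
        bracket (coroot_vec \<Delta> r) v b * basis_bracket \<Phi> \<Delta> c (Eb s) b j +
        2 * n * (v b * basis_bracket \<Phi> \<Delta> c (Eb s) b j)" if b: "b \<in> I" for b
    proof (cases "basis_bracket \<Phi> \<Delta> c (Eb s) b j = 0")
      case False
      then have "weight j = weight b + s" using basis_bracket_weight[of "Eb s" b j] b s by (simp add: add.commute)
      then have "pairing r j = pairing r b + 2 * n" using pairing_shift[OF r True b] s by simp
      then show ?thesis using bracket_coroot_vec[OF r, of v b] b by (simp add: algebra_simps)
    qed simp
    have "bracket (coroot_vec \<Delta> r) (ad s v) j = (\<Sum>b\<in>I. pairing r j * (v b * basis_bracket \<Phi> \<Delta> c (Eb s) b j))"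
      using bracket_coroot_vec[OF r, of "ad s v" j] True s ad_expand[of "Eb s" v j] by (simp add: sum_distrib_left)
    also have "\<dots> = (\<Sum>b\<in>I. bracket (coroot_vec \<Delta> r) v b * basis_bracket \<Phi> \<Delta> c (Eb s) b j +
        2 * n * (v b * basis_bracket \<Phi> \<Delta> c (Eb s) b j))"
      using * by (intro sum.cong) auto
    also have "\<dots> = ad s (bracket (coroot_vec \<Delta> r) v) j + 2 * n * ad s v j"
      using s ad_expand[of "Eb s"] by (simp add: sum.distrib sum_distrib_left)
    finally show ?thesis .
  next
    case False
    then have "ad s w j = 0" for w using ad_weight[OF s(1)] by blast
    then show ?thesis using False bracket_coroot_vec[OF r] by simp
  qed
  show "bracket (coroot_vec \<Delta> r) (ad r v) = (\<lambda>j. ad r (bracket (coroot_vec \<Delta> r) v) j + 2 * ad r v j)" for v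
    using shift[OF r, of 1] by (auto simp: fun_eq_iff)
  show "bracket (coroot_vec \<Delta> r) (ad (- r) v) = (\<lambda>j. ad (- r) (bracket (coroot_vec \<Delta> r) v) j - 2 * ad (- r) v j)" for v
    using shift[OF r', of "- 1"] by (auto simp: fun_eq_iff)
  show "ad r (ad (- r) v) = (\<lambda>j. ad (- r) (ad r v) j + bracket (coroot_vec \<Delta> r) v j)" for v
  proof
    fix j
    have "ad r (ad (- r) v) j + ad (- r) (bracket v (unit_vec (Eb r))) j + bracket v (coroot_vec \<Delta> r) j = 0"
      using jacobi[of "unit_vec (Eb r)" "unit_vec (Eb (- r))" v j] ad_minus_root[OF r] by simp
    moreover have "ad (- r) (bracket v (unit_vec (Eb r))) j = - ad (- r) (ad r v) j"
      using bracket_antisym[of v "unit_vec (Eb r)"] int_linear_minus[OF int_linear_bracket] by (metis (no_types))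
    moreover have "bracket v (coroot_vec \<Delta> r) j = - bracket (coroot_vec \<Delta> r) v j"
      using bracket_antisym[of v "coroot_vec \<Delta> r"] by simp
    ultimately show "ad r (ad (- r) v) j = ad (- r) (ad r v) j + bracket (coroot_vec \<Delta> r) v j" by simp
  qed
qed

lemma ad_root:
  assumes r: "r \<in> \<Phi>" and s: "s \<in> \<Phi>" and ne: "s \<noteq> - r"
  shows "ad r (unit_vec (Eb s)) = (if r + s \<in> \<Phi> then (\<lambda>j. c r s * unit_vec (Eb (r + s)) j) else (\<lambda>j. 0))"
  using bracket_unit[of "Eb r" "Eb s"] r s ne by (auto simp: fun_eq_iff)

section \<open>Divisibility of the powers of \<open>ad r\<close> and integer matrices of
  exponentials\<close>

definition depth :: "'v \<Rightarrow> 'v \<Rightarrow> nat" where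
  "depth r s = Max {p. s - real p *\<^sub>R r \<in> \<Phi>}"

text \<open>Shifting p by one identifies the two index sets, apart from p = 0 on the left, which
  cannot be the maximum.\<close>

lemma depth_Suc:
  assumes r: "r \<in> \<Phi>" and s: "s \<in> \<Phi>"
  shows "depth r (r + s) = Suc (depth r s)"
proof -
  have fin: "finite {p. s - real p *\<^sub>R r \<in> \<Phi>}" for s
  proof (rule finite_imageD)
    show "finite ((\<lambda>p. s - real p *\<^sub>R r) ` {p. s - real p *\<^sub>R r \<in> \<Phi>})"
      by (rule finite_subset[OF _ finite_\<Phi>]) auto
    show "inj_on (\<lambda>p. s - real p *\<^sub>R r) {p. s - real p *\<^sub>R r \<in> \<Phi>}"
      using root_nonzero[OF r] by (auto simp: inj_on_def)
  qed
  have 0: "0 \<in> {p. s - real p *\<^sub>R r \<in> \<Phi>}" using s by simp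
  have shift: "r + s - real (Suc p) *\<^sub>R r = s - real p *\<^sub>R r" for p
    by (simp add: scaleR_left_distrib)
  show ?thesis
    unfolding depth_def
  proof (rule Max_eqI[OF fin])
    have "Max {p. s - real p *\<^sub>R r \<in> \<Phi>} \<in> {p. s - real p *\<^sub>R r \<in> \<Phi>}"
      using Max_in[OF fin] 0 by blast
    then show "Suc (Max {p. s - real p *\<^sub>R r \<in> \<Phi>}) \<in> {p. r + s - real p *\<^sub>R r \<in> \<Phi>}"
      using shift by (metis mem_Collect_eq)
    fix q assume q: "q \<in> {p. r + s - real p *\<^sub>R r \<in> \<Phi>}"
    show "q \<le> Suc (Max {p. s - real p *\<^sub>R r \<in> \<Phi>})"
    proof (cases q)
      case (Suc p)
      then have "p \<in> {p. s - real p *\<^sub>R r \<in> \<Phi>}" using q shift[of p] by (metis mem_Collect_eq)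
      then show ?thesis using Max_ge[OF fin] Suc by simp
    qed simp
  qed
qed

lemma abs_constant: "\<lbrakk>r \<in> \<Phi>; s \<in> \<Phi>; r + s \<in> \<Phi>\<rbrakk> \<Longrightarrow> \<bar>c r s\<bar> = int (depth r s) + 1"
  unfolding depth_def by (rule structure_constant)

lemma dvd_consecutive2: "(2::int) dvd (int d + 1) * (int d + 2)"
  by simp

lemma dvd_consecutive3: "(6::int) dvd (int d + 1) * (int d + 2) * (int d + 3)"
proof (induction d)
  case (Suc d)
  obtain k where k: "(int (Suc d) + 1) * (int (Suc d) + 2) = 2 * k" using dvd_consecutive2 by (metis dvd_def)
  have "(int (Suc d) + 1) * (int (Suc d) + 2) * (int (Suc d) + 3) =
      (int d + 1) * (int d + 2) * (int d + 3) + 3 * ((int (Suc d) + 1) * (int (Suc d) + 2))"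
    by (simp add: algebra_simps)
  also have "\<dots> = (int d + 1) * (int d + 2) * (int d + 3) + 6 * k" unfolding k by simp
  finally show ?case using Suc by (metis dvd_add dvd_triv_left)
qed simp

lemma ad_scale_unit: "ad r (\<lambda>j. k * v j) = (\<lambda>j. k * ad r v j)"
  using int_linear_scale[OF int_linear_bracket] .

lemma ad_zero: "ad r (\<lambda>j. 0) = (\<lambda>j. 0)"
  using ad_scale_unit[of r 0 "\<lambda>j. 0"] by simp

text \<open>On the Cartan part the second power already vanishes, and the opposite root vector
  passes through the coroot to -2 times the root vector and then to zero. Along any other root
  string the successive constants are, up to sign, d + 1, d + 2 and d + 3 with d the depth, and
  products of two or three consecutive integers are divisible by 2 and 6.\<close>

lemma ad_powers_dvd:
  assumes r: "r \<in> \<Phi>" and b: "b \<in> I"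
  shows "2 dvd ad r (ad r (unit_vec b)) j \<and> 6 dvd ad r (ad r (ad r (unit_vec b))) j"
proof (cases b)
  case (Hb a)
  have "ad r (unit_vec b) = (\<lambda>j. (- \<lfloor>coroot a \<bullet> r\<rfloor>) * unit_vec (Eb r) j)"
    using bracket_unit[of "Eb r" b] r b Hb by (auto simp: fun_eq_iff)
  then have "ad r (ad r (unit_vec b)) = (\<lambda>j. 0)"
    by (simp only: ad_scale_unit ad_self[OF r]) simp
  then show ?thesis by (simp add: ad_zero)
next
  case (Eb s)
  then have s: "s \<in> \<Phi>" using b by simp
  show ?thesis
  proof (cases "s = - r")
    case True
    then have "ad r (ad r (unit_vec b)) = (\<lambda>j. - 2 * unit_vec (Eb r) j)"
      using Eb ad_minus_root[OF r] ad_coroot_vec[OF r] by simp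
    moreover from this have "ad r (ad r (ad r (unit_vec b))) = (\<lambda>j. 0)"
      by (simp only: ad_scale_unit ad_self[OF r]) simp
    ultimately show ?thesis by simp
  next
    case False
    \<comment> \<open>No root of the string above s is opposite to r, so no bracket falls into the
      Cartan part and \<open>ad_root\<close> applies at every step.\<close>
    have neq: "s \<noteq> (- real (Suc n)) *\<^sub>R r" for n
      using False s scaled_notin[OF r, of "- real (Suc n)"] by (cases n) auto
    have neq1: "r + s \<noteq> - r"
      using neq[of 1] by (auto simp: scaleR_2 eq_neg_iff_add_eq_0 algebra_simps)
    have neq2: "r + (r + s) \<noteq> - r"
    proof
      assume "r + (r + s) = - r"
      then have "s = - r - r - r" by (simp add: algebra_simps)
      also have "\<dots> = (- real (Suc 2)) *\<^sub>R r"
        by (simp add: scaleR_left_diff_distrib[of "- 2" 1 r, simplified] scaleR_left_diff_distrib[of "- 1" 1 r, simplified])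
      finally show False using neq by blast
    qed
    note ad1 = ad_root[OF r s False]
    show ?thesis
    proof (cases "r + s \<in> \<Phi>")
      case 1: True
      note ad2 = ad_root[OF r 1 neq1]
      have c1: "\<bar>c r s\<bar> = int (depth r s) + 1" using abs_constant[OF r s 1] .
      show ?thesis
      proof (cases "r + (r + s) \<in> \<Phi>")
        case 2: True
        note ad3 = ad_root[OF r 2 neq2]
        have c2: "\<bar>c r (r + s)\<bar> = int (depth r s) + 2"
          using abs_constant[OF r 1 2] depth_Suc[OF r s] by simp
        have dvd2: "2 dvd c r s * c r (r + s)"
          using dvd_consecutive2[of "depth r s"] c1 c2 by (metis abs_mult dvd_abs_iff)
        show ?thesis
        proof (cases "r + (r + (r + s)) \<in> \<Phi>")
          case 3: True
          have c3: "\<bar>c r (r + (r + s))\<bar> = int (depth r s) + 3"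
            using abs_constant[OF r 2 3] depth_Suc[OF r 1] depth_Suc[OF r s] by simp
          have "6 dvd c r s * c r (r + s) * c r (r + (r + s))"
            using dvd_consecutive3[of "depth r s"] c1 c2 c3 by (metis abs_mult dvd_abs_iff)
          then show ?thesis using 1 2 3 dvd2 Eb by (simp add: ad1 ad2 ad3 ad_scale_unit flip: mult.assoc)
        next
          case False
          then show ?thesis using 1 2 dvd2 Eb by (simp add: ad1 ad2 ad3 ad_scale_unit flip: mult.assoc)
        qed
      next
        case False
        then show ?thesis using 1 Eb by (simp add: ad1 ad2 ad_scale_unit ad_zero)
      qed
    next
      case False
      then show ?thesis using Eb by (simp add: ad1 ad_zero)
    qed
  qed
qed

text \<open>The integer matrix of \<open>exp (e ad e\<^sub>r)\<close>: the divisions are exact by \<open>ad_powers_dvd\<close>.\<close>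

definition exp_mat :: "'v \<Rightarrow> int \<Rightarrow> 'v basis_index \<Rightarrow> 'v basis_index \<Rightarrow> int" where
  "exp_mat r e j b = (\<Sum>i\<le>3. e ^ i * ((ad r ^^ i) (unit_vec b) j div fact i))"

definition mat_mult :: "('v basis_index \<Rightarrow> 'v basis_index \<Rightarrow> int) \<Rightarrow> ('v basis_index \<Rightarrow> 'v basis_index \<Rightarrow> int) \<Rightarrow>
    'v basis_index \<Rightarrow> 'v basis_index \<Rightarrow> int" where
  "mat_mult A B j b = (\<Sum>m\<in>I. A j m * B m b)"

lemma exp_mat_exp6:
  assumes r: "r \<in> \<Phi>" and b: "b \<in> I"
  shows "6 * exp_mat r e j b = exp6 e (ad r) (unit_vec b) j"
proof -
  obtain p q where p: "ad r (ad r (unit_vec b)) j = 2 * p" and q: "ad r (ad r (ad r (unit_vec b))) j = 6 * q"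
    using ad_powers_dvd[OF r b, of j] by (metis dvd_def)
  have sum: "(\<Sum>i\<le>3. f i) = f 0 + f 1 + f 2 + f 3" for f :: "nat \<Rightarrow> int"
    by (simp add: numeral_eq_Suc)
  have pow: "(ad r ^^ 2) v = ad r (ad r v)" "(ad r ^^ 3) v = ad r (ad r (ad r v))" for v
    by (simp_all add: numeral_eq_Suc)
  show ?thesis
    unfolding exp_mat_def exp6_def sum pow by (simp add: p q fact_numeral)
qed

lemma exp_mat_weight:
  assumes "r \<in> \<Phi>" "b \<in> I" "exp_mat r e j b \<noteq> 0"
  shows "j \<in> I \<and> (\<exists>n::int. weight j = weight b + of_int n *\<^sub>R r)"
proof -
  obtain i where "(ad r ^^ i) (unit_vec b) j \<noteq> 0"
    using assms(3) unfolding exp_mat_def by (metis (no_types, lifting) div_0 mult_zero_right sum.neutral)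
  then show ?thesis using ad_pow_weight[OF assms(1,2)] by (metis of_int_of_nat_eq)
qed

lemma exp6_expand:
  assumes r: "r \<in> \<Phi>" and v: "\<And>j. j \<notin> I \<Longrightarrow> v j = 0"
  shows "exp6 e (ad r) v j = (\<Sum>b\<in>I. v b * exp6 e (ad r) (unit_vec b) j)"
proof -
  have lin: "int_linear (exp6 e (ad r))" using int_linear_exp6 int_linear_bracket by blast
  have E0: "exp6 e (ad r) (\<lambda>j. 0) = (\<lambda>j. 0)" using int_linear_scale[OF lin, of 0 "\<lambda>j. 0"] by simp
  have "exp6 e (ad r) (\<lambda>j. \<Sum>b\<in>A. v b * unit_vec b j) = (\<lambda>j. \<Sum>b\<in>A. v b * exp6 e (ad r) (unit_vec b) j)"
    if "finite A" for A
    using that by (induction A rule: finite_induct) (simp_all add: E0 int_linear_simps[OF lin])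
  from this[OF finite_I] have "exp6 e (ad r) (\<lambda>j. \<Sum>b\<in>I. v b * unit_vec b j) j = (\<Sum>b\<in>I. v b * exp6 e (ad r) (unit_vec b) j)"
    by (simp add: fun_eq_iff)
  moreover have "(\<lambda>j. \<Sum>b\<in>I. v b * unit_vec b j) = v"
  proof
    fix j
    have "(\<Sum>b\<in>I. v b * unit_vec b j) = (\<Sum>b\<in>I. if b = j then v j else 0)"
      by (intro sum.cong) (auto simp: unit_vec_def)
    then show "(\<Sum>b\<in>I. v b * unit_vec b j) = v j" using v[of j] finite_I by simp
  qed
  ultimately show ?thesis by simp
qed

text \<open>The scalar k carries the powers of six left over from the exponentials applied
  before.\<close>

lemma exp6_mat_mult:
  assumes r: "r \<in> \<Phi>" and A: "\<And>j. j \<notin> I \<Longrightarrow> A j b = 0"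
  shows "exp6 e (ad r) (\<lambda>j. k * A j b) j = 6 * k * mat_mult (exp_mat r e) A j b"
proof -
  have "exp6 e (ad r) (\<lambda>j. k * A j b) j = (\<Sum>m\<in>I. k * A m b * exp6 e (ad r) (unit_vec m) j)"
    using exp6_expand[OF r, of "\<lambda>j. k * A j b"] A by simp
  also have "\<dots> = (\<Sum>m\<in>I. k * A m b * (6 * exp_mat r e j m))"
    using exp_mat_exp6[OF r] by (intro sum.cong) auto
  also have "\<dots> = 6 * k * mat_mult (exp_mat r e) A j b"
    unfolding mat_mult_def by (simp add: sum_distrib_left algebra_simps)
  finally show ?thesis .
qed

lemma exp_mat_outside: "\<lbrakk>r \<in> \<Phi>; b \<in> I; j \<notin> I\<rbrakk> \<Longrightarrow> exp_mat r e j b = 0"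
  using exp_mat_weight by blast

lemma mat_mult_outside:
  assumes "\<And>m. m \<in> I \<Longrightarrow> A j m = 0" shows "mat_mult A B j b = 0"
  unfolding mat_mult_def using assms by simp

text \<open>36 times the two sides agree by \<open>exp6_inverse\<close>. The factor is cancelled
  over the integers, so the identity survives reduction to any field.\<close>

lemma exp_mat_inverse:
  assumes r: "r \<in> \<Phi>" and b: "b \<in> I"
  shows "mat_mult (exp_mat r 1) (exp_mat r (- 1)) j b = unit_vec b j"
proof -
  have "exp6 (- 1) (ad r) (unit_vec b) = (\<lambda>j. 6 * exp_mat r (- 1) j b)"
    using exp_mat_exp6[OF r b] by (simp add: fun_eq_iff)
  then have "exp6 1 (ad r) (exp6 (- 1) (ad r) (unit_vec b)) j = 36 * mat_mult (exp_mat r 1) (exp_mat r (- 1)) j b"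
    using exp6_mat_mult[OF r, of "exp_mat r (- 1)" b 1 6 j] exp_mat_outside[OF r b] by simp
  then show ?thesis using exp6_inverse[OF int_linear_bracket ad_4[OF r], where v = "unit_vec b"] by (simp add: fun_eq_iff)
qed

section \<open>The integer matrix of a Weyl element and its effect on weights\<close>

definition weyl_mat :: "'v \<Rightarrow> 'v basis_index \<Rightarrow> 'v basis_index \<Rightarrow> int" where
  "weyl_mat r = mat_mult (exp_mat r 1) (mat_mult (exp_mat (- r) (- 1)) (exp_mat r 1))"

lemma mat_mult_nonzero:
  assumes "mat_mult A B j b \<noteq> 0" obtains m where "m \<in> I" "A j m \<noteq> 0" "B m b \<noteq> 0"
  using assms unfolding mat_mult_def by (metis (no_types, lifting) mult_eq_0_iff sum.neutral)

text \<open>The coroot vector acts diagonally by the pairings, so comparing entries in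
  \<open>H_weyl\<close> shows that the entry at j and b, multiplied by the sum of the two pairings,
  is zero. Together with the shift by a multiple of r this says that the matrix reflects
  weights.\<close>

lemma weyl_mat_weight:
  assumes r: "r \<in> \<Phi>" and b: "b \<in> I" and nz: "weyl_mat r j b \<noteq> 0"
  shows "j \<in> I" "\<exists>n::int. weight j = weight b + of_int n *\<^sub>R r" "pairing r j = - pairing r b"
proof -
  have r': "- r \<in> \<Phi>" using minus_mem r .
  obtain m where m: "m \<in> I" "exp_mat r 1 j m \<noteq> 0" "mat_mult (exp_mat (- r) (- 1)) (exp_mat r 1) m b \<noteq> 0"
    using mat_mult_nonzero nz unfolding weyl_mat_def by blast
  obtain l where l: "l \<in> I" "exp_mat (- r) (- 1) m l \<noteq> 0" "exp_mat r 1 l b \<noteq> 0"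
    using mat_mult_nonzero[OF m(3)] by blast
  obtain n1 n2 n3 :: int where n: "weight j = weight m + of_int n1 *\<^sub>R r" "weight m = weight l + of_int n2 *\<^sub>R (- r)"
    "weight l = weight b + of_int n3 *\<^sub>R r"
    using exp_mat_weight[OF r m(1,2)] exp_mat_weight[OF r' l(1,2)] exp_mat_weight[OF r b l(3)] by blast
  show j: "j \<in> I" using exp_mat_weight[OF r m(1,2)] by blast
  have "weight j = weight b + of_int (n1 - n2 + n3) *\<^sub>R r"
    using n by (simp add: scaleR_left_distrib scaleR_left_diff_distrib)
  then show "\<exists>n::int. weight j = weight b + of_int n *\<^sub>R r" by blast
  interpret sl2 "ad r" "ad (- r)" "bracket (coroot_vec \<Delta> r)" using sl2_root[OF r] .
  let ?w = "\<lambda>v. exp6 1 (ad r) (exp6 (- 1) (ad (- r)) (exp6 1 (ad r) v))"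
  \<comment> \<open>Three exponentials contribute a factor six each, hence 216.\<close>
  have w: "?w (unit_vec b) = (\<lambda>j. 216 * weyl_mat r j b)"
  proof
    fix j
    have 1: "exp6 1 (ad r) (unit_vec b) = (\<lambda>j. 6 * exp_mat r 1 j b)"
      using exp_mat_exp6[OF r b] by (simp add: fun_eq_iff)
    have 2: "exp6 (- 1) (ad (- r)) (\<lambda>j. 6 * exp_mat r 1 j b) = (\<lambda>j. 36 * mat_mult (exp_mat (- r) (- 1)) (exp_mat r 1) j b)"
      using exp6_mat_mult[OF r', of "exp_mat r 1" b "- 1" 6] exp_mat_outside[OF r b] by (simp add: fun_eq_iff)
    show "?w (unit_vec b) j = 216 * weyl_mat r j b"
      unfolding 1 2 weyl_mat_def
      using exp6_mat_mult[OF r, of "mat_mult (exp_mat (- r) (- 1)) (exp_mat r 1)" b 1 36 j]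
        mat_mult_outside[of "exp_mat (- r) (- 1)"] exp_mat_outside[OF r'] by simp
  qed
  have "bracket (coroot_vec \<Delta> r) (unit_vec b) = (\<lambda>j. pairing r b * unit_vec b j)"
    using bracket_coroot_vec[OF r] b by (auto simp: fun_eq_iff unit_vec_def)
  moreover have "?w (\<lambda>j. k * v j) = (\<lambda>j. k * ?w v j)" for k v
    using int_linear_scale[OF int_linear_exp6[OF int_linear_bracket]] by simp
  ultimately have "?w (bracket (coroot_vec \<Delta> r) (unit_vec b)) j = pairing r b * (216 * weyl_mat r j b)"
    using w by simp
  moreover have "bracket (coroot_vec \<Delta> r) (?w (unit_vec b)) j = pairing r j * (216 * weyl_mat r j b)"
    using bracket_coroot_vec[OF r] j w by simp
  moreover have "bracket (coroot_vec \<Delta> r) (?w (unit_vec b)) j = - ?w (bracket (coroot_vec \<Delta> r) (unit_vec b)) j"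
    using H_weyl[of "unit_vec b"] by (simp add: fun_eq_iff)
  ultimately have "(pairing r j + pairing r b) * weyl_mat r j b = 0" by (simp add: algebra_simps)
  then show "pairing r j = - pairing r b" using nz by simp
qed

text \<open>Both steps negate the pairing, so it returns to its value, whereas a net shift by n
  times r changes it by 2 n. Torus elements are products of two Weyl elements of the same root, so
  this controls their action on weights.\<close>

lemma weyl_mat_square_weight:
  assumes r: "r \<in> \<Phi>" and b: "b \<in> I" and nz: "weyl_mat r m b \<noteq> 0" "weyl_mat r j m \<noteq> 0"
  shows "weight j = weight b"
proof -
  note 1 = weyl_mat_weight[OF r b nz(1)] and 2 = weyl_mat_weight[OF r weyl_mat_weight(1)[OF r b nz(1)] nz(2)]
  obtain n1 n2 :: int where "weight m = weight b + of_int n1 *\<^sub>R r" "weight j = weight m + of_int n2 *\<^sub>R r"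
    using 1 2 by blast
  then have *: "weight j = weight b + of_int (n1 + n2) *\<^sub>R r" by (simp add: scaleR_left_distrib)
  then have "pairing r j = pairing r b + 2 * (n1 + n2)" using pairing_shift[OF r 2(1) b] by blast
  then have "n1 + n2 = 0" using 1 2 by simp
  then show ?thesis using * by simp
qed

section \<open>Chevalley groups\<close>

text \<open>Half the pairing of the coroot of r with the weight, rounded down. Only differences
  along r-strings matter, and there the floor is exact: adding r raises the degree by one. Rounding
  avoids square roots of t at odd pairings.\<close>

definition degree :: "'v \<Rightarrow> 'v basis_index \<Rightarrow> int" where
  "degree r j = \<lfloor>(weight j \<bullet> r) / (r \<bullet> r)\<rfloor>"

lemma degree_shift:
  assumes "r \<in> \<Phi>" "weight j = weight b + of_int n *\<^sub>R r"
  shows "degree r j = degree r b + n"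
proof -
  have "(weight j \<bullet> r) / (r \<bullet> r) = (weight b \<bullet> r) / (r \<bullet> r) + of_int n"
    using assms root_nonzero by (simp add: inner_add_left add_divide_distrib)
  then show ?thesis unfolding degree_def by simp
qed

abbreviation \<Omega> :: "('v basis_index \<Rightarrow> 'k::field) set" where
  "\<Omega> \<equiv> chev_space \<Phi> \<Delta>"

abbreviation xr :: "'v \<Rightarrow> 'k::field \<Rightarrow> ('v, 'k) lin" where
  "xr \<equiv> root_elt \<Phi> \<Delta> c"

abbreviation nr :: "'v \<Rightarrow> 'k::field \<Rightarrow> ('v, 'k) lin" where
  "nr \<equiv> weyl_elt \<Phi> \<Delta> c"

abbreviation Q :: "'v set \<Rightarrow> ('v, 'k::field) lin set" where
  "Q \<equiv> std_parabolic \<Phi> \<Delta> c"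

text \<open>The matrix A conjugated by the diagonal matrix with entries \<open>t\<close> to the power \<open>degree r j\<close>.
  In this form \<open>x\<^sub>r(t)\<close> comes from \<open>x\<^sub>r(1)\<close> and \<open>x\<^sub>-\<^sub>r(-1/t)\<close> from \<open>x\<^sub>-\<^sub>r(-1)\<close>.\<close>

definition mat_map :: "'v \<Rightarrow> 'k::field \<Rightarrow> ('v basis_index \<Rightarrow> 'v basis_index \<Rightarrow> int) \<Rightarrow> ('v, 'k) lin" where
  "mat_map r t A = (\<lambda>f\<in>\<Omega>. \<lambda>j. \<Sum>b\<in>I. f b * (t powi (degree r j - degree r b) * of_int (A j b)))"

lemma mat_map_\<Omega>:
  assumes "\<And>j b. \<lbrakk>j \<notin> I; b \<in> I\<rbrakk> \<Longrightarrow> A j b = 0" "f \<in> \<Omega>"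
  shows "mat_map r t A f \<in> \<Omega>"
  using assms unfolding mat_map_def by (simp add: chev_space_def)

text \<open>Conjugation by a fixed invertible diagonal matrix is multiplicative: the exponents
  telescope through the middle index.\<close>

lemma compose_mat_map:
  assumes t: "t \<noteq> 0" and B: "\<And>j b. \<lbrakk>j \<notin> I; b \<in> I\<rbrakk> \<Longrightarrow> B j b = 0"
  shows "compose \<Omega> (mat_map r t A) (mat_map r t B) = mat_map r t (mat_mult A B)"
proof
  fix f show "compose \<Omega> (mat_map r t A) (mat_map r t B) f = mat_map r t (mat_mult A B) f"
  proof (cases "f \<in> \<Omega>")
    case True
    let ?d = "degree r"
    show ?thesis
    proof
      fix j
      have "compose \<Omega> (mat_map r t A) (mat_map r t B) f j =
          (\<Sum>m\<in>I. (\<Sum>b\<in>I. f b * (t powi (?d m - ?d b) * of_int (B m b))) * (t powi (?d j - ?d m) * of_int (A j m)))"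
        using mat_map_\<Omega>[of B f r t] B True by (simp add: compose_def mat_map_def)
      also have "\<dots> = (\<Sum>b\<in>I. \<Sum>m\<in>I. f b * (t powi (?d m - ?d b) * of_int (B m b)) * (t powi (?d j - ?d m) * of_int (A j m)))"
        unfolding sum_distrib_right by (rule sum.swap)
      also have "\<dots> = (\<Sum>b\<in>I. \<Sum>m\<in>I. f b * (t powi (?d j - ?d b) * of_int (A j m * B m b)))"
      proof (intro sum.cong refl)
        fix b m
        have "t powi (?d j - ?d b) = t powi (?d m - ?d b) * t powi (?d j - ?d m)"
          using t by (simp flip: power_int_add)
        then show "f b * (t powi (?d m - ?d b) * of_int (B m b)) * (t powi (?d j - ?d m) * of_int (A j m)) =
            f b * (t powi (?d j - ?d b) * of_int (A j m * B m b))"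
          by simp
      qed
      also have "\<dots> = mat_map r t (mat_mult A B) f j"
        using True by (simp add: mat_map_def mat_mult_def sum_distrib_left)
      finally show "compose \<Omega> (mat_map r t A) (mat_map r t B) f j = mat_map r t (mat_mult A B) f j" .
    qed
  next
    case False
    then show ?thesis by (simp add: compose_def mat_map_def)
  qed
qed

section \<open>Root elements and Weyl elements as rescaled integer matrices\<close>

lemma root_elt_mat_map:
  assumes s: "s \<in> \<Phi>"
    and u: "\<And>i j b. weight j = weight b + real i *\<^sub>R s \<Longrightarrow> u ^ i = of_int e ^ i * t powi (degree r j - degree r b)"
  shows "xr s u = mat_map r t (exp_mat s e)"
proof -
  have "(\<Sum>i\<le>3. u ^ i * of_int ((ad s ^^ i) (unit_vec b) j div fact i)) =
      t powi (degree r j - degree r b) * of_int (exp_mat s e j b)" if b: "b \<in> I" for b j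
  proof -
    have "u ^ i * of_int ((ad s ^^ i) (unit_vec b) j div fact i) =
        t powi (degree r j - degree r b) * of_int (e ^ i * ((ad s ^^ i) (unit_vec b) j div fact i))" for i
    proof (cases "(ad s ^^ i) (unit_vec b) j = 0")
      case False
      then have "u ^ i = of_int e ^ i * t powi (degree r j - degree r b)"
        using ad_pow_weight[OF s b] u by blast
      then show ?thesis by simp
    qed simp
    then have "(\<Sum>i\<le>3. u ^ i * of_int ((ad s ^^ i) (unit_vec b) j div fact i)) =
        (\<Sum>i\<le>3. t powi (degree r j - degree r b) * of_int (e ^ i * ((ad s ^^ i) (unit_vec b) j div fact i)))"
      by (intro sum.cong refl)
    then show ?thesis unfolding exp_mat_def by (simp only: sum_distrib_left of_int_sum)
  qed
  then show ?thesis unfolding root_elt_def mat_map_def by (simp cong: sum.cong)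
qed

lemma root_elt_pos:
  assumes r: "r \<in> \<Phi>"
  shows "xr r t = mat_map r t (exp_mat r 1)"
proof (rule root_elt_mat_map[OF r])
  fix i j b assume "weight j = weight b + real i *\<^sub>R r"
  then have "degree r j - degree r b = int i" using degree_shift[OF r, of j b "int i"] by simp
  then show "t ^ i = of_int 1 ^ i * t powi (degree r j - degree r b)" by simp
qed

lemma root_elt_neg:
  assumes r: "r \<in> \<Phi>"
  shows "xr r (- t) = mat_map r t (exp_mat r (- 1))"
proof (rule root_elt_mat_map[OF r])
  fix i j b assume "weight j = weight b + real i *\<^sub>R r"
  then have "degree r j - degree r b = int i" using degree_shift[OF r, of j b "int i"] by simp
  then show "(- t) ^ i = of_int (- 1) ^ i * t powi (degree r j - degree r b)"
    using power_minus[of t i] by simp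
qed

lemma root_elt_opposite:
  assumes r: "r \<in> \<Phi>"
  shows "xr (- r) (- inverse t) = mat_map r t (exp_mat (- r) (- 1))"
proof (rule root_elt_mat_map)
  show "- r \<in> \<Phi>" using minus_mem r .
  fix i j b assume "weight j = weight b + real i *\<^sub>R - r"
  then have "degree r j - degree r b = - int i" using degree_shift[OF r, of j b "- int i"] by simp
  then show "(- inverse t) ^ i = of_int (- 1) ^ i * t powi (degree r j - degree r b)"
    using power_minus[of "inverse t" i] by (simp add: power_int_minus power_inverse)
qed

lemma exp_mat_0:
  assumes "b \<in> I"
  shows "exp_mat r 0 j b = unit_vec b j"
  unfolding exp_mat_def by (simp add: numeral_eq_Suc)

lemma mat_map_unit:
  assumes "\<And>j b. b \<in> I \<Longrightarrow> A j b = unit_vec b j" "f \<in> \<Omega>"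
  shows "mat_map r t A f = f"
proof
  fix j
  have "mat_map r t A f j = (\<Sum>b\<in>I. if b = j then f j else 0)"
    unfolding mat_map_def using assms by (simp, intro sum.cong) (auto simp: unit_vec_def)
  then show "mat_map r t A f j = f j" using assms(2) finite_I by (auto simp: chev_space_def)
qed

lemma root_elt_inverse:
  fixes t :: "'k::field"
  assumes r: "r \<in> \<Phi>" and f: "f \<in> \<Omega>"
  shows "xr r t (xr r (- t) f) = f"
proof (cases "t = 0")
  case True
  \<comment> \<open>For t = 0 the rescaling is not invertible, so this root element is written with
    the zeroth exponential and the rescaling parameter 1.\<close>
  have "xr r 0 = mat_map r (1 :: 'k) (exp_mat r 0)"
    by (rule root_elt_mat_map[OF r]) simp
  moreover have "mat_map r (1 :: 'k) (exp_mat r 0) f = f" by (rule mat_map_unit[OF exp_mat_0 f])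
  ultimately show ?thesis using True by simp
next
  case False
  have "xr r t (xr r (- t) f) =
      compose \<Omega> (mat_map r t (exp_mat r 1)) (mat_map r t (exp_mat r (- 1))) f"
    using f by (simp add: compose_def root_elt_pos[OF r, of t] root_elt_neg[OF r, of t])
  also have "\<dots> = mat_map r t (mat_mult (exp_mat r 1) (exp_mat r (- 1))) f"
    using compose_mat_map[OF False] exp_mat_outside[OF r] by metis
  also have "\<dots> = f"
    by (rule mat_map_unit[OF exp_mat_inverse[OF r] f])
  finally show ?thesis .
qed

lemma root_elt_\<Omega>:
  assumes r: "r \<in> \<Phi>" and f: "f \<in> \<Omega>"
  shows "xr r t f \<in> \<Omega>"
  unfolding root_elt_pos[OF r] using mat_map_\<Omega> exp_mat_outside[OF r] f by metis

lemma root_elt_Bij: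
  assumes r: "r \<in> \<Phi>"
  shows "xr r t \<in> Bij \<Omega>"
proof -
  have "xr r t \<in> extensional \<Omega>" unfolding root_elt_def by simp
  moreover have "bij_betw (xr r t) \<Omega> \<Omega>"
    using root_elt_inverse[OF r, of _ t] root_elt_inverse[OF r, of _ "- t"] root_elt_\<Omega>[OF r]
    by (intro bij_betw_byWitness[where f' = "xr r (- t)"]) auto
  ultimately show ?thesis unfolding Bij_def by blast
qed

abbreviation S :: "('v, 'k::field) lin monoid" where
  "S \<equiv> chevalley_group \<Phi> \<Delta> c"

lemma group_S: "group S"
  unfolding chevalley_group_def by (rule group.group_subgroup_generated[OF group_BijGroup])

sublocale S: group S
  by (rule group_S)

lemma carrier_S_Bij: "g \<in> carrier S \<Longrightarrow> g \<in> Bij \<Omega>"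
  unfolding chevalley_group_def
  using group.carrier_subgroup_generated_subset[OF group_BijGroup] by (fastforce simp: BijGroup_def)

lemma mult_S: "\<lbrakk>g \<in> carrier S; h \<in> carrier S\<rbrakk> \<Longrightarrow> g \<otimes>\<^bsub>S\<^esub> h = compose \<Omega> g h"
  using carrier_S_Bij[of g] carrier_S_Bij[of h] by (simp add: chevalley_group_def BijGroup_def)

lemma one_S: "\<one>\<^bsub>S\<^esub> = (\<lambda>f\<in>\<Omega>. f)"
  by (simp add: chevalley_group_def BijGroup_def)

lemma root_elt_carrier:
  assumes "r \<in> \<Phi>"
  shows "xr r t \<in> carrier S"
  unfolding chevalley_group_def carrier_subgroup_generated root_subgroup_def
  using root_elt_Bij[OF assms] assms by (intro generate.incl) (auto simp: BijGroup_def)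

text \<open>All three root elements are rescaled by the same diagonal matrix, the middle one because
  its parameter is the negative inverse of t, so the product is the rescaled product of the integer
  matrices.\<close>

lemma weyl_elt_mat_map:
  assumes r: "r \<in> \<Phi>" and t: "t \<noteq> 0"
  shows "nr r t = mat_map r t (weyl_mat r)"
proof -
  have r': "- r \<in> \<Phi>" using minus_mem r .
  note carrier = root_elt_carrier[OF r, of t] root_elt_carrier[OF r', of "- inverse t"]
  have "nr r t = xr r t \<otimes>\<^bsub>S\<^esub> (xr (- r) (- inverse t) \<otimes>\<^bsub>S\<^esub> xr r t)"
    unfolding weyl_elt_def Let_def using carrier by (simp add: S.m_assoc)
  also have "\<dots> = compose \<Omega> (xr r t) (compose \<Omega> (xr (- r) (- inverse t)) (xr r t))"
    using mult_S carrier S.m_closed by metis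
  also have "\<dots> = mat_map r t (weyl_mat r)"
    unfolding root_elt_opposite[OF r] root_elt_pos[OF r] weyl_mat_def
    using exp_mat_outside[OF r] exp_mat_outside[OF r']
    by (simp add: compose_mat_map[OF t] mat_mult_outside)
  finally show ?thesis .
qed

lemma weyl_elt_carrier:
  assumes "r \<in> \<Phi>"
  shows "nr r t \<in> carrier S"
  unfolding weyl_elt_def Let_def
  by (intro S.m_closed root_elt_carrier minus_mem assms)

lemma torus_elt_carrier:
  assumes "r \<in> \<Phi>"
  shows "torus_elt \<Phi> \<Delta> c r t \<in> carrier S"
  unfolding torus_elt_def by (intro S.m_closed weyl_elt_carrier assms)

section \<open>The subspace cut out by the coefficient of a simple root, and its stabilizer\<close>

definition filtration :: "'v \<Rightarrow> ('v basis_index \<Rightarrow> 'k::field) set" where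
  "filtration a = {f \<in> \<Omega>. \<forall>j\<in>I. representation \<Delta> (weight j) a < 0 \<longrightarrow> f j = 0}"

lemma filtrationD: "\<lbrakk>f \<in> filtration a; b \<in> I; f b \<noteq> 0\<rbrakk> \<Longrightarrow> 0 \<le> representation \<Delta> (weight b) a"
  unfolding filtration_def by (metis (mono_tags, lifting) mem_Collect_eq not_le)

lemma filtration_\<Omega>: "f \<in> filtration a \<Longrightarrow> f \<in> \<Omega>"
  unfolding filtration_def by blast

lemma root_elt_filtration:
  assumes r: "r \<in> \<Phi>" "0 \<le> representation \<Delta> r a" and f: "f \<in> filtration a"
  shows "xr r t f \<in> filtration a"
  unfolding filtration_def
proof (intro CollectI conjI ballI impI)
  show "xr r t f \<in> \<Omega>" using root_elt_\<Omega>[OF r(1) filtration_\<Omega>[OF f]] .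
  fix j assume j: "j \<in> I" "representation \<Delta> (weight j) a < 0"
  have "f b * (\<Sum>i\<le>3. t ^ i * of_int ((ad r ^^ i) (unit_vec b) j div fact i)) = 0" if b: "b \<in> I" for b
  proof (cases "f b = 0")
    case False
    have "(ad r ^^ i) (unit_vec b) j = 0" for i
    proof (rule ccontr)
      assume "(ad r ^^ i) (unit_vec b) j \<noteq> 0"
      then have "weight j = weight b + real i *\<^sub>R r" using ad_pow_weight[OF r(1) b] by blast
      then have "representation \<Delta> (weight j) a = representation \<Delta> (weight b) a + real i * representation \<Delta> r a"
        using representation_add[OF independent_\<Delta>] representation_scale[OF independent_\<Delta>] span_\<Delta> by simp
      moreover have "0 \<le> real i * representation \<Delta> r a" using r(2) by simp
      ultimately show False using filtrationD[OF f b False] j by linarith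
    qed
    then show ?thesis by simp
  qed simp
  then show "xr r t f j = 0"
    unfolding root_elt_def using filtration_\<Omega>[OF f] by (simp add: sum.neutral)
qed

text \<open>By \<open>weyl_mat_square_weight\<close> the composite of the two Weyl elements connects
  only basis vectors of equal weight, so coordinates of negative weight receive nothing; no
  eigenvalue has to be computed.\<close>

lemma torus_elt_filtration:
  assumes r: "r \<in> \<Phi>" and t: "t \<noteq> 0" and f: "f \<in> filtration a"
  shows "torus_elt \<Phi> \<Delta> c r t f \<in> filtration a"
  unfolding filtration_def
proof (intro CollectI conjI ballI impI)
  have f\<Omega>: "f \<in> \<Omega>" using filtration_\<Omega>[OF f] .
  show "torus_elt \<Phi> \<Delta> c r t f \<in> \<Omega>"
    using carrier_S_Bij[OF torus_elt_carrier[OF r]] f\<Omega> Bij_imp_funcset by blast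
  fix j assume j: "j \<in> I" "representation \<Delta> (weight j) a < 0"
  have \<Omega>: "nr r (- 1) f \<in> \<Omega>"
    using carrier_S_Bij[OF weyl_elt_carrier[OF r]] f\<Omega> Bij_imp_funcset by blast
  have "torus_elt \<Phi> \<Delta> c r t f = nr r t (nr r (- 1) f)"
    unfolding torus_elt_def using mult_S[OF weyl_elt_carrier[OF r, of t] weyl_elt_carrier[OF r, of "- 1"]] f\<Omega>
    by (simp add: compose_def)
  then have "torus_elt \<Phi> \<Delta> c r t f j = nr r t (nr r (- 1) f) j" by simp
  also have "\<dots> = (\<Sum>m\<in>I. nr r (- 1) f m * (t powi (degree r j - degree r m) * of_int (weyl_mat r j m)))"
    using \<Omega> by (simp add: weyl_elt_mat_map[OF r t] mat_map_def)
  also have "\<dots> = 0"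
  proof (intro sum.neutral ballI)
    fix m assume m: "m \<in> I"
    show "nr r (- 1) f m * (t powi (degree r j - degree r m) * of_int (weyl_mat r j m)) = 0"
    proof (cases "weyl_mat r j m = 0")
      case False
      have "f b * ((- 1) powi (degree r m - degree r b) * of_int (weyl_mat r m b)) = 0" if b: "b \<in> I" for b
      proof (cases "f b = 0 \<or> weyl_mat r m b = 0")
        case nz: False
        then have "weight j = weight b" using weyl_mat_square_weight[OF r b _ False] by blast
        then show ?thesis using filtrationD[OF f b] nz j by simp
      qed auto
      then have "nr r (- 1) f m = 0"
        unfolding weyl_elt_mat_map[OF r, of "- 1", simplified] mat_map_def using f\<Omega> by (simp add: sum.neutral)
      then show ?thesis by simp
    qed simp
  qed
  finally show "torus_elt \<Phi> \<Delta> c r t f j = 0" .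
qed

lemma finite_\<Omega>: "finite (\<Omega> :: ('v basis_index \<Rightarrow> 'k::{field,finite}) set)"
proof -
  have "\<Omega> = {f :: 'v basis_index \<Rightarrow> 'k. \<forall>j. (j \<in> I \<longrightarrow> f j \<in> UNIV) \<and> (j \<notin> I \<longrightarrow> f j = 0)}"
    unfolding chev_space_def by simp
  then show ?thesis using finite_set_of_finite_funs[OF finite_I, of "UNIV :: 'k set" 0] by simp
qed

text \<open>Closure under inverses uses finiteness of the field: the subspace is then a finite set,
  and an injective map of it into itself is onto.\<close>

lemma filtration_stabilizer:
  "subgroup {g \<in> carrier S. g ` filtration a \<subseteq> filtration a} (S :: ('v, 'k::{field,finite}) lin monoid)"
proof (rule S.subgroupI)
  show "{g \<in> carrier S. g ` filtration a \<subseteq> filtration a} \<noteq> ({} :: ('v, 'k) lin set)"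
    using S.one_closed filtration_\<Omega> by (force simp: one_S)
  fix g :: "('v, 'k) lin" assume "g \<in> {g \<in> carrier S. g ` filtration a \<subseteq> filtration a}"
  then have g: "g \<in> carrier S" "g ` filtration a \<subseteq> filtration a" by blast+
  have sub: "filtration a \<subseteq> (\<Omega> :: ('v basis_index \<Rightarrow> 'k) set)" using filtration_\<Omega> by blast
  have "inj_on g (filtration a)"
    using carrier_S_Bij[OF g(1)] sub inj_on_subset unfolding Bij_def bij_betw_def by blast
  then have surj: "g ` filtration a = filtration a"
    using endo_inj_surj[OF finite_subset[OF sub finite_\<Omega>] g(2)] by blast
  have "(inv\<^bsub>S\<^esub> g) f \<in> filtration a" if "f \<in> filtration a" for f
  proof -
    have "f \<in> g ` filtration a" unfolding surj by (rule that)
    then obtain h where h: "h \<in> filtration a" "f = g h" by (elim imageE)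
    note inv = S.inv_closed[OF g(1)]
    have "compose \<Omega> (inv\<^bsub>S\<^esub> g) g h = (\<lambda>f\<in>\<Omega>. f) h"
      using mult_S[OF inv g(1)] S.l_inv[OF g(1)] one_S by metis
    then have "(inv\<^bsub>S\<^esub> g) f = h" using filtration_\<Omega>[OF h(1)] h(2) by (simp add: compose_def)
    then show ?thesis using h by simp
  qed
  then show "inv\<^bsub>S\<^esub> g \<in> {g \<in> carrier S. g ` filtration a \<subseteq> filtration a}"
    using S.inv_closed[OF g(1)] by blast
  fix h :: "('v, 'k) lin" assume "h \<in> {g \<in> carrier S. g ` filtration a \<subseteq> filtration a}"
  then have h: "h \<in> carrier S" "h ` filtration a \<subseteq> filtration a" by blast+
  have "(g \<otimes>\<^bsub>S\<^esub> h) f \<in> filtration a" if "f \<in> filtration a" for f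
    using mult_S[OF g(1) h(1)] filtration_\<Omega>[OF that] g h that by (simp add: compose_def image_subset_iff)
  then show "g \<otimes>\<^bsub>S\<^esub> h \<in> {g \<in> carrier S. g ` filtration a \<subseteq> filtration a}"
    using S.m_closed[OF g(1) h(1)] by blast
qed blast

section \<open>Generation and properness of the standard parabolics\<close>

lemma chev_U_least:
  assumes "subgroup H S" "\<And>r t. r \<in> positive_roots \<Phi> \<Delta> \<Longrightarrow> xr r t \<in> H"
  shows "chev_U \<Phi> \<Delta> c \<subseteq> H"
  unfolding chev_U_def
  by (rule S.generate_subgroup_incl[OF _ assms(1)]) (use assms(2) in \<open>auto simp: root_subgroup_def\<close>)

lemma chev_T_least:
  assumes "subgroup H S" "\<And>r t. \<lbrakk>r \<in> \<Phi>; t \<noteq> 0\<rbrakk> \<Longrightarrow> torus_elt \<Phi> \<Delta> c r t \<in> H"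
  shows "chev_T \<Phi> \<Delta> c \<subseteq> H"
  unfolding chev_T_def
  by (rule S.generate_subgroup_incl[OF _ assms(1)]) (use assms(2) in auto)

lemma chev_B_least:
  assumes "subgroup H S" "chev_U \<Phi> \<Delta> c \<subseteq> H" "chev_T \<Phi> \<Delta> c \<subseteq> H"
  shows "chev_B \<Phi> \<Delta> c \<subseteq> H"
  unfolding chev_B_def using assms subgroup.m_closed[OF assms(1)] by (auto simp: set_mult_def)

lemma levi_least:
  assumes "subgroup H S" "chev_T \<Phi> \<Delta> c \<subseteq> H" "\<And>r t. r \<in> \<Phi> \<inter> span J \<Longrightarrow> xr r t \<in> H"
  shows "levi \<Phi> \<Delta> c J \<subseteq> H"
  unfolding levi_def
  by (rule S.generate_subgroup_incl[OF _ assms(1)]) (use assms(2,3) in \<open>auto simp: root_subgroup_def\<close>)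

lemma std_parabolic_least:
  assumes "subgroup H S" "chev_B \<Phi> \<Delta> c \<subseteq> H" "levi \<Phi> \<Delta> c J \<subseteq> H"
  shows "Q J \<subseteq> H"
  unfolding std_parabolic_def
  by (rule S.generate_subgroup_incl[OF _ assms(1)]) (use assms(2,3) in auto)

lemma positive_roots_sub: "positive_roots \<Phi> \<Delta> \<subseteq> \<Phi>"
  unfolding positive_roots_def by blast

lemma chev_T_carrier: "chev_T \<Phi> \<Delta> c \<subseteq> carrier S"
  using chev_T_least[OF S.subgroup_self] torus_elt_carrier by blast

lemma chev_B_carrier: "chev_B \<Phi> \<Delta> c \<subseteq> carrier S"
  using chev_B_least[OF S.subgroup_self chev_U_least[OF S.subgroup_self] chev_T_carrier]
    positive_roots_sub root_elt_carrier by blast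

lemma levi_carrier: "levi \<Phi> \<Delta> c J \<subseteq> carrier S"
  using levi_least[OF S.subgroup_self chev_T_carrier] root_elt_carrier by blast

lemma std_parabolic_subgroup: "subgroup (Q J) S"
  unfolding std_parabolic_def using chev_B_carrier levi_carrier by (intro S.generate_is_subgroup) blast

lemma chev_B_std_parabolic: "chev_B \<Phi> \<Delta> c \<subseteq> Q J"
  and levi_std_parabolic: "levi \<Phi> \<Delta> c J \<subseteq> Q J"
  unfolding std_parabolic_def by (auto intro: generate.incl)

lemma levi_mono: "J \<subseteq> K \<Longrightarrow> levi \<Phi> \<Delta> c J \<subseteq> levi \<Phi> \<Delta> c K"
  unfolding levi_def using span_mono[of J K] by (intro S.mono_generate) blast

lemma std_parabolic_mono: "J \<subseteq> K \<Longrightarrow> Q J \<subseteq> Q K"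
  unfolding std_parabolic_def using levi_mono[of J K] by (intro S.mono_generate) blast

lemma weyl_elt_std_parabolic:
  fixes t :: "'k::field"
  assumes "J \<subseteq> \<Delta>" "a \<in> J"
  shows "nr a t \<in> Q J"
proof -
  have a: "a \<in> \<Phi> \<inter> span J" using assms \<Delta>_sub span_base by blast
  then have a': "- a \<in> \<Phi> \<inter> span J" using minus_mem span_neg by blast
  have root: "xr r u \<in> Q J" if "r \<in> \<Phi> \<inter> span J" for r and u :: 'k
  proof -
    have "xr r u \<in> (\<Union>r\<in>\<Phi> \<inter> span J. root_subgroup \<Phi> \<Delta> c r)"
      by (rule UN_I[OF that]) (simp add: root_subgroup_def)
    then have "xr r u \<in> levi \<Phi> \<Delta> c J"
      unfolding levi_def by (intro generate.incl UnI2)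
    then show ?thesis using levi_std_parabolic by blast
  qed
  show ?thesis
    unfolding weyl_elt_def Let_def
    by (intro subgroup.m_closed[OF std_parabolic_subgroup] root a a')
qed

text \<open>The witness is the root vector of a. The quadratic term of the exponential sends it to
  -2 / 2 = -1 times the root vector of the opposite root, which is nonzero in every characteristic,
  including 2, thanks to the divided power.\<close>

lemma root_elt_minus_simple:
  assumes a: "a \<in> \<Delta>"
  shows "\<not> xr (- a) (1 :: 'k::field) ` filtration a \<subseteq> filtration a"
proof
  assume stable: "xr (- a) (1 :: 'k) ` filtration a \<subseteq> filtration a"
  have a\<Phi>: "a \<in> \<Phi>" "- a \<in> \<Phi>" using a \<Delta>_sub minus_mem by blast+
  have rep: "representation \<Delta> a a = 1" "representation \<Delta> (- a) a = - 1"
    using representation_basis[OF independent_\<Delta> a] representation_neg[OF independent_\<Delta>, of a] span_\<Delta> by auto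
  define f :: "'v basis_index \<Rightarrow> 'k" where "f j = (if j = Eb a then 1 else 0)" for j
  have f\<Omega>: "f \<in> \<Omega>" unfolding f_def chev_space_def using a\<Phi> by auto
  have "f \<in> filtration a" unfolding filtration_def f_def using f\<Omega>[unfolded f_def] rep by auto
  then have "xr (- a) 1 f \<in> filtration a" using stable by blast
  then have "xr (- a) 1 f (Eb (- a)) = 0"
    unfolding filtration_def using a\<Phi> rep by auto
  moreover have "xr (- a) 1 f (Eb (- a)) =
      (\<Sum>i\<le>3. of_int ((ad (- a) ^^ i) (unit_vec (Eb a)) (Eb (- a)) div fact i))"
  proof -
    have "xr (- a) 1 f (Eb (- a)) = (\<Sum>b\<in>I. if b = Eb a then
        (\<Sum>i\<le>3. of_int ((ad (- a) ^^ i) (unit_vec (Eb a)) (Eb (- a)) div fact i)) else 0)"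
      unfolding root_elt_def using f\<Omega> by (simp, intro sum.cong) (auto simp: f_def)
    then show ?thesis using finite_I a\<Phi> by simp
  qed
  moreover have "(\<Sum>i\<le>3. of_int ((ad (- a) ^^ i) (unit_vec (Eb a)) (Eb (- a)) div fact i)) = (- 1 :: 'k)"
  proof -
    have neq: "a \<noteq> - a" using root_nonzero[OF a\<Phi>(1)]
      by (simp add: eq_neg_iff_add_eq_0 flip: scaleR_2)
    have 1: "ad (- a) (unit_vec (Eb a)) = coroot_vec \<Delta> (- a)" using ad_minus_root[OF a\<Phi>(2)] by simp
    have 2: "ad (- a) (coroot_vec \<Delta> (- a)) = (\<lambda>j. - 2 * unit_vec (Eb (- a)) j)" using ad_coroot_vec[OF a\<Phi>(2)] .
    have 3: "ad (- a) (\<lambda>j. - 2 * unit_vec (Eb (- a)) j) = (\<lambda>j. 0)"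
      by (simp only: ad_scale_unit ad_self[OF a\<Phi>(2)]) simp
    have sum: "(\<Sum>i\<le>3. g i) = g 0 + g 1 + g 2 + g 3" for g :: "nat \<Rightarrow> 'k"
      by (simp add: numeral_eq_Suc)
    have pow: "(ad r ^^ 2) v = ad r (ad r v)" "(ad r ^^ 3) v = ad r (ad r (ad r v))" for r v
      by (simp_all add: numeral_eq_Suc)
    have div: "- 2 div 2 = (- 1 :: int)" by simp
    show ?thesis unfolding sum pow using neq 3
      by (simp add: 1 2 unit_vec_def coroot_vec_def)
  qed
  ultimately show False by simp
qed

lemma std_parabolic_proper:
  assumes a: "a \<in> \<Delta>" "a \<notin> J" and J: "J \<subseteq> \<Delta>"
  shows "Q J \<noteq> carrier (S :: ('v, 'k::{field,finite}) lin monoid)"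
proof -
  let ?H = "{g \<in> carrier S. g ` filtration a \<subseteq> filtration a} :: ('v, 'k) lin set"
  note H = filtration_stabilizer[of a, where 'k = 'k]
  have root: "xr r t \<in> ?H" if "r \<in> \<Phi>" "0 \<le> representation \<Delta> r a" for r t
    using root_elt_carrier root_elt_filtration that by blast
  have "chev_U \<Phi> \<Delta> c \<subseteq> ?H"
    using chev_U_least[OF H] root a unfolding positive_roots_def by blast
  moreover have T: "chev_T \<Phi> \<Delta> c \<subseteq> ?H"
    using chev_T_least[OF H] torus_elt_carrier torus_elt_filtration by blast
  ultimately have "chev_B \<Phi> \<Delta> c \<subseteq> ?H" using chev_B_least[OF H] by blast
  moreover have "levi \<Phi> \<Delta> c J \<subseteq> ?H"
  proof (rule levi_least[OF H T])
    fix r t assume r: "r \<in> \<Phi> \<inter> span J"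
    \<comment> \<open>Expansions in J and in \<open>\<Delta>\<close> agree on the span of J, and J
      omits a; the coefficient at a is therefore zero for positive and negative roots of the Levi
      subgroup alike.\<close>
    have "representation \<Delta> r a = representation J r a"
      using representation_extend[OF independent_\<Delta> _ J, of r] r by auto
    then have "representation \<Delta> r a = 0" using a representation_ne_zero by metis
    then show "xr r t \<in> ?H" using root r by simp
  qed
  ultimately have "Q J \<subseteq> ?H" using std_parabolic_least[OF H] by blast
  moreover have "xr (- a) 1 \<notin> ?H" using root_elt_minus_simple[OF a(1)] by blast
  moreover have "xr (- a) (1 :: 'k) \<in> carrier S"
    using root_elt_carrier minus_mem a \<Delta>_sub by blast
  ultimately show ?thesis by blast
qed

end

section \<open>Parabolic subgroups\<close>

lemma (in group) split_BN_pair_imp_BN_pair: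
  assumes "split_BN_pair p G B N U T I n"
  shows "BN_pair G B N T I n"
proof -
  note bn = assms[unfolded split_BN_pair_def]
  have B: "subgroup B G" using bn by (elim conjE)
  have N: "subgroup N G" using bn by (elim conjE)
  have gen: "generate G (B \<union> N) = carrier G" using bn by (elim conjE)
  have BN: "B \<inter> N = T" using bn by (elim conjE)
  have T_normal: "T \<lhd> (G\<lparr>carrier := N\<rparr>)" using bn by (elim conjE)
  have nN: "n ` I \<subseteq> N" using bn by (elim conjE)
  have genN: "generate G (T \<union> n ` I) = N" using bn by (elim conjE)
  have nT: "\<forall>i\<in>I. n i \<notin> T \<and> n i \<otimes> n i \<in> T" using bn by (elim conjE)
  have exch: "\<forall>i\<in>I. \<forall>w\<in>N. n i <# B #> w \<subseteq> (B #> (n i \<otimes> w) <#> B) \<union> (B #> w <#> B)"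
    using bn by (elim conjE)
  have nondeg: "\<forall>i\<in>I. n i <# B #> inv (n i) \<noteq> B" using bn by (elim conjE)
  have n_carrier: "n i \<in> carrier G" if "i \<in> I" for i
    using that nN subgroup.mem_carrier[OF N] by blast
  show ?thesis
  proof (intro BN_pair.intro BN_pair_axioms.intro)
    show "group G" by (rule is_group)
    show "subgroup B G" "subgroup N G" "generate G (B \<union> N) = carrier G" "B \<inter> N = T"
      "generate G (T \<union> n ` I) = N"
      by (fact B N gen BN genN)+
    show "w \<otimes> t \<otimes> inv w \<in> T" if "w \<in> N" "t \<in> T" for w t
      using normal.inv_op_closed2[OF T_normal, of w t] that m_inv_consistent[OF N that(1)] by simp
    show "n i \<in> N" "n i \<notin> T" "n i \<otimes> n i \<in> T" if "i \<in> I" for i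
      using that nN nT by blast+
    show "(\<exists>b1\<in>B. \<exists>b2\<in>B. n i \<otimes> b \<otimes> w = b1 \<otimes> (n i \<otimes> w) \<otimes> b2) \<or>
        (\<exists>b1\<in>B. \<exists>b2\<in>B. n i \<otimes> b \<otimes> w = b1 \<otimes> w \<otimes> b2)" if "i \<in> I" "w \<in> N" "b \<in> B" for i w b
    proof -
      have "n i \<otimes> b \<otimes> w \<in> n i <# B #> w" using that(3) by (simp add: coset_conj_eq_image)
      then have "n i \<otimes> b \<otimes> w \<in> (B #> (n i \<otimes> w) <#> B) \<union> (B #> w <#> B)" using exch that by blast
      then show ?thesis unfolding set_mult_def r_coset_def by blast
    qed
    show "\<exists>b\<in>B. n i \<otimes> b \<otimes> inv (n i) \<notin> B" if i: "i \<in> I" for i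
    proof (rule ccontr)
      assume "\<not> ?thesis"
      then have *: "n i \<otimes> b \<otimes> inv (n i) \<in> B" if "b \<in> B" for b using that by blast
      have sq: "n i \<otimes> n i \<in> B" using nT BN i by blast
      \<comment> \<open>Containment of the conjugate in B upgrades to equality because the square of
        \<open>n i\<close> lies in T, hence in B; this turns the inequality of the axiom into an
        element b whose conjugate leaves B.\<close>
      have "B \<subseteq> n i <# B #> inv (n i)"
      proof
        fix b assume b: "b \<in> B"
        then have bc: "b \<in> carrier G" using subgroup.mem_carrier[OF B] by blast
        have "inv (n i \<otimes> n i) \<otimes> (n i \<otimes> b \<otimes> inv (n i)) \<otimes> (n i \<otimes> n i) \<in> B"
          using subgroup.m_closed[OF B subgroup.m_closed[OF B subgroup.m_inv_closed[OF B sq] *[OF b]] sq] .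
        moreover have "b = n i \<otimes> (inv (n i \<otimes> n i) \<otimes> (n i \<otimes> b \<otimes> inv (n i)) \<otimes> (n i \<otimes> n i)) \<otimes> inv (n i)"
          using n_carrier[OF i] bc by (simp add: group_simps)
        ultimately show "b \<in> n i <# B #> inv (n i)" unfolding coset_conj_eq_image by blast
      qed
      moreover have "n i <# B #> inv (n i) \<subseteq> B" unfolding coset_conj_eq_image using * by blast
      ultimately show False using nondeg i by blast
    qed
  qed
qed

context BN_pair
begin

lemma normalizer_overgroup:
  assumes P: "subgroup P G" "B \<subseteq> P"
  shows "normalizer G P = P"
proof
  have PG: "P \<subseteq> carrier G" using P subgroup.subset by blast
  show "normalizer G P \<subseteq> P"
  proof
    fix g assume "g \<in> normalizer G P"
    then have g: "g \<in> carrier G" "conj_set g P = P" using normalizer_iff[OF PG] by auto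
    then have "g \<otimes> b \<otimes> inv g \<in> P" if "b \<in> B" for b using that P(2) by blast
    then show "g \<in> P" using mem_overgroup[OF P g(1)] by blast
  qed
  show "P \<subseteq> normalizer G P"
  proof
    fix g assume g: "g \<in> P"
    then have gG: "g \<in> carrier G" using PG by blast
    have sub: "conj_set h P \<subseteq> P" if "h \<in> P" for h
      using that subgroup.m_closed[OF P(1)] subgroup.m_inv_closed[OF P(1)] by blast
    have "P = conj_set g (conj_set (inv g) P)" using conj_set_inv[OF PG, of "inv g"] gG by simp
    also have "\<dots> \<subseteq> conj_set g P" using sub[OF subgroup.m_inv_closed[OF P(1) g]] by blast
    finally show "g \<in> normalizer G P" using normalizer_iff[OF PG] gG sub[OF g] by blast
  qed
qed

text \<open>The normal closure of P in W is itself an overgroup of B, and every w in W conjugates B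
  into it. Applying \<open>mem_overgroup\<close> to the closure rather than to P therefore puts w
  inside.\<close>

lemma normally_saturating_overgroup:
  assumes P: "subgroup P G" "B \<subseteq> P"
  shows "normally_saturating G P"
  unfolding normally_saturating_def
proof (intro conjI allI impI)
  show "subgroup P G" by (rule P)
  fix W assume W: "subgroup W G \<and> P \<subseteq> W"
  have WG: "W \<subseteq> carrier G" using W subgroup.subset by blast
  have PG: "P \<subseteq> carrier G" using P subgroup.subset by blast
  have conj_mem: "w \<otimes> v \<otimes> inv w \<in> normal_closure G W P" if "w \<in> W" "v \<in> P" for w v
    unfolding normal_closure_def coset_conj_eq_image using that by (intro generate.incl) blast
  have closure: "subgroup (normal_closure G W P) G"
    unfolding normal_closure_def coset_conj_eq_image
    using WG PG by (intro generate_is_subgroup) blast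
  have "B \<subseteq> normal_closure G W P"
  proof
    fix b assume "b \<in> B"
    then show "b \<in> normal_closure G W P"
      using conj_mem[of \<one> b] P(2) subgroup.one_closed[of W G] W by auto
  qed
  then have "W \<subseteq> normal_closure G W P"
    using mem_overgroup[OF closure] conj_mem P(2) WG by blast
  moreover have "normal_closure G W P \<subseteq> W"
  proof (rule normal_closure_subset)
    show "subgroup W G" using W by blast
    fix w v assume "w \<in> W" "v \<in> P"
    then show "w \<otimes> v \<otimes> inv w \<in> W"
      using W subgroup.m_closed[of W G] subgroup.m_inv_closed[of W G] by blast
  qed
  ultimately show "normal_closure G W P = W" by blast
qed

lemma B_nontrivial: "I \<noteq> {} \<Longrightarrow> B \<noteq> {\<one>}"
  using nondegenerate B_one by (metis all_not_in_conv n_carrier r_inv r_one singletonD)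

end

section \<open>Standard parabolics as the overgroups of B\<close>

context chevalley
begin

context
  fixes N T :: "('v, 'k::{field,finite}) lin set"
  assumes BN: "BN_pair (S :: ('v, 'k) lin monoid) (chev_B \<Phi> \<Delta> c) N T \<Delta> (\<lambda>r. nr r 1)"
begin

interpretation BN_pair "S :: ('v, 'k) lin monoid" "chev_B \<Phi> \<Delta> c" N T \<Delta> "\<lambda>r. nr r 1"
  by (rule BN)

lemma std_parabolic_all: "Q \<Delta> = carrier (S :: ('v, 'k) lin monoid)"
  using overgroup_eqI[OF std_parabolic_subgroup chev_B_std_parabolic S.subgroup_self chev_B_carrier]
    weyl_elt_std_parabolic[OF order_refl] weyl_elt_carrier \<Delta>_sub by blast

text \<open>If \<open>Q K\<close> contained the Weyl element of some a outside K, the parabolic for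
  \<open>\<Delta> - {a}\<close> would contain the Weyl elements of all simple roots and hence be the
  whole group, against \<open>std_parabolic_proper\<close>.\<close>

lemma weyl_elt_std_parabolic_iff:
  assumes K: "K \<subseteq> \<Delta>" and a: "a \<in> \<Delta>"
  shows "nr a (1 :: 'k) \<in> Q K \<longleftrightarrow> a \<in> K"
proof
  assume w: "nr a (1 :: 'k) \<in> Q K"
  show "a \<in> K"
  proof (rule ccontr)
    assume "a \<notin> K"
    let ?Q = "Q (\<Delta> - {a}) :: ('v, 'k) lin set"
    have "nr a 1 \<in> ?Q" using w std_parabolic_mono[of K "\<Delta> - {a}"] K \<open>a \<notin> K\<close> by blast
    moreover have "nr b 1 \<in> ?Q" if "b \<in> \<Delta>" "b \<noteq> a" for b
      using weyl_elt_std_parabolic[of "\<Delta> - {a}" b] that by blast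
    ultimately have "nr b 1 \<in> ?Q" if "b \<in> \<Delta>" for b using that by blast
    then have "?Q = carrier S"
      using overgroup_eqI[OF std_parabolic_subgroup chev_B_std_parabolic S.subgroup_self chev_B_carrier, of "\<Delta> - {a}"]
        weyl_elt_carrier \<Delta>_sub by blast
    then show False using std_parabolic_proper[OF a, of "\<Delta> - {a}"] by blast
  qed
qed (use weyl_elt_std_parabolic K in blast)

lemma std_parabolic_overgroup:
  assumes P: "subgroup P S" "chev_B \<Phi> \<Delta> c \<subseteq> (P :: ('v, 'k) lin set)"
  shows "\<exists>K\<subseteq>\<Delta>. P = Q K"
proof -
  let ?K = "{a \<in> \<Delta>. nr a 1 \<in> P}"
  have "P = Q ?K"
    using weyl_elt_std_parabolic_iff[of ?K]
    by (intro overgroup_eqI[OF P std_parabolic_subgroup chev_B_std_parabolic]) auto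
  moreover have "?K \<subseteq> \<Delta>" by blast
  ultimately show ?thesis by (intro exI conjI)
qed

lemma std_parabolic_subset_iff:
  assumes "J \<subseteq> \<Delta>" "K \<subseteq> \<Delta>" "Q J \<subseteq> (Q K :: ('v, 'k) lin set)"
  shows "J \<subseteq> K"
  using weyl_elt_std_parabolic_iff[OF assms(1)] weyl_elt_std_parabolic_iff[OF assms(2)] assms by blast

lemma std_parabolic_stable_overgroup:
  assumes J: "J \<subset> \<Delta>"
    and unstable: "\<And>K. \<lbrakk>J \<subset> K; K \<subset> \<Delta>\<rbrakk> \<Longrightarrow> \<not> stable_class S X (Q K :: ('v, 'k) lin set)"
    and W: "subgroup W S" "Q J \<subseteq> W" "stable_class S X W"
  shows "W = Q J \<or> W = carrier S"
proof -
  obtain K where K: "K \<subseteq> \<Delta>" "W = Q K"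
    using std_parabolic_overgroup[OF W(1)] W(2) chev_B_std_parabolic by blast
  then have "J \<subseteq> K" using std_parabolic_subset_iff J W(2) by blast
  then consider "K = J" | "K = \<Delta>" | "J \<subset> K" "K \<subset> \<Delta>" using K(1) by blast
  then show ?thesis
  proof cases
    case 3
    then show ?thesis using unstable W(3) K(2) by blast
  qed (use K std_parabolic_all in blast)+
qed

lemma std_parabolic_basic:
  assumes J: "J \<subset> \<Delta>"
  shows "normalizer S (Q J) = (Q J :: ('v, 'k) lin set)"
    "normally_saturating S (Q J :: ('v, 'k) lin set)"
    "{\<one>\<^bsub>S\<^esub>} \<subset> (Q J :: ('v, 'k) lin set)"
    "Q J \<subset> carrier (S :: ('v, 'k) lin monoid)"
proof -
  let ?V = "Q J :: ('v, 'k) lin set"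
  show "normalizer S ?V = ?V" "normally_saturating S ?V"
    using normalizer_overgroup normally_saturating_overgroup std_parabolic_subgroup chev_B_std_parabolic by blast+
  have "chev_B \<Phi> \<Delta> c \<noteq> {\<one>\<^bsub>S :: ('v, 'k) lin monoid\<^esub>}" using B_nontrivial J by blast
  then show "{\<one>\<^bsub>S\<^esub>} \<subset> ?V"
    using B_one subsetD[OF chev_B_std_parabolic, of _ J] by blast
  obtain a where "a \<in> \<Delta>" "a \<notin> J" using J by blast
  then have "?V \<noteq> carrier S" using std_parabolic_proper J by blast
  then show "?V \<subset> carrier S" using subgroup.subset[OF std_parabolic_subgroup] by blast
qed

end
end

text \<open>A class above that of V has a representative containing V itself, and this
  representative is again stable, so \<open>max\<close> applies to it. It is not the whole group,
  since its class has a proper member.\<close>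

lemma (in group) maximal_classI:
  assumes X: "X \<subseteq> auto G" and V: "subgroup V G" "conj_class G V \<in> stable_poset G X"
    and max: "\<And>W. \<lbrakk>subgroup W G; V \<subseteq> W; stable_class G X W\<rbrakk> \<Longrightarrow> W = V \<or> W = carrier G"
  shows "maximal_class G X (conj_class G V)"
  unfolding maximal_class_def
proof (intro conjI ballI impI)
  show "conj_class G V \<in> stable_poset G X" by (rule V)
  fix D assume D: "D \<in> stable_poset G X" and le: "class_le G (conj_class G V) D"
  have VG: "V \<subseteq> carrier G" using V subgroup.subset by blast
  obtain W where W: "D = conj_class G W" "subgroup W G" "W \<subset> carrier G" "stable_class G X W"
    using D unfolding stable_poset_def by blast
  obtain V' U s where U: "subgroup V' G" "subgroup U G" "conj_class G V = conj_class G V'" "D = conj_class G U"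
    "s \<in> carrier G" "V' \<subseteq> inv s <# U #> s"
    using le unfolding class_le_def by blast
  have UG: "U \<subseteq> carrier G" using U(2) subgroup.subset by blast
  have "V \<in> conj_class G V'" using conj_class_self[OF VG] U(3) by simp
  then obtain g where g: "g \<in> carrier G" "V = conj_set g V'" using conj_class_iff by blast
  \<comment> \<open>The order on classes compares some representatives V' and U. Conjugating V' back
    to V by g moves the containing conjugate of U along, which accounts for the product of g with
    the inverse of s.\<close>
  define W' where "W' = conj_set (g \<otimes> inv s) U"
  have "V' \<subseteq> conj_set (inv s) U" using U(5,6) by (simp add: coset_conj_eq_image)
  then have VW: "V \<subseteq> W'"
    unfolding W'_def g(2) using conj_set_mult[OF UG g(1), of "inv s"] U(5) by (simp add: image_mono)
  have gs: "g \<otimes> inv s \<in> carrier G" using g U(5) by simp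
  have sub: "subgroup W' G" unfolding W'_def using subgroup_conj_set[OF U(2) gs] .
  have "W' \<in> conj_class G U" using conj_class_iff gs W'_def by blast
  then have D': "conj_class G W' = D" using conj_class_eq[OF UG] U(4) by simp
  have WG: "W \<subseteq> carrier G" using W(3) by blast
  have W'W: "W' \<in> conj_class G W"
    using conj_class_self[OF subgroup.subset[OF sub]] D' W(1) by simp
  have "stable_class G X W'" using stable_class_conj[OF X WG W'W W(4)] .
  then have "W' = V \<or> W' = carrier G" using max sub VW by blast
  moreover have "W' \<noteq> carrier G"
  proof
    assume full: "W' = carrier G"
    obtain h where h: "h \<in> carrier G" "W' = conj_set h W" using W'W conj_class_iff by blast
    have "x \<in> W" if x: "x \<in> carrier G" for x
    proof -
      have "h \<otimes> x \<otimes> inv h \<in> conj_set h W" using full h x by (metis inv_closed m_closed)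
      then obtain w where w: "w \<in> W" "h \<otimes> x \<otimes> inv h = h \<otimes> w \<otimes> inv h" by blast
      then have "x = w" using h(1) x WG by (simp add: subset_iff m_assoc)
      then show ?thesis using w by simp
    qed
    then show False using W(3) by blast
  qed
  ultimately show "D = conj_class G V" using D' by simp
qed

text \<open>Membership in the poset speaks about some representative of the class; normalizers
  commute with conjugation, which carries the property over to W.\<close>

lemma (in group) normalizer_of_stable_poset:
  assumes W: "subgroup W G" "conj_class G W \<in> stable_poset G X"
  shows "normalizer G W = W"
proof -
  obtain W0 where W0: "conj_class G W = conj_class G W0" "subgroup W0 G" "normalizer G W0 = W0"
    using W(2) unfolding stable_poset_def by blast
  have "W \<in> conj_class G W0" using conj_class_self[OF subgroup.subset[OF W(1)]] W0(1) by simp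
  then obtain g where "g \<in> carrier G" "W = conj_set g W0" using conj_class_iff by blast
  then show ?thesis using normalizer_conj_set[OF subgroup.subset[OF W0(2)]] W0(3) by simp
qed

lemma coordinatesI:
  assumes "group S" "subgroup X (AutoGroup S)" "1 \<le> k" "normalized_model S X k G N \<phi>"
  shows "coordinates S G X k N \<phi>"
proof -
  have "X \<subseteq> auto S" using subgroup.subset[OF assms(2)] by (simp add: AutoGroup_def)
  then show ?thesis
    using assms(1,3,4)
    unfolding normalized_model_def unique_minimal_normal_def minimal_normal_def coordinates_def coordinates_axioms_def
    by blast
qed

theorem lemma3p6:
  fixes Phi Delta J :: "'v::euclidean_space set"
    and c :: "'v \<Rightarrow> 'v \<Rightarrow> int"
    and S :: "('v, 'k::{field,finite}) lin monoid"
    and X :: "(('v, 'k) lin \<Rightarrow> ('v, 'k) lin) set"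
    and V :: "('v, 'k) lin set"
  assumes "irreducible_root_system Phi"
    and "simple_system Phi Delta"
    and "chevalley_constants Phi Delta c"
    and "S = chevalley_group Phi Delta c"
    and "simple_group S"
    and "split_BN_pair CHAR('k) S (chev_B Phi Delta c) (chev_N Phi Delta c)
           (chev_U Phi Delta c) (chev_T Phi Delta c) Delta (\<lambda>r. weyl_elt Phi Delta c r 1)"
    and "card Delta \<ge> 2"
    and "subgroup X (AutoGroup S)"
    and "inner_auts S \<subseteq> X"
    and "J \<subset> Delta"
    and "V = std_parabolic Phi Delta c J"
    and "stable_class S X V"
    and "\<And>K. J \<subset> K \<Longrightarrow> K \<subset> Delta \<Longrightarrow> \<not> stable_class S X (std_parabolic Phi Delta c K)"
  shows "conj_class S V \<in> stable_poset S X \<and>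
         maximal_class S X (conj_class S V) \<and>
         normally_saturating S V \<and>
         (\<forall>k (G :: 'g monoid) N \<phi>. k \<ge> 1 \<and> normalized_model S X k G N \<phi> \<longrightarrow>
            power_normalizer G \<phi> k V \<inter> N = \<phi> ` pow_set V k \<and>
            power_normalizer G \<phi> k V <#>\<^bsub>G\<^esub> N = carrier G \<and>
            card (power_normalizer G \<phi> k V) = order (G Mod N) * card V ^ k \<and>
            maximal_subgroup G (power_normalizer G \<phi> k V) \<and>
            (\<forall>W. subgroup W S \<and> conj_class S W \<in> stable_poset S X \<and>
                 conj_class S W \<noteq> conj_class S V \<longrightarrow>
                 power_normalizer G \<phi> k W \<notin> conj_class G (power_normalizer G \<phi> k V)))"
proof -
  note S_def = assms(4)
  interpret chevalley Phi Delta c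
    using assms(1,2,3) by (simp add: chevalley_def chevalley_axioms_def root_system_def)
  interpret grp: group S unfolding S_def by (rule group_S)
  have X: "X \<subseteq> auto S" using subgroup.subset[OF assms(8)] by (simp add: AutoGroup_def)
  have BN: "BN_pair (chevalley_group Phi Delta c) (chev_B Phi Delta c) (chev_N Phi Delta c) (chev_T Phi Delta c)
      Delta (\<lambda>r. weyl_elt Phi Delta c r (1 :: 'k))"
    using grp.split_BN_pair_imp_BN_pair[OF assms(6)] unfolding S_def .
  note basic = std_parabolic_basic[OF BN assms(10), folded S_def assms(11)]
  have V: "subgroup V S" unfolding assms(11) S_def by (rule std_parabolic_subgroup)
  have max: "W = V \<or> W = carrier S" if "subgroup W S" "V \<subseteq> W" "stable_class S X W" for W
    using std_parabolic_stable_overgroup[OF BN assms(10), folded S_def, OF assms(13), folded assms(11)] that by blast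
  have poset: "conj_class S V \<in> stable_poset S X"
    unfolding stable_poset_def using V basic assms(12) by blast
  have model: "power_normalizer G \<phi> k V \<inter> N = \<phi> ` pow_set V k \<and>
      power_normalizer G \<phi> k V <#>\<^bsub>G\<^esub> N = carrier G \<and>
      card (power_normalizer G \<phi> k V) = order (G Mod N) * card V ^ k \<and>
      maximal_subgroup G (power_normalizer G \<phi> k V) \<and>
      (\<forall>W. subgroup W S \<and> conj_class S W \<in> stable_poset S X \<and> conj_class S W \<noteq> conj_class S V \<longrightarrow>
         power_normalizer G \<phi> k W \<notin> conj_class G (power_normalizer G \<phi> k V))"
    if "k \<ge> 1" "normalized_model S X k G N \<phi>" for k and G :: "'g monoid" and N \<phi>
  proof -
    interpret coordinates S G X k N \<phi>
      using coordinatesI[OF grp.is_group assms(8) that] .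
    show ?thesis
    proof (intro conjI allI impI)
      show "power_normalizer G \<phi> k V \<inter> N = \<phi> ` pow_set V k"
        using power_normalizer_Int_N[OF V basic(1)] unfolding blk_def .
      show "power_normalizer G \<phi> k V <#>\<^bsub>G\<^esub> N = carrier G"
        using power_normalizer_N[OF subgroup.subset[OF V] assms(12)] .
      show "card (power_normalizer G \<phi> k V) = order (G Mod N) * card V ^ k"
        using card_power_normalizer[OF V basic(1) assms(12)] .
      show "maximal_subgroup G (power_normalizer G \<phi> k V)"
        using maximal_power_normalizer[OF basic(2,1) _ assms(12) max] basic(4) by blast
      fix W assume W: "subgroup W S \<and> conj_class S W \<in> stable_poset S X \<and> conj_class S W \<noteq> conj_class S V"
      then have "normalizer S W = W" using grp.normalizer_of_stable_poset by blast
      then show "power_normalizer G \<phi> k W \<notin> conj_class G (power_normalizer G \<phi> k V)"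
        using conj_class_power_normalizer[OF V basic(1) assms(12)] W by blast
    qed
  qed
  show ?thesis
  proof (intro conjI)
    show "maximal_class S X (conj_class S V)"
      by (rule grp.maximal_classI[OF X V poset]) (rule max)
    show "conj_class S V \<in> stable_poset S X" by (rule poset)
    show "normally_saturating S V" by (rule basic(2))
  qed (intro allI impI, elim conjE, rule model)
qed

end
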